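(* Let $(F_k)_{k\in\mathbb N}$ be a sequence in $\mathcal I$. Then there exist a subsequence, not relabeled, and a functional $F\in\mathcal I_{\mathrm{sc}}$ such that for every $D\in\mathcal O(\mathbb R^N)$ the sequence $(F_k(\cdot,D))_{k\in\mathbb N}$ $\Gamma$-converges to $F(\cdot,D)$ with respect to the topology induced by the norm $\|\cdot\|_D^{\mathcal A}$ on $L^p(D;\mathbb R^d)$. If, in addition, $F_k\in\mathcal I_{\mathrm{Lip}}$ for every $k\in\mathbb N$, then $F\in\mathcal I_{\mathrm{Lip}}$.
   Context: Fixed throughout: positive integers $N,d,l$ and $p,q\in(1,+\infty)$ with $\frac1p+\frac1q=1$. $\mathcal O(\mathbb R^N)$ is the collection of all bounded open subsets of $\mathbb R^N$; for $D\in\mathcal O(\mathbb R^N)$, $\mathcal O(D)$ is the collection of all open subsets of $D$. $W^{-1,p}(D;\mathbb R^m)$ is the dual of $W^{1,q}_0(D;\mathbb R^m)$, the latter normed by $\|\nabla u\|_{L^q(D)}$, with the dual norm; $L^p$ functions are viewed as elements of it by integration. Operator: $A^1,\dots,A^N\in\mathbb R^{l\times d}$ are fixed matrices with the constant-rank property: there is $r\in\mathbb N$ with $\operatorname{rank}\big(\sum_{i=1}^N A^iw_i\big)=r$ for all $w\in\mathbb R^N\setminus\{0\}$. For $u\in L^p_{\mathrm{loc}}(\mathbb R^N;\mathbb R^d)$, $\mathcal Au$ is the distribution $\langle\mathcal Au,\psi\rangle=-\sum_i\int_{\mathbb R^N}(A^iu)\cdot\partial_i\psi\,dx$, $\psi\in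 C_c^\infty(\mathbb R^N;\mathbb R^l)$. For $D\in\mathcal O(\mathbb R^N)$ and $u\in L^p(D;\mathbb R^d)$, $\mathcal A_Du\in W^{-1,p}(D;\mathbb R^l)$ is defined by $\langle\mathcal A_Du,\psi\rangle=-\sum_i\int_D(A^iu)\cdot\partial_i\psi\,dx$, $\psi\in W^{1,q}_0(D;\mathbb R^l)$. Set $\|u\|_D^{\mathcal A}:=\|u\|_{W^{-1,p}(D;\mathbb R^d)}+\|\mathcal A_Du\|_{W^{-1,p}(D;\mathbb R^l)}$. $\mathcal A$-quasiconvexity and constants: a locally bounded Borel function $g:\mathbb R^d\to\mathbb R$ is $\mathcal A$-quasiconvex if, for a cube $Q\subset\mathbb R^N$ (the notion does not depend on $Q$), $g(\xi)\le\frac1{|Q|}\int_Qg(\xi+w(x))\,dx$ for every $\xi\in\mathbb R^d$ and every $Q$-periodic $w\in C^\infty(\mathbb R^N;\mathbb R^d)$ with $\mathcal Aw=0$ in $\mathbb R^N$ and $\int_Qw\,dx=0$. The wave cone is $\Lambda:=\bigcup_{w\in\mathbb R^N\setminus\{0\}}\ker\big(\sum_iA^iw_i\big)\subset\mathbb R^d$. Constants $c_0\ge1$ and $c_1\ge\hat c_1\ge1$ are fixed, where $\hat c_1$ is a constant such that, in the case $\operatorname{span}(\Lambda)=\mathbb R^d$, every $\mathcal A$-quasiconvex $g:\mathbb R^d\to[0,+\infty)$ with $\frac1{c_0}|\xi|^p-c_0\le g(\xi)\le c_0(1+|\xi|^p)$ for all $\xi$ satisfies $|g(\xi_1)-g(\xi_2)|\le\hat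 c_1\big(1+\min\{g(\xi_1),g(\xi_2)\}^{\frac{p-1}p}+|\xi_1-\xi_2|^{p-1}\big)|\xi_1-\xi_2|$ for all $\xi_1,\xi_2$ (such a constant exists in that case). Classes of functionals: $\mathcal I$ is the collection of all functionals $F$ assigning to each pair $(u,D)$, with $D\in\mathcal O(\mathbb R^N)$ and $u\in L^p(D;\mathbb R^d)$, a value $F(u,D)\in[0,+\infty)$ such that for all such $(u,D)$: (a) $\frac1{c_0}\|u\|_{L^p(D)}^p-c_0|D|\le F(u,D)\le c_0(|D|+\|u\|_{L^p(D)}^p)$; (b) the set function $B\mapsto F(u,B):=F(u|_B,B)$ on $\mathcal O(D)$ can be extended to a nonnegative measure on all Borel subsets of $D$. $\mathcal I_{\mathrm{Lip}}$ is the set of $F\in\mathcal I$ such that (c) $|F(u,D)-F(v,D)|\le c_1\big(|D|^{\frac{p-1}p}+\min\{F(u,D),F(v,D)\}^{\frac{p-1}p}+\|u-v\|_{L^p(D)}^{p-1}\big)\|u-v\|_{L^p(D)}$ for all $D\in\mathcal O(\mathbb R^N)$ and $u,v\in L^p(D;\mathbb R^d)$. $\mathcal I_{\mathrm{sc}}$ is the set of $F\in\mathcal I$ such that for every $D\in\mathcal O(\mathbb R^N)$ the functional $u\mapsto F(u,D)$ is lower semicontinuous for the topology induced on $L^p(D;\mathbb R^d)$ by $\|\cdot\|_D^{\mathcal A}$. *)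

theory Defs
  imports "HOL-Analysis.Analysis"
begin

section \<open>Lebesgue and Sobolev spaces\<close>

text \<open>
  Elements of \<open>L\<^sup>p(D)\<close> are represented by total functions; only the values on \<open>D\<close> matter, and
  the restriction of \<open>u\<close> to a subset is represented by \<open>u\<close> itself. Almost everywhere equal
  functions are not identified; that functionals on \<open>L\<^sup>p(D)\<close> respect this identification is
  an explicit requirement below.
\<close>

definition bounded_opens :: "(real^'n) set set" where
  "bounded_opens = {D. open D \<and> bounded D}"

definition Lp :: "real \<Rightarrow> (real^'n) set \<Rightarrow> (real^'n \<Rightarrow> 'b::euclidean_space) set" where
  "Lp p D = {u. u \<in> borel_measurable (lebesgue_on D) \<and>
                integrable (lebesgue_on D) (\<lambda>x. norm (u x) powr p)}"

definition Lp_norm :: "real \<Rightarrow> (real^'n) set \<Rightarrow> (real^'n \<Rightarrow> 'b::euclidean_space) \<Rightarrow> real" where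
  "Lp_norm p D u = (\<integral>x. norm (u x) powr p \<partial>lebesgue_on D) powr (1 / p)"

definition partial_deriv :: "'n \<Rightarrow> (real^'n \<Rightarrow> 'b::euclidean_space) \<Rightarrow> real^'n \<Rightarrow> 'b" where
  "partial_deriv i f x = frechet_derivative f (at x) (axis i 1)"

primrec C_k :: "nat \<Rightarrow> (real^'n \<Rightarrow> 'b::euclidean_space) \<Rightarrow> bool" where
  "C_k 0 f \<longleftrightarrow> continuous_on UNIV f"
| "C_k (Suc k) f \<longleftrightarrow> (\<forall>x. f differentiable at x) \<and> (\<forall>i. C_k k (partial_deriv i f))"

definition C_infinity :: "(real^'n \<Rightarrow> 'b::euclidean_space) set" where
  "C_infinity = {f. \<forall>k. C_k k f}"

definition test_functions :: "(real^'n) set \<Rightarrow> (real^'n \<Rightarrow> 'b::euclidean_space) set" where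
  "test_functions D = {\<phi> \<in> C_infinity. \<exists>K. compact K \<and> K \<subseteq> D \<and> (\<forall>x. x \<notin> K \<longrightarrow> \<phi> x = 0)}"

definition locally_integrable :: "(real^'n) set \<Rightarrow> (real^'n \<Rightarrow> 'b::euclidean_space) \<Rightarrow> bool" where
  "locally_integrable D u \<longleftrightarrow> (\<forall>K. compact K \<and> K \<subseteq> D \<longrightarrow> integrable (lebesgue_on K) u)"

text \<open>The entry \<open>G x $ j $ i\<close> is the weak derivative of the component \<open>\<psi>\<^sub>j\<close> in direction \<open>i\<close>; the
  norm of \<open>G x\<close> is the Frobenius norm.\<close>

definition has_weak_grad ::
    "(real^'n) set \<Rightarrow> (real^'n \<Rightarrow> real^'m) \<Rightarrow> (real^'n \<Rightarrow> real^'n^'m) \<Rightarrow> bool" where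
  "has_weak_grad D \<psi> G \<longleftrightarrow>
     locally_integrable D \<psi> \<and> locally_integrable D G \<and>
     (\<forall>\<phi> \<in> test_functions D. \<forall>i j.
        (\<integral>x. \<psi> x $ j * partial_deriv i \<phi> x \<partial>lebesgue_on D) =
        - (\<integral>x. G x $ j $ i * (\<phi> x :: real) \<partial>lebesgue_on D))"

definition weak_grad :: "(real^'n) set \<Rightarrow> (real^'n \<Rightarrow> real^'m) \<Rightarrow> real^'n \<Rightarrow> real^'n^'m" where
  "weak_grad D \<psi> = (SOME G. has_weak_grad D \<psi> G)"

definition W1 :: "real \<Rightarrow> (real^'n) set \<Rightarrow> (real^'n \<Rightarrow> real^'m) set" where
  "W1 q D = {\<psi> \<in> Lp q D. \<exists>G \<in> Lp q D. has_weak_grad D \<psi> G}"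

definition W1_norm :: "real \<Rightarrow> (real^'n) set \<Rightarrow> (real^'n \<Rightarrow> real^'m) \<Rightarrow> real" where
  "W1_norm q D \<psi> = Lp_norm q D \<psi> + Lp_norm q D (weak_grad D \<psi>)"

text \<open>The closure of the test functions in \<open>W\<^sup>1\<^sup>,\<^sup>q(D)\<close>.\<close>

definition W10 :: "real \<Rightarrow> (real^'n) set \<Rightarrow> (real^'n \<Rightarrow> real^'m) set" where
  "W10 q D = {\<psi> \<in> W1 q D. \<exists>\<phi>. (\<forall>k::nat. \<phi> k \<in> test_functions D) \<and>
                 (\<lambda>k. W1_norm q D (\<lambda>x. \<phi> k x - \<psi> x)) \<longlonglongrightarrow> 0}"

text \<open>
  The dual norm of a functional \<open>T\<close> on \<open>W\<^sub>0\<^sup>1\<^sup>,\<^sup>q(D)\<close> normed by the \<open>L\<^sup>q\<close> norm of the gradient, that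
  is, the norm of \<open>W\<^sup>-\<^sup>1\<^sup>,\<^sup>p(D)\<close> for conjugate \<open>p\<close>, \<open>q\<close>. The supremum is taken in the reals and is
  meaningful for bounded \<open>T\<close>; the functionals \<open>of_Lp D u\<close> and \<open>A_op A D u\<close> are bounded for bounded
  \<open>D\<close> and \<open>u \<in> L\<^sup>p(D)\<close> (Poincare and Hoelder inequalities).
\<close>

definition dual_norm ::
    "real \<Rightarrow> (real^'n) set \<Rightarrow> ((real^'n \<Rightarrow> real^'m) \<Rightarrow> real) \<Rightarrow> real" where
  "dual_norm q D T = (SUP \<psi> \<in> {\<psi> \<in> W10 q D. Lp_norm q D (weak_grad D \<psi>) \<le> 1}. \<bar>T \<psi>\<bar>)"

definition of_Lp :: "(real^'n) set \<Rightarrow> (real^'n \<Rightarrow> real^'m) \<Rightarrow> (real^'n \<Rightarrow> real^'m) \<Rightarrow> real" where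
  "of_Lp D u \<psi> = (\<integral>x. u x \<bullet> \<psi> x \<partial>lebesgue_on D)"

section \<open>The differential operator\<close>

definition symbol :: "('n::finite \<Rightarrow> real^'d^'l) \<Rightarrow> real^'n \<Rightarrow> real^'d^'l" where
  "symbol A w = (\<Sum>i\<in>UNIV. w $ i *\<^sub>R A i)"

definition constant_rank :: "('n::finite \<Rightarrow> real^'d^'l) \<Rightarrow> bool" where
  "constant_rank A \<longleftrightarrow> (\<exists>r. \<forall>w. w \<noteq> 0 \<longrightarrow> rank (symbol A w) = r)"

definition wave_cone :: "('n::finite \<Rightarrow> real^'d^'l) \<Rightarrow> (real^'d) set" where
  "wave_cone A = (\<Union>w \<in> - {0}. {\<xi>. symbol A w *v \<xi> = 0})"

definition A_distr ::
    "('n::finite \<Rightarrow> real^'d^'l) \<Rightarrow> (real^'n \<Rightarrow> real^'d) \<Rightarrow> (real^'n \<Rightarrow> real^'l) \<Rightarrow> real" where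
  "A_distr A u \<psi> = - (\<Sum>i\<in>UNIV. \<integral>x. (A i *v u x) \<bullet> partial_deriv i \<psi> x \<partial>lebesgue)"

text \<open>The functional \<open>\<A>\<^sub>D u\<close> on \<open>W\<^sub>0\<^sup>1\<^sup>,\<^sup>q(D)\<close>; the column \<open>i\<close> of the weak gradient is the weak
  partial derivative in direction \<open>i\<close>.\<close>

definition A_op ::
    "('n::finite \<Rightarrow> real^'d^'l) \<Rightarrow> (real^'n) set \<Rightarrow> (real^'n \<Rightarrow> real^'d) \<Rightarrow> (real^'n \<Rightarrow> real^'l) \<Rightarrow> real" where
  "A_op A D u \<psi> =
     - (\<Sum>i\<in>UNIV. \<integral>x. (A i *v u x) \<bullet> column i (weak_grad D \<psi> x) \<partial>lebesgue_on D)"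

definition A_norm ::
    "('n::finite \<Rightarrow> real^'d^'l) \<Rightarrow> real \<Rightarrow> (real^'n) set \<Rightarrow> (real^'n \<Rightarrow> real^'d) \<Rightarrow> real" where
  "A_norm A q D u = dual_norm q D (of_Lp D u) + dual_norm q D (A_op A D u)"

definition A_topology ::
    "('n::finite \<Rightarrow> real^'d^'l) \<Rightarrow> real \<Rightarrow> real \<Rightarrow> (real^'n) set \<Rightarrow> (real^'n \<Rightarrow> real^'d) topology" where
  "A_topology A p q D = topology (\<lambda>U. U \<subseteq> Lp p D \<and>
     (\<forall>u\<in>U. \<exists>\<epsilon>>0. \<forall>v\<in>Lp p D. A_norm A q D (\<lambda>x. v x - u x) < \<epsilon> \<longrightarrow> v \<in> U))"

lemma openin_A_topology:
  "openin (A_topology A p q D) U \<longleftrightarrow> U \<subseteq> Lp p D \<and>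
     (\<forall>u\<in>U. \<exists>\<epsilon>>0. \<forall>v\<in>Lp p D. A_norm A q D (\<lambda>x. v x - u x) < \<epsilon> \<longrightarrow> v \<in> U)"
proof -
  have "istopology (\<lambda>U. U \<subseteq> Lp p D \<and>
     (\<forall>u\<in>U. \<exists>\<epsilon>>0. \<forall>v\<in>Lp p D. A_norm A q D (\<lambda>x. v x - u x) < \<epsilon> \<longrightarrow> v \<in> U))"
    (is "istopology ?P")
    unfolding istopology_def
  proof (intro conjI allI impI)
    fix S T assume S: "?P S" and T: "?P T"
    then show "S \<inter> T \<subseteq> Lp p D" by blast
    show "\<forall>u\<in>S \<inter> T. \<exists>\<epsilon>>0. \<forall>v\<in>Lp p D. A_norm A q D (\<lambda>x. v x - u x) < \<epsilon> \<longrightarrow> v \<in> S \<inter> T"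
    proof
      fix u assume "u \<in> S \<inter> T"
      with S T obtain e1 e2 where
        "e1 > 0" "\<forall>v\<in>Lp p D. A_norm A q D (\<lambda>x. v x - u x) < e1 \<longrightarrow> v \<in> S"
        "e2 > 0" "\<forall>v\<in>Lp p D. A_norm A q D (\<lambda>x. v x - u x) < e2 \<longrightarrow> v \<in> T"
        by blast
      then show "\<exists>\<epsilon>>0. \<forall>v\<in>Lp p D. A_norm A q D (\<lambda>x. v x - u x) < \<epsilon> \<longrightarrow> v \<in> S \<inter> T"
        by (intro exI[of _ "min e1 e2"]) auto
    qed
  next
    fix \<K> assume K: "\<forall>S\<in>\<K>. ?P S"
    then show "\<Union>\<K> \<subseteq> Lp p D" by blast
    show "\<forall>u\<in>\<Union>\<K>. \<exists>\<epsilon>>0. \<forall>v\<in>Lp p D. A_norm A q D (\<lambda>x. v x - u x) < \<epsilon> \<longrightarrow> v \<in> \<Union>\<K>"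
    proof
      fix u assume "u \<in> \<Union>\<K>"
      then obtain S where "S \<in> \<K>" "u \<in> S" by blast
      with K show "\<exists>\<epsilon>>0. \<forall>v\<in>Lp p D. A_norm A q D (\<lambda>x. v x - u x) < \<epsilon> \<longrightarrow> v \<in> \<Union>\<K>"
        by (meson UnionI)
    qed
  qed
  then show ?thesis by (simp add: A_topology_def topology_inverse')
qed

lemma topspace_A_topology: "topspace (A_topology A p q D) = Lp p D"
proof
  show "topspace (A_topology A p q D) \<subseteq> Lp p D"
    using openin_topspace[of "A_topology A p q D"] unfolding openin_A_topology by blast
  have "openin (A_topology A p q D) (Lp p D)"
    unfolding openin_A_topology by (blast intro: zero_less_one)
  then show "Lp p D \<subseteq> topspace (A_topology A p q D)" by (rule openin_subset)
qed

section \<open>Quasiconvexity\<close>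

text \<open>\<open>Q\<close> ranges over the axis-parallel cubes with lower corner \<open>a\<close> and side length \<open>s\<close>; the notion
  does not depend on the choice of the cube.\<close>

definition A_quasiconvex :: "('n::finite \<Rightarrow> real^'d^'l) \<Rightarrow> (real^'d \<Rightarrow> real) \<Rightarrow> bool" where
  "A_quasiconvex A g \<longleftrightarrow>
     g \<in> borel_measurable borel \<and> (\<forall>K. bounded K \<longrightarrow> bounded (g ` K)) \<and>
     (\<exists>(a :: real^'n) (s :: real). s > 0 \<and>
       (let Q = cbox a (a + (\<chi> i. s)) in
         \<forall>\<xi> w. w \<in> C_infinity \<and> (\<forall>x i. w (x + axis i s) = w x) \<and>
           (\<forall>\<psi> \<in> test_functions UNIV. A_distr A w \<psi> = 0) \<and>
           (\<integral>x. w x \<partial>lebesgue_on Q) = 0 \<longrightarrow>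
           g \<xi> \<le> (1 / measure lebesgue Q) * (\<integral>x. g (\<xi> + w x) \<partial>lebesgue_on Q)))"

definition quasiconvex_Lipschitz_const ::
    "('n::finite \<Rightarrow> real^'d^'l) \<Rightarrow> real \<Rightarrow> real \<Rightarrow> real \<Rightarrow> bool" where
  "quasiconvex_Lipschitz_const A p c0 c \<longleftrightarrow>
     (\<forall>g. A_quasiconvex A g \<and> (\<forall>\<xi>. 0 \<le> g \<xi>) \<and>
        (\<forall>\<xi>. (1 / c0) * norm \<xi> powr p - c0 \<le> g \<xi> \<and> g \<xi> \<le> c0 * (1 + norm \<xi> powr p)) \<longrightarrow>
        (\<forall>\<xi>1 \<xi>2. \<bar>g \<xi>1 - g \<xi>2\<bar> \<le>
           c * (1 + min (g \<xi>1) (g \<xi>2) powr ((p - 1) / p) + norm (\<xi>1 - \<xi>2) powr (p - 1))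
             * norm (\<xi>1 - \<xi>2)))"

section \<open>Classes of functionals\<close>

text \<open>Only the values \<open>F u D\<close> with \<open>D\<close> bounded and open and \<open>u \<in> L\<^sup>p(D)\<close> are meaningful.\<close>

type_synonym ('n, 'd) functional = "(real^'n \<Rightarrow> real^'d) \<Rightarrow> (real^'n) set \<Rightarrow> real"

definition class_I :: "real \<Rightarrow> real \<Rightarrow> ('n::finite, 'd::finite) functional set" where
  "class_I p c0 = {F. \<forall>D \<in> bounded_opens. \<forall>u \<in> Lp p D.
     (\<forall>v \<in> Lp p D. (AE x in lebesgue_on D. u x = v x) \<longrightarrow> F u D = F v D) \<and>
     0 \<le> F u D \<and>
     (1 / c0) * Lp_norm p D u powr p - c0 * measure lebesgue D \<le> F u D \<and>
     F u D \<le> c0 * (measure lebesgue D + Lp_norm p D u powr p) \<and>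
     (\<exists>\<mu>. space \<mu> = D \<and> sets \<mu> = sets (restrict_space borel D) \<and>
        (\<forall>B. open B \<and> B \<subseteq> D \<longrightarrow> emeasure \<mu> B = ennreal (F u B)))}"

definition class_I_Lip :: "real \<Rightarrow> real \<Rightarrow> real \<Rightarrow> ('n::finite, 'd::finite) functional set" where
  "class_I_Lip p c0 c1 = {F \<in> class_I p c0. \<forall>D \<in> bounded_opens. \<forall>u \<in> Lp p D. \<forall>v \<in> Lp p D.
     \<bar>F u D - F v D\<bar> \<le>
       c1 * (measure lebesgue D powr ((p - 1) / p) + min (F u D) (F v D) powr ((p - 1) / p)
             + Lp_norm p D (\<lambda>x. u x - v x) powr (p - 1)) * Lp_norm p D (\<lambda>x. u x - v x)}"

definition lower_semicontinuous_on_top :: "'a topology \<Rightarrow> ('a \<Rightarrow> real) \<Rightarrow> bool" where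
  "lower_semicontinuous_on_top T f \<longleftrightarrow> (\<forall>c. openin T {u \<in> topspace T. c < f u})"

definition class_I_sc ::
    "('n::finite \<Rightarrow> real^'d^'l) \<Rightarrow> real \<Rightarrow> real \<Rightarrow> real \<Rightarrow> ('n::finite, 'd::finite) functional set" where
  "class_I_sc A p q c0 = {F \<in> class_I p c0. \<forall>D \<in> bounded_opens.
     lower_semicontinuous_on_top (A_topology A p q D) (\<lambda>u. F u D)}"

section \<open>Gamma-convergence in a topological space\<close>

definition Gamma_liminf :: "'a topology \<Rightarrow> (nat \<Rightarrow> 'a \<Rightarrow> ereal) \<Rightarrow> 'a \<Rightarrow> ereal" where
  "Gamma_liminf T f u = (SUP U \<in> {U. openin T U \<and> u \<in> U}. liminf (\<lambda>k. INF v\<in>U. f k v))"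

definition Gamma_limsup :: "'a topology \<Rightarrow> (nat \<Rightarrow> 'a \<Rightarrow> ereal) \<Rightarrow> 'a \<Rightarrow> ereal" where
  "Gamma_limsup T f u = (SUP U \<in> {U. openin T U \<and> u \<in> U}. limsup (\<lambda>k. INF v\<in>U. f k v))"

definition Gamma_converges :: "'a topology \<Rightarrow> (nat \<Rightarrow> 'a \<Rightarrow> ereal) \<Rightarrow> ('a \<Rightarrow> ereal) \<Rightarrow> bool" where
  "Gamma_converges T f g \<longleftrightarrow>
     (\<forall>u \<in> topspace T. Gamma_liminf T f u = g u \<and> Gamma_limsup T f u = g u)"

end

theory Submission
  imports Defs "HOL-Library.Diagonal_Subsequence"
begin

text \<open>
  By density, the norms of \<open>W\<^sup>-\<^sup>1\<^sup>,\<^sup>p\<close> only see test functions, and the Poincare inequality makes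
  multiplication by a cutoff function continuous for \<open>\<parallel>\<cdot>\<parallel>\<^sup>\<A>\<close>. As \<open>L\<^sup>p(D)\<close> is separable, a diagonal argument
  gives a subsequence whose Gamma-liminf \<open>F'\<close> and Gamma-limsup \<open>F''\<close> agree on a countable family of open
  sets that separates compact sets from the complements of open ones. Gluing recovery sequences with the
  best of \<open>M\<close> cutoffs supported in disjoint layers yields \<open>F''(u, A' \<union> B) \<le> F''(u, A'') + F''(u, B)\<close> for
  \<open>A' \<subset>\<subset> A''\<close>. The growth from above then makes \<open>F''\<close> inner regular, so that \<open>F' = F''\<close> on all bounded
  open sets, and the criterion of De Giorgi and Letta gives the measure property. Coercivity passes to the
  limit because the \<open>L\<^sup>p\<close> norm is lower semicontinuous for \<open>\<parallel>\<cdot>\<parallel>\<^sup>\<A>\<close>, and the Lipschitz estimate because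
  recovery sequences can be translated by \<open>v - u\<close>.
\<close>

section \<open>Smooth functions\<close>

text \<open>The gluing step explains the topology. For a cutoff \<open>\<zeta>\<close> the
  distribution \<open>A(\<zeta> w)\<close> contains, besides \<open>\<zeta> A w\<close>, the sum of
  the terms \<open>(d_i \<zeta>) A^i w\<close>. Smallness of \<open>A w\<close> says nothing about
  them, but they are of order zero in \<open>w\<close> and so are controlled by the
  \<open>W^(-1,p)\<close> norm of \<open>w\<close>, the other summand of the norm. The constant in
  this estimate depends on the cutoff and hence on the number \<open>M\<close> of layers. The order
  of choices makes this harmless: coercivity bounds the \<open>L^p\<close> norms of almost optimal
  functions independently of \<open>M\<close>, so \<open>M\<close> is fixed by the admissible energy
  error, and the radius of the balls from which the functions are taken is fixed afterwards.

  The two limits have complementary virtues. The lower one is monotone, superadditive and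
  semicontinuous, the upper one is subadditive and inner regular. Monotonicity of the one and inner
  regularity of the other squeeze them together on every domain; from then on all these properties
  belong to one set function.\<close>

lemma partial_deriv_eq:
  assumes "(f has_derivative f') (at x)"
  shows "partial_deriv i f x = f' (axis i 1)"
  unfolding partial_deriv_def using frechet_derivative_at[OF assms] by simp

lemma C_k_continuous: "C_k k f \<Longrightarrow> continuous_on UNIV f"
  by (cases k) (auto intro!: continuous_at_imp_continuous_on differentiable_imp_continuous_within)

text \<open>The recursion asks for differentiability at every level but for continuity only at the
  bottom; there differentiability supplies it.\<close>

lemma C_k_SucD: "C_k (Suc k) f \<Longrightarrow> C_k k f"
proof (induction k arbitrary: f)
  case 0
  then show ?case using C_k_continuous C_k.simps(1) by blast
next
  case (Suc k)
  show ?case unfolding C_k.simps(2)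
    using Suc.prems unfolding C_k.simps(2)[of "Suc k"] using Suc.IH by blast
qed

lemma C_k_const: "C_k k (\<lambda>x::real^'n. c)"
proof (induction k arbitrary: c)
  case (Suc k)
  have "partial_deriv i (\<lambda>x::real^'n. c) = (\<lambda>x. 0)" for i
    by (rule ext, subst partial_deriv_eq[OF has_derivative_const]) simp
  moreover have "(\<lambda>x. c) differentiable at x" for x :: "real^'n" by simp
  ultimately show ?case using Suc unfolding C_k.simps by auto
qed simp

lemma C_k_linear:
  assumes "bounded_linear h" "C_k k f"
  shows "C_k k (\<lambda>x. h (f x))"
  using assms(2)
proof (induction k arbitrary: f)
  case 0
  then show ?case using bounded_linear.continuous_on[OF assms(1)] by simp
next
  case (Suc k)
  have d: "((\<lambda>x. h (f x)) has_derivative (\<lambda>v. h (frechet_derivative f (at x) v))) (at x)" for x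
    using Suc.prems by (intro bounded_linear.has_derivative[OF assms(1)]) (simp add: frechet_derivative_works)
  have "partial_deriv i (\<lambda>x. h (f x)) = (\<lambda>x. h (partial_deriv i f x))" for i
    by (rule ext) (simp add: partial_deriv_eq[OF d] partial_deriv_def)
  then show ?case using Suc d unfolding C_k.simps by (auto intro!: differentiableI)
qed

lemma C_k_add:
  assumes "C_k k f" "C_k k g"
  shows "C_k k (\<lambda>x. f x + g x)"
  using assms
proof (induction k arbitrary: f g)
  case 0
  then show ?case by (simp add: continuous_on_add)
next
  case (Suc k)
  have d: "((\<lambda>x. f x + g x) has_derivative
      (\<lambda>v. frechet_derivative f (at x) v + frechet_derivative g (at x) v)) (at x)" for x
    using Suc.prems by (intro has_derivative_add) (simp_all add: frechet_derivative_works)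
  have "partial_deriv i (\<lambda>x. f x + g x) = (\<lambda>x. partial_deriv i f x + partial_deriv i g x)" for i
    by (rule ext) (simp add: partial_deriv_eq[OF d] partial_deriv_def)
  then show ?case using Suc d unfolding C_k.simps by (auto intro!: differentiableI)
qed

lemma partial_deriv_bilinear:
  assumes "bounded_bilinear b" "f differentiable at x" "g differentiable at x"
  shows "partial_deriv i (\<lambda>x. b (f x) (g x)) x =
         b (f x) (partial_deriv i g x) + b (partial_deriv i f x) (g x)"
  unfolding partial_deriv_eq[OF bounded_bilinear.FDERIV[OF assms(1)
    frechet_derivative_works[THEN iffD1, OF assms(2)] frechet_derivative_works[THEN iffD1, OF assms(3)]]]
  by (simp add: partial_deriv_def)

text \<open>Products, scalar multiples and inner products at once: by the Leibniz rule a partial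
  derivative is a sum of two bilinear expressions in functions of class \<open>k\<close>.\<close>

lemma C_k_bilinear:
  assumes "bounded_bilinear b" "C_k k f" "C_k k g"
  shows "C_k k (\<lambda>x. b (f x) (g x))"
  using assms(2,3)
proof (induction k arbitrary: f g)
  case 0
  then show ?case using bounded_bilinear.continuous_on[OF assms(1)] by simp
next
  case (Suc k)
  have *: "C_k k f" "C_k k g"
    using Suc.prems C_k_SucD by blast+
  have d: "f differentiable at x" "g differentiable at x" for x using Suc.prems by auto
  have "partial_deriv i (\<lambda>x. b (f x) (g x)) =
     (\<lambda>x. b (f x) (partial_deriv i g x) + b (partial_deriv i f x) (g x))" for i
    by (rule ext, rule partial_deriv_bilinear[OF assms(1) d])
  moreover have "C_k k (\<lambda>x. b (f x) (partial_deriv i g x) + b (partial_deriv i f x) (g x))" for i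
    using Suc * by (intro C_k_add) auto
  moreover have "(\<lambda>x. b (f x) (g x)) differentiable at x" for x
    using bounded_bilinear.FDERIV[OF assms(1)
    frechet_derivative_works[THEN iffD1, OF d(1)] frechet_derivative_works[THEN iffD1, OF d(2)]]
    unfolding differentiable_def by blast
  ultimately show ?case by simp
qed

text \<open>The partial derivative \<open>- (1/g) (d_i g) (1/g)\<close> contains no new reciprocal,
  so the induction on \<open>k\<close> runs with \<open>g\<close> fixed.\<close>

lemma C_k_inverse:
  fixes g :: "real^'n \<Rightarrow> real"
  assumes "C_k k g" "\<And>x. g x \<noteq> 0"
  shows "C_k k (\<lambda>x. inverse (g x))"
  using assms(1)
proof (induction k)
  case 0
  then show ?case using assms(2) by (auto intro!: continuous_on_inverse)
next
  case (Suc k)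
  have d: "((\<lambda>x. inverse (g x)) has_derivative
      (\<lambda>v. - (inverse (g x) * frechet_derivative g (at x) v * inverse (g x)))) (at x)" for x
  proof -
    have "(g has_derivative frechet_derivative g (at x)) (at x)"
      using Suc.prems by (simp add: frechet_derivative_works)
    from Deriv.has_derivative_inverse[OF assms(2) this] show ?thesis .
  qed
  have "partial_deriv i (\<lambda>x. inverse (g x)) =
      (\<lambda>x. - (inverse (g x) * partial_deriv i g x * inverse (g x)))" for i
    by (rule ext) (simp add: partial_deriv_eq[OF d] partial_deriv_def)
  moreover have "C_k k (\<lambda>x. - (inverse (g x) * partial_deriv i g x * inverse (g x)))" for i
    using Suc C_k_SucD[OF Suc.prems]
    by (intro C_k_linear[OF bounded_linear_minus[OF bounded_linear_ident]]
      C_k_bilinear[OF bounded_bilinear_mult]) auto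
  ultimately show ?case using d unfolding C_k.simps by (auto intro!: differentiableI)
qed

text \<open>A smooth function of one real variable is given by the sequence \<open>h\<close> of its
  successive derivatives; the chain rule moves from \<open>h n\<close> to \<open>h (Suc n)\<close>,
  hence the induction over all \<open>n\<close> simultaneously.\<close>

lemma C_k_compose_real:
  fixes h :: "nat \<Rightarrow> real \<Rightarrow> real"
  assumes "\<And>n x. (h n has_real_derivative h (Suc n) x) (at x)" "C_k k g"
  shows "C_k k (\<lambda>x. h n (g x))"
  using assms(2)
proof (induction k arbitrary: n)
  case 0
  have "continuous_on UNIV (h n)"
    using assms(1) by (meson DERIV_isCont continuous_at_imp_continuous_on)
  then show ?case using 0 continuous_on_compose2[of UNIV "h n" UNIV g] by auto
next
  case (Suc k)
  have d: "((\<lambda>x. h n (g x)) has_derivative (\<lambda>v. h (Suc n) (g x) * frechet_derivative g (at x) v)) (at x)" for x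
  proof -
    have "(g has_derivative frechet_derivative g (at x)) (at x)"
      using Suc.prems by (simp add: frechet_derivative_works)
    from has_derivative_compose[OF this, of "h n" "\<lambda>v. h (Suc n) (g x) * v"] assms(1)
    show ?thesis by (simp add: has_field_derivative_def)
  qed
  have "partial_deriv i (\<lambda>x. h n (g x)) = (\<lambda>x. h (Suc n) (g x) * partial_deriv i g x)" for i
    by (rule ext) (simp add: partial_deriv_eq[OF d] partial_deriv_def)
  moreover have "C_k k (\<lambda>x. h (Suc n) (g x) * partial_deriv i g x)" for i
    using Suc C_k_SucD[OF Suc.prems] by (intro C_k_bilinear[OF bounded_bilinear_mult]) auto
  ultimately show ?case using d unfolding C_k.simps by (auto intro!: differentiableI)
qed

lemma C_infinityD: "f \<in> C_infinity \<Longrightarrow> C_k k f"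
  by (simp add: C_infinity_def)

lemma C_infinity_differentiable: "f \<in> C_infinity \<Longrightarrow> f differentiable at x"
  using C_infinityD[of f "Suc 0"] by simp

lemma C_infinity_continuous: "f \<in> C_infinity \<Longrightarrow> continuous_on S f"
  using C_infinityD[of f 0] continuous_on_subset by auto

lemma C_infinity_partial_deriv: "f \<in> C_infinity \<Longrightarrow> partial_deriv i f \<in> C_infinity"
  unfolding C_infinity_def using C_k.simps(2) by blast

lemma C_infinity_const: "(\<lambda>x. c) \<in> C_infinity"
  by (simp add: C_infinity_def C_k_const)

lemma C_infinity_add: "f \<in> C_infinity \<Longrightarrow> g \<in> C_infinity \<Longrightarrow> (\<lambda>x. f x + g x) \<in> C_infinity"
  by (simp add: C_infinity_def C_k_add)

lemma C_infinity_linear: "bounded_linear h \<Longrightarrow> f \<in> C_infinity \<Longrightarrow> (\<lambda>x. h (f x)) \<in> C_infinity"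
  by (simp add: C_infinity_def C_k_linear)

lemma C_infinity_bilinear:
  "bounded_bilinear b \<Longrightarrow> f \<in> C_infinity \<Longrightarrow> g \<in> C_infinity \<Longrightarrow> (\<lambda>x. b (f x) (g x)) \<in> C_infinity"
  by (simp add: C_infinity_def C_k_bilinear)

lemmas C_infinity_mult = C_infinity_bilinear[OF bounded_bilinear_mult]
lemmas C_infinity_scaleR = C_infinity_bilinear[OF bounded_bilinear_scaleR]
lemmas C_infinity_inner = C_infinity_bilinear[OF bounded_bilinear_inner]
lemmas C_infinity_minus = C_infinity_linear[OF bounded_linear_minus[OF bounded_linear_ident]]

lemma C_infinity_diff: "f \<in> C_infinity \<Longrightarrow> g \<in> C_infinity \<Longrightarrow> (\<lambda>x. f x - g x) \<in> C_infinity"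
  using C_infinity_add[OF _ C_infinity_minus[of g]] by simp

lemma C_infinity_sum:
  assumes "\<And>i. i \<in> I \<Longrightarrow> f i \<in> C_infinity"
  shows "(\<lambda>x. \<Sum>i\<in>I. f i x) \<in> C_infinity"
  using assms by (induction I rule: infinite_finite_induct) (auto simp: C_infinity_const intro: C_infinity_add)

lemma C_infinity_ident: "(\<lambda>x::real^'n. x) \<in> C_infinity"
proof -
  have p: "partial_deriv i (\<lambda>x::real^'n. x) = (\<lambda>x. axis i 1)" for i
    by (rule ext) (simp add: partial_deriv_eq[OF has_derivative_ident])
  have "C_k k (\<lambda>x::real^'n. x)" for k
    by (cases k) (simp_all add: p C_k_const)
  then show ?thesis by (simp add: C_infinity_def)
qed

lemma C_infinity_divide:
  fixes f g :: "real^'n \<Rightarrow> real"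
  assumes "f \<in> C_infinity" "g \<in> C_infinity" "\<And>x. g x \<noteq> 0"
  shows "(\<lambda>x. f x / g x) \<in> C_infinity"
proof -
  have "(\<lambda>x. inverse (g x)) \<in> C_infinity"
    using assms(2,3) by (simp add: C_infinity_def C_k_inverse)
  from C_infinity_mult[OF assms(1) this] show ?thesis by (simp add: divide_inverse)
qed

section \<open>Flat functions, cutoffs and smooth separation of sets\<close>

definition flat_exp :: "real poly \<Rightarrow> real \<Rightarrow> real" where
  "flat_exp P t = (if t \<le> 0 then 0 else poly P (1 / t) * exp (- 1 / t))"

lemma poly_exp_tendsto_0: "((\<lambda>s::real. poly P s * exp (- s)) \<longlongrightarrow> 0) at_top"
proof -
  have "((\<lambda>s::real. \<Sum>i\<le>degree P. coeff P i * (s ^ i / exp s)) \<longlongrightarrow> (\<Sum>i\<le>degree P. coeff P i * 0)) at_top"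
    by (intro tendsto_intros tendsto_power_div_exp_0)
  then show ?thesis
    by (simp add: poly_altdef sum_distrib_right sum_divide_distrib exp_minus divide_inverse mult.assoc)
qed

text \<open>For \<open>t > 0\<close> the derivative of \<open>P(1/t) exp(-1/t)\<close> is
  \<open>t^(-2) (P - P')(1/t) exp(-1/t)\<close>, which has the same form; this closure under
  differentiation is the reason for the polynomial parameter. The factor \<open>[:0, 0, 1:]\<close>
  is \<open>t^(-2)\<close> read as a polynomial in \<open>1/t\<close>.\<close>

lemma flat_exp_has_derivative:
  "(flat_exp P has_real_derivative flat_exp ([:0, 0, 1:] * (P - pderiv P)) t) (at t)"
proof -
  consider "t < 0" | "t > 0" | "t = 0" by linarith
  then show ?thesis
  proof cases
    case 1
    have "((\<lambda>t. 0) has_real_derivative 0) (at t)" by simp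
    then have "(flat_exp P has_real_derivative 0) (at t)"
      by (rule has_field_derivative_transform_within_open[where S="{..<0}"])
         (use 1 in \<open>auto simp: flat_exp_def\<close>)
    then show ?thesis using 1 by (simp add: flat_exp_def)
  next
    case 2
    have "((\<lambda>t. poly P (1 / t) * exp (- 1 / t)) has_real_derivative
        flat_exp ([:0, 0, 1:] * (P - pderiv P)) t) (at t)"
      using 2 by (auto intro!: derivative_eq_intros DERIV_chain2[OF poly_DERIV]
        simp: flat_exp_def field_simps power2_eq_square)
    then show ?thesis
      by (rule has_field_derivative_transform_within_open[where S="{0<..}"])
         (use 2 in \<open>auto simp: flat_exp_def\<close>)
  next
    case 3
    have "((\<lambda>h. flat_exp P h / h) \<longlongrightarrow> 0) (at_right 0)"
    proof -
      \<comment> \<open>With \<open>s = 1/h\<close> the difference quotient at 0 becomes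
        \<open>s P(s) exp(-s)\<close>; the factor \<open>[:0, 1:]\<close> absorbs the division by
        \<open>h\<close>.\<close>
      have "((\<lambda>h. poly ([:0, 1:] * P) (inverse h) * exp (- inverse h)) \<longlongrightarrow> 0) (at_right (0::real))"
        by (rule filterlim_compose[OF poly_exp_tendsto_0 filterlim_inverse_at_top_right])
      then show ?thesis
        by (rule Lim_transform_eventually)
           (auto simp: eventually_at_right_field flat_exp_def field_simps intro!: exI[of _ 1])
    qed
    moreover have "((\<lambda>h. flat_exp P h / h) \<longlongrightarrow> 0) (at_left 0)"
      by (rule Lim_transform_eventually[OF tendsto_const])
         (auto simp: eventually_at_left_field flat_exp_def intro!: exI[of _ "-1"])
    ultimately have "((\<lambda>h. flat_exp P h / h) \<longlongrightarrow> 0) (at 0)"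
      using filterlim_split_at by blast
    then show ?thesis using 3 by (simp add: DERIV_def flat_exp_def)
  qed
qed

definition bump :: "real \<Rightarrow> real" where
  "bump = flat_exp 1"

lemma bump_eq_0: "t \<le> 0 \<Longrightarrow> bump t = 0" and bump_pos: "0 < t \<Longrightarrow> 0 < bump t"
  by (auto simp: bump_def flat_exp_def)

lemma bump_nonneg: "0 \<le> bump t"
  using bump_eq_0[of t] bump_pos[of t] by (cases "t \<le> 0") auto

lemma C_infinity_bump:
  assumes "g \<in> C_infinity"
  shows "(\<lambda>x. bump (g x)) \<in> C_infinity"
proof -
  define P where "P n = ((\<lambda>P. [:0, 0, 1:] * (P - pderiv P)) ^^ n) (1 :: real poly)" for n
  have "(flat_exp (P n) has_real_derivative flat_exp (P (Suc n)) t) (at t)" for n t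
    using flat_exp_has_derivative by (simp add: P_def)
  then have "C_k k (\<lambda>x. flat_exp (P 0) (g x))" for k
    using assms by (intro C_k_compose_real[where h="\<lambda>n. flat_exp (P n)"]) (auto simp: C_infinity_def)
  then show ?thesis by (simp add: C_infinity_def P_def bump_def)
qed

text \<open>The thresholds 1/3 and 2/3, instead of 0 and 1, leave plateaus of positive width inside
  the unit interval. The open layer \<open>0 < t < 1\<close> then overlaps the open sets
  \<open>t < 1/3\<close> and \<open>t > 2/3\<close>, where the cutoff is constant, and the three
  together form an open cover.\<close>

definition smooth_step :: "real \<Rightarrow> real" where
  "smooth_step t = bump (t - 1/3) / (bump (t - 1/3) + bump (2/3 - t))"

lemma smooth_step_denom: "0 < bump (t - 1/3) + bump (2/3 - t)"
proof (cases "1/3 < t")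
  case True
  then show ?thesis using bump_pos[of "t - 1/3"] bump_nonneg[of "2/3 - t"] by simp
next
  case False
  then show ?thesis using bump_nonneg[of "t - 1/3"] bump_pos[of "2/3 - t"] by simp
qed

lemma smooth_step_0: "t \<le> 1/3 \<Longrightarrow> smooth_step t = 0"
  by (simp add: smooth_step_def bump_eq_0)

lemma smooth_step_1: "2/3 \<le> t \<Longrightarrow> smooth_step t = 1"
  using smooth_step_denom[of t] by (simp add: smooth_step_def bump_eq_0)

lemma smooth_step_bounds: "0 \<le> smooth_step t" "smooth_step t \<le> 1"
  using smooth_step_denom[of t] bump_nonneg[of "t - 1/3"] bump_nonneg[of "2/3 - t"]
  by (auto simp: smooth_step_def)

lemma C_infinity_smooth_step:
  assumes "g \<in> C_infinity"
  shows "(\<lambda>x. smooth_step (g x)) \<in> C_infinity"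
  unfolding smooth_step_def
  by (intro C_infinity_divide C_infinity_add C_infinity_bump C_infinity_diff assms C_infinity_const)
     (use smooth_step_denom in \<open>simp add: less_imp_neq[THEN not_sym]\<close>)

text \<open>A finite sum of bumps on small balls is positive on \<open>K\<close> and vanishes off a
  compact subset of \<open>U\<close>; a quotient then flattens it to 1 wherever it exceeds a
  positive level. Hence the plateau contains an open neighbourhood of \<open>K\<close>.\<close>

lemma smooth_Urysohn:
  fixes K U :: "(real^'n) set"
  assumes "compact K" "open U" "K \<subseteq> U"
  obtains \<phi> V where "\<phi> \<in> test_functions U" "\<And>x. 0 \<le> \<phi> x" "\<And>x. \<phi> x \<le> (1::real)"
    "open V" "K \<subseteq> V" "\<And>x. x \<in> V \<Longrightarrow> \<phi> x = 1"
proof (cases "K = {}")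
  case True
  show ?thesis
    by (rule that[of "\<lambda>_. 0" "{}"]) (use True in \<open>auto simp: test_functions_def C_infinity_const intro!: exI[of _ "{}"]\<close>)
next
  case False
  have "\<exists>r>0. cball x r \<subseteq> U" if "x \<in> K" for x
    using assms that open_contains_cball by blast
  then obtain r where r: "\<And>x. x \<in> K \<Longrightarrow> 0 < r x" "\<And>x. x \<in> K \<Longrightarrow> cball x (r x) \<subseteq> U" by metis
  obtain C where C: "C \<subseteq> K" "finite C" "K \<subseteq> (\<Union>x\<in>C. ball x (r x))"
    using compactE_image[OF assms(1), of K "\<lambda>x. ball x (r x)"] r(1) by force
  \<comment> \<open>The squared distance is used because it is smooth, also at the centres of the
    balls.\<close>
  define a where "a y = (\<Sum>x\<in>C. bump ((r x)\<^sup>2 - (y - x) \<bullet> (y - x)))" for y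
  have aC: "a \<in> C_infinity"
    unfolding a_def
    by (intro C_infinity_sum C_infinity_bump C_infinity_diff C_infinity_inner C_infinity_const C_infinity_ident)
  have a0: "0 \<le> a y" for y unfolding a_def by (intro sum_nonneg bump_nonneg)
  have sq: "(r x)\<^sup>2 - (y - x) \<bullet> (y - x) = (r x)\<^sup>2 - (dist x y)\<^sup>2" for x y
    by (metis dist_commute dist_norm power2_norm_eq_inner)
  have apos: "0 < a y" if "y \<in> K" for y
  proof -
    from that C obtain x where x: "x \<in> C" "dist x y < r x" by auto
    then have "0 < bump ((r x)\<^sup>2 - (y - x) \<bullet> (y - x))"
      unfolding sq by (intro bump_pos) (simp add: power_strict_mono)
    then show ?thesis unfolding a_def using x(1) C(2) bump_nonneg by (intro sum_pos2) auto
  qed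
  obtain y0 where y0: "y0 \<in> K" "\<And>y. y \<in> K \<Longrightarrow> a y0 \<le> a y"
    using continuous_attains_inf[OF assms(1) False C_infinity_continuous[OF aC]] by auto
  \<comment> \<open>Half the minimum of \<open>a\<close> on \<open>K\<close>: so \<open>K\<close>
    lies in the open set \<open>a > \<delta>\<close>, on which \<open>bump (\<delta> - a y)\<close>
    vanishes and the quotient below equals 1.\<close>
  define \<delta> where "\<delta> = a y0 / 2"
  have \<delta>: "0 < \<delta>" "\<And>y. y \<in> K \<Longrightarrow> \<delta> < a y" using apos[OF y0(1)] y0(2) by (fastforce simp: \<delta>_def)+
  define \<phi> where "\<phi> y = a y / (a y + bump (\<delta> - a y))" for y
  have den: "0 < a y + bump (\<delta> - a y)" for y
    using a0[of y] \<delta>(1) bump_pos[of "\<delta> - a y"] bump_nonneg[of "\<delta> - a y"] by (cases "a y = 0") auto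
  have \<phi>C: "\<phi> \<in> C_infinity"
    unfolding \<phi>_def
    by (intro C_infinity_divide C_infinity_add C_infinity_bump C_infinity_diff aC C_infinity_const)
       (use den in \<open>simp add: less_imp_neq[THEN not_sym]\<close>)
  show ?thesis
  proof
    have "\<phi> y = 0" if "y \<notin> (\<Union>x\<in>C. cball x (r x))" for y
    proof -
      have "bump ((r x)\<^sup>2 - (y - x) \<bullet> (y - x)) = 0" if x: "x \<in> C" for x
      proof -
        have "r x \<le> dist x y" using \<open>y \<notin> _\<close> x by force
        then have "(r x)\<^sup>2 \<le> (dist x y)\<^sup>2" using r(1)[of x] C(1) x by (intro power_mono) (auto simp: less_imp_le)
        then show ?thesis unfolding sq by (intro bump_eq_0) simp
      qed
      then show ?thesis by (simp add: \<phi>_def a_def)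
    qed
    moreover have "compact (\<Union>x\<in>C. cball x (r x))" using C(2) by auto
    moreover have "(\<Union>x\<in>C. cball x (r x)) \<subseteq> U" using r(2) C(1) by blast
    ultimately show "\<phi> \<in> test_functions U" unfolding test_functions_def using \<phi>C by blast
    show "0 \<le> \<phi> x" "\<phi> x \<le> 1" for x
      using den[of x] a0[of x] bump_nonneg[of "\<delta> - a x"] by (auto simp: \<phi>_def)
    show "open (a -` {\<delta><..})"
      by (rule open_vimage) (use C_infinity_continuous[OF aC] in auto)
    show "K \<subseteq> a -` {\<delta><..}" using \<delta>(2) by auto
    show "\<phi> x = 1" if "x \<in> a -` {\<delta><..}" for x
      using that \<delta>(1) by (auto simp: \<phi>_def bump_eq_0)
  qed
qed

section \<open>Test functions and the Poincare inequality\<close>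

lemma integrable_lebesgue_on_support:
  fixes f :: "'a::euclidean_space \<Rightarrow> 'b::euclidean_space"
  assumes "D \<in> sets lebesgue" "\<And>x. x \<notin> D \<Longrightarrow> f x = 0"
  shows "integrable (lebesgue_on D) f \<longleftrightarrow> integrable lebesgue f"
proof -
  have "(\<lambda>x. indicator D x *\<^sub>R f x) = f" using assms(2) by (auto simp: indicator_def)
  then show ?thesis using assms(1) by (simp add: integrable_restrict_space)
qed

lemma integral_lebesgue_on_support:
  fixes f :: "'a::euclidean_space \<Rightarrow> 'b::euclidean_space"
  assumes "D \<in> sets lebesgue" "\<And>x. x \<notin> D \<Longrightarrow> f x = 0"
  shows "integral\<^sup>L (lebesgue_on D) f = integral\<^sup>L lebesgue f"
proof -
  have "(\<lambda>x. indicator D x *\<^sub>R f x) = f" using assms(2) by (auto simp: indicator_def)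
  then show ?thesis using assms(1) by (simp add: integral_restrict_space)
qed

lemma integrable_lborel_compact_support:
  fixes f :: "'a::euclidean_space \<Rightarrow> 'b::euclidean_space"
  assumes "continuous_on UNIV f" "compact K" "\<And>x. x \<notin> K \<Longrightarrow> f x = 0"
  shows "integrable lborel f"
proof -
  have "integrable lborel (\<lambda>x. indicator K x *\<^sub>R f x)"
    using assms(1,2) continuous_on_subset by (blast intro: borel_integrable_compact)
  moreover have "(\<lambda>x. indicator K x *\<^sub>R f x) = f" using assms(3) by (auto simp: indicator_def)
  ultimately show ?thesis by simp
qed

lemma integrable_compact_support:
  fixes f :: "'a::euclidean_space \<Rightarrow> 'b::euclidean_space"
  assumes "continuous_on UNIV f" "compact K" "\<And>x. x \<notin> K \<Longrightarrow> f x = 0" "D \<in> sets lebesgue"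
  shows "integrable (lebesgue_on D) f"
proof -
  have "integrable lebesgue f"
    using integrable_lborel_compact_support[OF assms(1-3)]
    by (simp add: integrable_completion borel_measurable_continuous_onI[OF assms(1)])
  then show ?thesis
    using assms(4) by (simp add: integrable_restrict_space integrable_mult_indicator)
qed

lemma continuous_compact_support_bounded:
  fixes f :: "'a::euclidean_space \<Rightarrow> 'b::euclidean_space"
  assumes "continuous_on UNIV f" "compact K" "\<And>x. x \<notin> K \<Longrightarrow> f x = 0"
  obtains B where "0 \<le> B" "\<And>x. norm (f x) \<le> B"
proof -
  have "bounded (f ` K)"
    using assms(1,2) by (meson compact_continuous_image compact_imp_bounded continuous_on_subset subset_UNIV)
  then obtain B where "\<And>x. x \<in> K \<Longrightarrow> norm (f x) \<le> B" unfolding bounded_iff by auto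
  then have "norm (f x) \<le> max B 0" for x using assms(3) by (cases "x \<in> K") force+
  then show ?thesis using that[of "max B 0"] by auto
qed

lemma partial_deriv_has_derivative:
  assumes "f differentiable at (x + t *\<^sub>R axis i 1)"
  shows "((\<lambda>t. f (x + t *\<^sub>R axis i 1)) has_derivative (\<lambda>s. s *\<^sub>R partial_deriv i f (x + t *\<^sub>R axis i 1))) (at t)"
proof -
  have f: "(f has_derivative frechet_derivative f (at (x + t *\<^sub>R axis i 1))) (at (x + t *\<^sub>R axis i 1))"
    using assms by (simp add: frechet_derivative_works)
  have "((\<lambda>t. x + t *\<^sub>R axis i 1) has_derivative (\<lambda>s. s *\<^sub>R axis i 1)) (at t)"
    by (auto intro!: derivative_eq_intros)
  from has_derivative_compose[OF this f] show ?thesis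
    by (simp add: partial_deriv_def linear_scale[OF has_derivative_linear[OF f]])
qed

lemma integral_lborel_translate:
  fixes f :: "'a::euclidean_space \<Rightarrow> real"
  assumes "f \<in> borel_measurable borel"
  shows "integral\<^sup>L lborel (\<lambda>x. f (x + c)) = integral\<^sup>L lborel f"
proof -
  have "integral\<^sup>L lborel f = integral\<^sup>L (distr lborel borel ((+) c)) f"
    by (simp add: lborel_distr_plus)
  also have "\<dots> = integral\<^sup>L lborel (\<lambda>x. f (c + x))"
    using assms by (intro integral_distr) auto
  finally show ?thesis by (simp add: add.commute)
qed

text \<open>Differentiate the constant function \<open>t \<mapsto> \<integral> f (x + t e\<^sub>i) dx\<close> at \<open>0\<close>.\<close>

lemma integral_partial_deriv_eq_0:
  fixes f :: "real^'n \<Rightarrow> real"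
  assumes diff: "\<And>x. f differentiable at x" and cont: "continuous_on UNIV (partial_deriv i f)"
    and K: "compact K" "\<And>x. x \<notin> K \<Longrightarrow> f x = 0" "\<And>x. x \<notin> K \<Longrightarrow> partial_deriv i f x = 0"
  shows "integral\<^sup>L lebesgue (partial_deriv i f) = 0"
proof -
  define e :: "real^'n" where "e = axis i 1"
  have ne: "norm e = 1" by (simp add: e_def)
  have cf: "continuous_on UNIV f"
    using diff by (simp add: continuous_at_imp_continuous_on differentiable_imp_continuous_within)
  obtain B where B: "0 \<le> B" "\<And>x. norm (partial_deriv i f x) \<le> B"
    using continuous_compact_support_bounded[OF cont K(1,3)] by blast
  obtain R where R: "\<And>x. x \<in> K \<Longrightarrow> norm x \<le> R"
    using compact_imp_bounded[OF K(1)] unfolding bounded_iff by blast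
  have dv: "((\<lambda>t. f (x + t *\<^sub>R e)) has_real_derivative partial_deriv i f (x + t *\<^sub>R e)) (at t)" for x t
    using partial_deriv_has_derivative[OF diff, where x=x and t=t and i=i]
    by (simp add: has_field_derivative_def e_def mult.commute[of _ "partial_deriv _ _ _"] mult_commute_abs)
  define h where "h n = inverse (real (Suc n))" for n
  have h: "0 < h n" "h n \<le> 1" for n by (auto simp: h_def inverse_le_1_iff)
  define s where "s n x = (f (x + h n *\<^sub>R e) - f x) / h n" for n x
  \<comment> \<open>By the mean value theorem each difference quotient is a value of the partial
    derivative, hence bounded by \<open>B\<close>. As \<open>h n \<le> 1\<close>, outside the ball
    of radius \<open>R + 1\<close> both points involved lie off \<open>K\<close> and the quotient is
    0.\<close>
  have bound: "norm (s n x) \<le> B * indicator (cball 0 (R + 1)) x" for n x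
  proof (cases "x \<in> cball 0 (R + 1)")
    case True
    obtain z where z: "f (x + h n *\<^sub>R e) - f (x + 0 *\<^sub>R e) = (h n - 0) * partial_deriv i f (x + z *\<^sub>R e)"
      using MVT2[OF h(1)[of n], of "\<lambda>t. f (x + t *\<^sub>R e)" "\<lambda>t. partial_deriv i f (x + t *\<^sub>R e)"] dv by blast
    then have "s n x = partial_deriv i f (x + z *\<^sub>R e)" using h(1)[of n] by (simp add: s_def)
    then show ?thesis using B(2) True by simp
  next
    case False
    then have nx: "norm x > R + 1" by simp
    have "norm (x + h n *\<^sub>R e) \<ge> norm x - norm (h n *\<^sub>R e)" by (metis norm_diff_ineq)
    then have "norm (x + h n *\<^sub>R e) > R" using nx h[of n] ne by simp
    then have "f (x + h n *\<^sub>R e) = 0" "f x = 0" using R K(2) nx by fastforce+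
    then show ?thesis using False by (simp add: s_def)
  qed
  have cs: "continuous_on UNIV (s n)" for n
    unfolding s_def using h(1)[of n]
    by (intro continuous_intros continuous_on_compose2[OF cf]) auto
  have lim: "(\<lambda>n. s n x) \<longlonglongrightarrow> partial_deriv i f x" for x
  proof -
    have "((\<lambda>t. (f (x + t *\<^sub>R e) - f x) / t) \<longlongrightarrow> partial_deriv i f x) (at 0)"
      using dv[of x 0] by (simp add: DERIV_def)
    moreover have "filterlim h (at 0) sequentially"
      unfolding filterlim_at using h LIMSEQ_inverse_real_of_nat by (auto simp: h_def[abs_def] less_imp_neq[THEN not_sym])
    ultimately show ?thesis unfolding s_def by (rule filterlim_compose)
  qed
  have "(\<lambda>n. integral\<^sup>L lborel (s n)) \<longlonglongrightarrow> integral\<^sup>L lborel (partial_deriv i f)"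
  proof (rule integral_dominated_convergence[where w="\<lambda>x. B * indicator (cball 0 (R + 1)) x"])
    show "integrable lborel (\<lambda>x. B * indicator (cball 0 (R + 1)) x :: real)"
      by (intro integrable_mult_right integrable_real_indicator) (use emeasure_bounded_finite[OF bounded_cball] in auto)
    show "partial_deriv i f \<in> borel_measurable lborel"
      using borel_measurable_continuous_onI[OF cont] by simp
    show "s n \<in> borel_measurable lborel" for n
      using borel_measurable_continuous_onI[OF cs] by simp
  qed (use lim bound in auto)
  moreover have "integral\<^sup>L lborel (s n) = 0" for n
  proof -
    have i1: "integrable lborel f" by (rule integrable_lborel_compact_support[OF cf K(1,2)])
    have "integrable lborel (\<lambda>x. f (x + h n *\<^sub>R e))"
    proof (rule integrable_lborel_compact_support)
      show "continuous_on UNIV (\<lambda>x. f (x + h n *\<^sub>R e))"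
        by (intro continuous_intros continuous_on_compose2[OF cf]) auto
      show "compact ((\<lambda>x. x - h n *\<^sub>R e) ` K)"
        by (intro compact_continuous_image K continuous_intros)
      show "f (x + h n *\<^sub>R e) = 0" if "x \<notin> (\<lambda>x. x - h n *\<^sub>R e) ` K" for x
        using that K(2)[of "x + h n *\<^sub>R e"] by (metis add_diff_cancel_right' image_eqI)
    qed
    then have "integral\<^sup>L lborel (s n) = (integral\<^sup>L lborel (\<lambda>x. f (x + h n *\<^sub>R e)) - integral\<^sup>L lborel f) / h n"
      unfolding s_def using i1 by simp
    then show ?thesis
      using integral_lborel_translate[of f "h n *\<^sub>R e"] borel_measurable_continuous_onI[OF cf] by simp
  qed
  ultimately have "integral\<^sup>L lborel (partial_deriv i f) = 0"
    by (simp add: LIMSEQ_const_iff)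
  moreover have "integral\<^sup>L lebesgue (partial_deriv i f) = integral\<^sup>L lborel (partial_deriv i f)"
    by (rule integral_completion) (use borel_measurable_continuous_onI[OF cont] in simp)
  ultimately show ?thesis by simp
qed

lemma partial_deriv_outside_support:
  assumes "closed K" "\<And>x. x \<notin> K \<Longrightarrow> f x = 0" "x \<notin> K"
  shows "partial_deriv i f x = 0"
proof -
  have "(f has_derivative (\<lambda>v. 0)) (at x)"
    by (rule has_derivative_transform_within_open[OF has_derivative_const, of "- K"])
       (use assms in \<open>auto simp: open_Compl\<close>)
  from partial_deriv_eq[OF this] show ?thesis by simp
qed

section \<open>Calculus of test functions\<close>

lemma test_functionsE:
  assumes "\<phi> \<in> test_functions D"
  obtains K where "compact K" "K \<subseteq> D" "\<And>x. x \<notin> K \<Longrightarrow> \<phi> x = 0"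
  using assms unfolding test_functions_def by blast

lemma test_functions_C_infinity: "\<phi> \<in> test_functions D \<Longrightarrow> \<phi> \<in> C_infinity"
  by (simp add: test_functions_def)

lemma test_functions_zero_outside: "\<phi> \<in> test_functions D \<Longrightarrow> x \<notin> D \<Longrightarrow> \<phi> x = 0"
  by (metis test_functionsE subsetD)

lemma test_functionsI:
  "\<phi> \<in> C_infinity \<Longrightarrow> compact K \<Longrightarrow> K \<subseteq> D \<Longrightarrow> (\<And>x. x \<notin> K \<Longrightarrow> \<phi> x = 0) \<Longrightarrow> \<phi> \<in> test_functions D"
  unfolding test_functions_def by blast

lemma test_functions_mono: "D \<subseteq> D' \<Longrightarrow> test_functions D \<subseteq> test_functions D'"
  unfolding test_functions_def by blast

lemma test_functions_partial_deriv:
  assumes "\<phi> \<in> test_functions D"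
  shows "partial_deriv i \<phi> \<in> test_functions D"
proof -
  obtain K where K: "compact K" "K \<subseteq> D" "\<And>x. x \<notin> K \<Longrightarrow> \<phi> x = 0"
    using test_functionsE[OF assms] by blast
  show ?thesis
    using partial_deriv_outside_support[OF compact_imp_closed[OF K(1)] K(3)]
      C_infinity_partial_deriv[OF test_functions_C_infinity[OF assms]]
    by (intro test_functionsI[OF _ K(1,2)]) auto
qed

lemma test_functions_zero: "(\<lambda>x. 0) \<in> test_functions D"
  by (rule test_functionsI[of _ "{}"]) (auto simp: C_infinity_const)

lemma test_functions_add:
  assumes "\<phi> \<in> test_functions D" "\<psi> \<in> test_functions D"
  shows "(\<lambda>x. \<phi> x + \<psi> x) \<in> test_functions D"
proof -
  obtain K where K: "compact K" "K \<subseteq> D" "\<And>x. x \<notin> K \<Longrightarrow> \<phi> x = 0"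
    using test_functionsE[OF assms(1)] by blast
  obtain L where L: "compact L" "L \<subseteq> D" "\<And>x. x \<notin> L \<Longrightarrow> \<psi> x = 0"
    using test_functionsE[OF assms(2)] by blast
  show ?thesis
    by (rule test_functionsI[of _ "K \<union> L"])
       (use K L assms in \<open>auto intro: C_infinity_add test_functions_C_infinity\<close>)
qed

lemma test_functions_linear:
  assumes "\<phi> \<in> test_functions D" "bounded_linear h"
  shows "(\<lambda>x. h (\<phi> x)) \<in> test_functions D"
proof -
  obtain K where K: "compact K" "K \<subseteq> D" "\<And>x. x \<notin> K \<Longrightarrow> \<phi> x = 0"
    using test_functionsE[OF assms(1)] by blast
  show ?thesis
    by (rule test_functionsI[of _ "K"])
       (use K assms in \<open>auto intro: C_infinity_linear test_functions_C_infinity simp: linear_0 bounded_linear.linear\<close>)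
qed

text \<open>Compactness of the support comes from \<open>\<phi>\<close> alone, so
  \<open>\<zeta>\<close> may be nonzero on an unbounded set, as one minus a cutoff is. The closed
  set \<open>S\<close> carries \<open>\<zeta>\<close> and allows the domain to change from
  \<open>D\<close> to \<open>D'\<close>.\<close>

lemma test_functions_scaleR:
  assumes "\<zeta> \<in> C_infinity" "\<phi> \<in> test_functions D"
    and "closed S" "\<And>x. x \<notin> S \<Longrightarrow> \<zeta> x = 0" "S \<inter> D \<subseteq> D'"
  shows "(\<lambda>x. \<zeta> x *\<^sub>R \<phi> x) \<in> test_functions D'"
proof -
  obtain K where K: "compact K" "K \<subseteq> D" "\<And>x. x \<notin> K \<Longrightarrow> \<phi> x = 0"
    using test_functionsE[OF assms(2)] by blast
  show ?thesis
  proof (rule test_functionsI)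
    show "compact (K \<inter> S)" using K(1) assms(3) by (rule compact_Int_closed)
    show "K \<inter> S \<subseteq> D'" using assms(5) K(2) by blast
  qed (use K(3) assms in \<open>auto intro: C_infinity_scaleR test_functions_C_infinity\<close>)
qed

lemma test_functions_integrable:
  assumes "\<phi> \<in> test_functions D'" "D \<in> sets lebesgue"
  shows "integrable (lebesgue_on D) \<phi>"
  by (meson assms test_functionsE integrable_compact_support C_infinity_continuous test_functions_C_infinity)

lemma partial_deriv_linear:
  assumes "bounded_linear h" "f differentiable at x"
  shows "partial_deriv i (\<lambda>x. h (f x)) x = h (partial_deriv i f x)"
proof -
  have "((\<lambda>x. h (f x)) has_derivative (\<lambda>v. h (frechet_derivative f (at x) v))) (at x)"
    using assms by (intro bounded_linear.has_derivative[OF assms(1)]) (simp add: frechet_derivative_works)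
  from partial_deriv_eq[OF this] show ?thesis by (simp add: partial_deriv_def)
qed

text \<open>The product \<open>f \<phi>\<close> has compact support, so its partial derivative
  integrates to 0.\<close>

lemma integral_by_parts_test_function:
  fixes f \<phi> :: "real^'n \<Rightarrow> real"
  assumes "f \<in> C_infinity" "\<phi> \<in> test_functions D" "D \<in> sets lebesgue"
  shows "(\<integral>x. f x * partial_deriv i \<phi> x \<partial>lebesgue_on D) = - (\<integral>x. partial_deriv i f x * \<phi> x \<partial>lebesgue_on D)"
proof -
  have t: "(\<lambda>x. f x *\<^sub>R \<phi> x) \<in> test_functions D"
    by (rule test_functions_scaleR[OF assms(1,2), of UNIV]) auto
  have d: "f differentiable at x" "\<phi> differentiable at x" for x
    using assms C_infinity_differentiable test_functions_C_infinity by blast+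
  have p: "partial_deriv i (\<lambda>x. f x * \<phi> x) = (\<lambda>x. f x * partial_deriv i \<phi> x + partial_deriv i f x * \<phi> x)"
    by (rule ext, rule partial_deriv_bilinear[OF bounded_bilinear_mult d])
  obtain K where K: "compact K" "K \<subseteq> D" "\<And>x. x \<notin> K \<Longrightarrow> f x * \<phi> x = 0"
    using test_functionsE[OF t] by auto
  have "integral\<^sup>L lebesgue (partial_deriv i (\<lambda>x. f x * \<phi> x)) = 0"
  proof (rule integral_partial_deriv_eq_0[OF _ _ K(1,3)])
    show "(\<lambda>x. f x * \<phi> x) differentiable at x" for x
      using C_infinity_differentiable[OF test_functions_C_infinity[OF t]] by simp
    show "continuous_on UNIV (partial_deriv i (\<lambda>x. f x * \<phi> x))"
      using C_infinity_continuous[OF C_infinity_partial_deriv[OF test_functions_C_infinity[OF t]]] by simp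
    show "partial_deriv i (\<lambda>x. f x * \<phi> x) x = 0" if "x \<notin> K" for x
      by (rule partial_deriv_outside_support[OF compact_imp_closed[OF K(1)] K(3) that])
  qed
  moreover have "integral\<^sup>L (lebesgue_on D) (partial_deriv i (\<lambda>x. f x * \<phi> x)) = integral\<^sup>L lebesgue (partial_deriv i (\<lambda>x. f x * \<phi> x))"
    using test_functions_zero_outside[OF test_functions_partial_deriv[OF t]]
    by (intro integral_lebesgue_on_support[OF assms(3)]) simp
  moreover have "integrable (lebesgue_on D) (\<lambda>x. f x *\<^sub>R partial_deriv i \<phi> x)"
    using test_functions_scaleR[OF assms(1) test_functions_partial_deriv[OF assms(2)], where S=UNIV and D'=D] assms(3)
    by (auto intro: test_functions_integrable)
  moreover have "integrable (lebesgue_on D) (\<lambda>x. partial_deriv i f x *\<^sub>R \<phi> x)"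
    using test_functions_scaleR[OF C_infinity_partial_deriv[OF assms(1)] assms(2), where S=UNIV and D'=D] assms(3)
    by (auto intro: test_functions_integrable)
  ultimately show ?thesis by (simp add: p)
qed

text \<open>The duality map of \<open>L^q\<close>, that is, the gradient of \<open>|y|^q / q\<close>
  for \<open>q > 1\<close>. At the origin it is 0, even for \<open>q < 2\<close>, thanks to the
  factor \<open>y\<close>.\<close>

definition power_dual :: "real \<Rightarrow> 'b::euclidean_space \<Rightarrow> 'b" where
  "power_dual q y = norm y powr (q - 2) *\<^sub>R y"

lemma norm_power_dual: "norm (power_dual q y) = norm y powr (q - 1)"
proof (cases "y = 0")
  case False
  have "norm y powr (q - 2) * norm y = norm y powr (q - 2) * norm y powr 1" by simp
  also have "\<dots> = norm y powr (q - 1)" unfolding powr_add[symmetric] by simp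
  finally show ?thesis by (simp add: power_dual_def)
qed (simp add: power_dual_def)

lemma inner_power_dual: "power_dual q y \<bullet> y = norm y powr q"
proof (cases "y = 0")
  case False
  have "norm y powr (q - 2) * norm y ^ 2 = norm y powr (q - 2) * norm y powr 2" using False by simp
  also have "\<dots> = norm y powr q" unfolding powr_add[symmetric] by simp
  finally show ?thesis by (simp add: power_dual_def power2_norm_eq_inner)
qed (simp add: power_dual_def)

lemma continuous_norm_powr: "0 < a \<Longrightarrow> continuous_on UNIV (\<lambda>y. norm y powr a)"
  by (intro continuous_on_powr' continuous_intros) auto

lemma norm_powr_tendsto_0:
  assumes "0 < a"
  shows "((\<lambda>z::'b::euclidean_space. norm z powr a) \<longlongrightarrow> 0) (at 0)"
proof -
  have "isCont (\<lambda>z::'b. norm z powr a) 0"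
    using continuous_norm_powr[OF assms, where 'a='b] by (simp add: continuous_on_eq_continuous_at)
  then show ?thesis unfolding isCont_def using assms by simp
qed

text \<open>For \<open>q < 2\<close> the scalar factor is unbounded near the origin; continuity
  there is seen from the norm \<open>|y|^(q - 1)\<close>, whose exponent is positive.\<close>

lemma continuous_power_dual:
  assumes "1 < q"
  shows "continuous_on UNIV (power_dual q :: 'b::euclidean_space \<Rightarrow> 'b)"
proof (rule continuous_at_imp_continuous_on, rule ballI)
  fix y :: 'b
  show "isCont (power_dual q) y"
  proof (cases "y = 0")
    case False
    then show ?thesis unfolding power_dual_def[abs_def] by (intro continuous_intros) auto
  next
    case True
    have "((\<lambda>z::'b. norm z powr (q - 1)) \<longlongrightarrow> 0) (at 0)" by (rule norm_powr_tendsto_0) (use assms in simp)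
    then have "((\<lambda>z::'b. norm (power_dual q z)) \<longlongrightarrow> 0) (at 0)" by (simp add: norm_power_dual)
    then show ?thesis using True
      by (simp add: isCont_def tendsto_norm_zero_iff power_dual_def[of q 0])
  qed
qed

lemma norm_powr_has_derivative:
  fixes y :: "'b::euclidean_space"
  assumes "1 < q"
  shows "((\<lambda>y. norm y powr q) has_derivative (\<lambda>v. q * (power_dual q y \<bullet> v))) (at y)"
proof (cases "y = 0")
  case False
  have "((\<lambda>y. norm y powr q) has_derivative (\<lambda>v. (y \<bullet> v / norm y) * (q * norm y powr (q - 1)))) (at y)"
    using False
    by (auto simp: field_simps powr_diff sgn_div_norm inner_commute norm_conv_dist[symmetric]
      intro!: has_derivative_eq_rhs[OF has_derivative_powr[OF has_derivative_norm[OF False] has_derivative_const]])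
  moreover have "(y \<bullet> v / norm y) * (q * norm y powr (q - 1)) = q * (power_dual q y \<bullet> v)" for v
  proof -
    have "norm y powr (q - 1) = norm y powr (q - 2) * norm y powr 1" unfolding powr_add[symmetric] by simp
    then show ?thesis using False by (simp add: power_dual_def)
  qed
  ultimately show ?thesis by simp
next
  case True
  have "((\<lambda>h::'b. norm h powr (q - 1)) \<longlongrightarrow> 0) (at 0)"
    by (rule norm_powr_tendsto_0) (use assms in simp)
  then have "((\<lambda>h::'b. norm h powr q / norm h) \<longlongrightarrow> 0) (at 0)"
    by (rule Lim_transform_eventually)
       (auto simp: eventually_at_filter powr_diff)
  then show ?thesis using True
    by (simp add: has_derivative_at power_dual_def bounded_linear_zero)
qed

text \<open>A weighted Young inequality whose weight gives \<open>a^q\<close> the coefficient 1/2,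
  so that this term can be absorbed in the Poincare inequality. It follows from comparing
  \<open>a\<close> with \<open>2 q R b\<close>.\<close>

lemma power_dual_le:
  fixes a b R q :: real
  assumes "1 < q" "0 < R" "0 \<le> a" "0 \<le> b"
  shows "q * R * a powr (q - 1) * b \<le> a powr q / 2 + (2 * q * R) powr q * b powr q / 2"
proof (cases "a \<le> 2 * q * R * b")
  case True
  have "a powr (q - 1) * b \<le> (2 * q * R * b) powr (q - 1) * b"
    using assms True by (intro mult_right_mono powr_mono2) auto
  also have "\<dots> = (2 * q * R) powr (q - 1) * b powr q"
  proof (cases "b = 0")
    case False
    have "b powr (q - 1) * b = b powr (q - 1) * b powr 1" using assms by simp
    also have "\<dots> = b powr q" unfolding powr_add[symmetric] by simp
    finally show ?thesis using assms by (simp add: powr_mult mult.assoc)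
  qed simp
  finally have "q * R * (a powr (q - 1) * b) \<le> q * R * ((2 * q * R) powr (q - 1) * b powr q)"
    using assms by (intro mult_left_mono) auto
  also have "\<dots> = (2 * q * R) powr q * b powr q / 2"
  proof -
    have "(2 * q * R) powr q = (2 * q * R) powr (q - 1) * (2 * q * R) powr 1" unfolding powr_add[symmetric] by simp
    then show ?thesis using assms by simp
  qed
  finally show ?thesis using powr_ge_zero[of a q] unfolding mult.assoc[of "q * R"] by linarith
next
  case False
  then have a: "0 < a" using assms by (smt (verit) mult_nonneg_nonneg)
  have "q * R * a powr (q - 1) * b = a powr (q - 1) * (2 * q * R * b) / 2" by simp
  also have "\<dots> \<le> a powr (q - 1) * a / 2" using False by (intro divide_right_mono mult_left_mono) auto
  also have "\<dots> = a powr q / 2"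
  proof -
    have "a powr q = a powr (q - 1) * a powr 1" unfolding powr_add[symmetric] by simp
    then show ?thesis using a by simp
  qed
  finally show ?thesis
    using mult_nonneg_nonneg[OF powr_ge_zero[of "2 * q * R" q] powr_ge_zero[of b q]] by linarith
qed

text \<open>Integrate \<open>\<partial>\<^sub>i (x\<^sub>i \<bar>\<psi>\<bar>\<^sup>q)\<close>.\<close>

lemma Poincare_partial_deriv:
  fixes \<psi> :: "real^'n \<Rightarrow> real^'m"
  assumes q: "1 < q" and R: "0 < R" "\<And>x. x \<in> D \<Longrightarrow> norm x \<le> R"
    and \<psi>: "\<psi> \<in> test_functions D"
  shows "(\<integral>x. norm (\<psi> x) powr q \<partial>lebesgue) \<le> (2 * q * R) powr q * (\<integral>x. norm (partial_deriv i \<psi> x) powr q \<partial>lebesgue)"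
proof -
  obtain K where K: "compact K" "K \<subseteq> D" "\<And>x. x \<notin> K \<Longrightarrow> \<psi> x = 0"
    using test_functionsE[OF \<psi>] by blast
  note C = test_functions_C_infinity[OF \<psi>]
  have K': "partial_deriv i \<psi> x = 0" if "x \<notin> K" for x
    by (rule partial_deriv_outside_support[OF compact_imp_closed[OF K(1)] K(3) that])
  define f where "f x = x $ i * norm (\<psi> x) powr q" for x
  have d: "(f has_derivative (\<lambda>v. x $ i * (q * (power_dual q (\<psi> x) \<bullet> frechet_derivative \<psi> (at x) v)) + v $ i * norm (\<psi> x) powr q)) (at x)" for x
  proof -
    have 1: "((\<lambda>x. norm (\<psi> x) powr q) has_derivative (\<lambda>v. q * (power_dual q (\<psi> x) \<bullet> frechet_derivative \<psi> (at x) v))) (at x)"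
      using C_infinity_differentiable[OF C, of x] unfolding frechet_derivative_works
      by (rule has_derivative_compose[OF _ norm_powr_has_derivative[OF q]])
    have 2: "((\<lambda>x. x $ i) has_derivative (\<lambda>v. v $ i)) (at x)"
      by (rule bounded_linear.has_derivative[OF bounded_linear_vec_nth has_derivative_ident])
    show ?thesis unfolding f_def by (rule has_derivative_mult[OF 2 1])
  qed
  define g where "g x = q * x $ i * (power_dual q (\<psi> x) \<bullet> partial_deriv i \<psi> x)" for x
  have pf: "partial_deriv i f = (\<lambda>x. g x + norm (\<psi> x) powr q)"
    by (rule ext) (simp add: partial_deriv_eq[OF d] g_def partial_deriv_def[of i \<psi>] axis_def)
  have c1: "continuous_on UNIV (\<lambda>x. norm (\<psi> x) powr q)"
    using q by (intro continuous_on_compose2[OF continuous_norm_powr] C_infinity_continuous C) auto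
  have c2: "continuous_on UNIV g" unfolding g_def
    by (intro continuous_intros continuous_on_compose2[OF continuous_power_dual[OF q]] C_infinity_continuous C_infinity_partial_deriv C) auto
  have c3: "continuous_on UNIV (\<lambda>x. norm (partial_deriv i \<psi> x) powr q)"
    using q by (intro continuous_on_compose2[OF continuous_norm_powr] C_infinity_continuous C_infinity_partial_deriv C) auto
  \<comment> \<open>\<open>f\<close> is in general not smooth, since \<open>|y|^q\<close> need not
    be smooth at the origin; differentiability and a continuous partial derivative are what the
    vanishing of the integral rests on.\<close>
  have *: "integral\<^sup>L lebesgue (partial_deriv i f) = 0"
  proof (rule integral_partial_deriv_eq_0[where K=K])
    show "f differentiable at x" for x using d by (rule differentiableI)
    show "continuous_on UNIV (partial_deriv i f)" unfolding pf by (intro continuous_on_add c1 c2)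
  qed (auto simp: K pf g_def K' f_def)
  have il: "integrable lebesgue (\<lambda>x. norm (\<psi> x) powr q)" "integrable lebesgue g"
    "integrable lebesgue (\<lambda>x. norm (partial_deriv i \<psi> x) powr q)"
    using integrable_compact_support[OF c1 K(1), of UNIV] integrable_compact_support[OF c2 K(1), of UNIV]
      integrable_compact_support[OF c3 K(1), of UNIV] K(3) K'
    by (auto simp: g_def lebesgue_on_UNIV_eq)
  have "(\<integral>x. norm (\<psi> x) powr q \<partial>lebesgue) = (\<integral>x. - g x \<partial>lebesgue)"
    using * il(1,2) by (simp add: pf)
  also have "\<dots> \<le> (\<integral>x. norm (\<psi> x) powr q / 2 + (2 * q * R) powr q * norm (partial_deriv i \<psi> x) powr q / 2 \<partial>lebesgue)"
  proof (rule integral_mono)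
    show "- g x \<le> norm (\<psi> x) powr q / 2 + (2 * q * R) powr q * norm (partial_deriv i \<psi> x) powr q / 2" for x
    proof (cases "x \<in> K")
      case True
      have "- g x \<le> \<bar>g x\<bar>" by simp
      also have "\<dots> = q * \<bar>x $ i\<bar> * \<bar>power_dual q (\<psi> x) \<bullet> partial_deriv i \<psi> x\<bar>" using q by (simp add: g_def abs_mult)
      also have "\<dots> \<le> q * R * (norm (\<psi> x) powr (q - 1) * norm (partial_deriv i \<psi> x))"
        using component_le_norm_cart[of x i] R K(2) True q
          Cauchy_Schwarz_ineq2[of "power_dual q (\<psi> x)" "partial_deriv i \<psi> x"]
        by (intro mult_mono) (auto simp: norm_power_dual intro: order_trans)
      also have "\<dots> \<le> norm (\<psi> x) powr q / 2 + (2 * q * R) powr q * norm (partial_deriv i \<psi> x) powr q / 2"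
        using power_dual_le[OF q R(1), of "norm (\<psi> x)" "norm (partial_deriv i \<psi> x)"] by (simp add: mult.assoc)
      finally show ?thesis .
    qed (use K(3) K' in \<open>simp add: g_def\<close>)
  qed (use il in \<open>auto intro!: integrable_divide Bochner_Integration.integrable_add\<close>)
  \<comment> \<open>The first summand is half of the left-hand side and is absorbed there; this
    leaves exactly the factor \<open>(2 q R)^q\<close>.\<close>
  also have "\<dots> = (\<integral>x. norm (\<psi> x) powr q \<partial>lebesgue) / 2 + (2 * q * R) powr q * (\<integral>x. norm (partial_deriv i \<psi> x) powr q \<partial>lebesgue) / 2"
    using il by simp
  finally show ?thesis by simp
qed

section \<open>Lebesgue spaces\<close>

text \<open>If one endpoint is 0, the claim is \<open>c^p \<le> c\<close> for \<open>c\<close> in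
  the unit interval; otherwise it is convexity of the power on the positive half-line.\<close>

lemma powr_convex_combination:
  fixes s t l p :: real
  assumes "1 \<le> p" "0 \<le> s" "0 \<le> t" "0 \<le> l" "l \<le> 1"
  shows "((1 - l) * s + l * t) powr p \<le> (1 - l) * s powr p + l * t powr p"
proof -
  have scale: "(c * y) powr p \<le> c * y powr p" if "0 \<le> c" "c \<le> 1" "0 \<le> y" for c y :: real
  proof (cases "c = 0")
    case False
    have "c powr p \<le> c powr 1" using that False assms(1) by (intro powr_mono') auto
    then show ?thesis using that False by (simp add: powr_mult mult_right_mono)
  qed simp
  consider "s = 0" | "t = 0" | "0 < s" "0 < t" using assms by linarith
  then show ?thesis
  proof cases
    case 1
    then show ?thesis using scale[of l t] assms by simp
  next
    case 2
    then show ?thesis using scale[of "1 - l" s] assms by simp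
  next
    case 3
    then show ?thesis using convex_onD[OF powr_convex[OF assms(1)], of l s t] assms by simp
  qed
qed

lemma powr_add_le:
  fixes a b p :: real
  assumes "0 < p" "0 \<le> a" "0 \<le> b"
  shows "(a + b) powr p \<le> 2 powr p * (a powr p + b powr p)"
proof -
  have "(a + b) powr p \<le> (2 * max a b) powr p" using assms by (intro powr_mono2) auto
  also have "\<dots> = 2 powr p * max a b powr p" using assms by (simp add: powr_mult)
  also have "\<dots> \<le> 2 powr p * (a powr p + b powr p)"
    by (intro mult_left_mono) (auto simp: max_def)
  finally show ?thesis .
qed

lemma Lp_measurable: "u \<in> Lp p D \<Longrightarrow> u \<in> borel_measurable (lebesgue_on D)"
  and Lp_integrable: "u \<in> Lp p D \<Longrightarrow> integrable (lebesgue_on D) (\<lambda>x. norm (u x) powr p)"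
  by (auto simp: Lp_def)

lemma Lp_norm_nonneg: "0 \<le> Lp_norm p D u"
  by (simp add: Lp_norm_def)

lemma Lp_norm_powr: "0 < p \<Longrightarrow> Lp_norm p D u powr p = (\<integral>x. norm (u x) powr p \<partial>lebesgue_on D)"
  by (simp add: Lp_norm_def powr_powr integral_nonneg_AE)

lemma Lp_norm_le_iff:
  assumes "0 < p" "0 \<le> c"
  shows "Lp_norm p D u \<le> c \<longleftrightarrow> (\<integral>x. norm (u x) powr p \<partial>lebesgue_on D) \<le> c powr p"
proof -
  have "Lp_norm p D u \<le> c \<longleftrightarrow> Lp_norm p D u powr p \<le> c powr p"
  proof
    assume "Lp_norm p D u \<le> c"
    then show "Lp_norm p D u powr p \<le> c powr p"
      using assms by (intro powr_mono2) (auto simp: Lp_norm_nonneg)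
  next
    assume *: "Lp_norm p D u powr p \<le> c powr p"
    show "Lp_norm p D u \<le> c"
    proof (rule ccontr)
      assume "\<not> Lp_norm p D u \<le> c"
      then have "c powr p < Lp_norm p D u powr p" using assms by (intro powr_less_mono2) auto
      with * show False by simp
    qed
  qed
  then show ?thesis using assms by (simp add: Lp_norm_powr)
qed

lemma Lp_norm_cong_AE:
  assumes "u \<in> borel_measurable (lebesgue_on D)" "v \<in> borel_measurable (lebesgue_on D)"
    and "AE x in lebesgue_on D. u x = v x"
  shows "Lp_norm p D u = Lp_norm p D v"
  unfolding Lp_norm_def using assms by (intro arg_cong[where f="\<lambda>x. x powr _"] integral_cong_AE) auto

lemma Lp_norm_cong: "(\<And>x. x \<in> D \<Longrightarrow> u x = v x) \<Longrightarrow> Lp_norm p D u = Lp_norm p D v"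
  unfolding Lp_norm_def by (intro arg_cong[where f="\<lambda>x. x powr _"] Bochner_Integration.integral_cong) auto

lemma Lp_cong:
  assumes "\<And>x. x \<in> D \<Longrightarrow> u x = v x" "u \<in> Lp p D"
  shows "v \<in> Lp p D"
proof -
  have "v \<in> borel_measurable (lebesgue_on D) \<longleftrightarrow> u \<in> borel_measurable (lebesgue_on D)"
    by (rule measurable_cong) (simp add: assms(1))
  moreover have "integrable (lebesgue_on D) (\<lambda>x. norm (v x) powr p) \<longleftrightarrow> integrable (lebesgue_on D) (\<lambda>x. norm (u x) powr p)"
    by (rule Bochner_Integration.integrable_cong) (simp_all add: assms(1))
  ultimately show ?thesis using assms(2) by (simp add: Lp_def)
qed

lemma Lp_bound:
  assumes "0 < p" "v \<in> Lp p D" "u \<in> borel_measurable (lebesgue_on D)" "0 \<le> c"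
    and "\<And>x. x \<in> D \<Longrightarrow> norm (u x) \<le> c * norm (v x)"
  shows "u \<in> Lp p D" "Lp_norm p D u \<le> c * Lp_norm p D v"
proof -
  have le: "norm (u x) powr p \<le> c powr p * norm (v x) powr p" if "x \<in> D" for x
    using powr_mono2[OF less_imp_le[OF assms(1)] norm_ge_zero assms(5)[OF that]] assms(4)
    by (simp add: powr_mult)
  have v: "integrable (lebesgue_on D) (\<lambda>x. c powr p * norm (v x) powr p)"
    using assms(2) by (simp add: Lp_def)
  have u: "integrable (lebesgue_on D) (\<lambda>x. norm (u x) powr p)"
    by (rule Bochner_Integration.integrable_bound[OF v]) (use assms(3) le in auto)
  then show "u \<in> Lp p D" using assms(3) by (simp add: Lp_def)
  have "(\<integral>x. norm (u x) powr p \<partial>lebesgue_on D) \<le> (\<integral>x. c powr p * norm (v x) powr p \<partial>lebesgue_on D)"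
    by (rule integral_mono[OF u v]) (use le in auto)
  also have "\<dots> = (c * Lp_norm p D v) powr p"
    using assms(1,4) by (simp add: powr_mult Lp_norm_powr Lp_norm_nonneg)
  finally show "Lp_norm p D u \<le> c * Lp_norm p D v"
    using assms(1,4) by (simp add: Lp_norm_le_iff Lp_norm_nonneg)
qed

lemma Lp_add:
  assumes "0 < p" "u \<in> Lp p D" "v \<in> Lp p D"
  shows "(\<lambda>x. u x + v x) \<in> Lp p D"
proof -
  have m: "(\<lambda>x. u x + v x) \<in> borel_measurable (lebesgue_on D)" using assms by (auto simp: Lp_def)
  have "integrable (lebesgue_on D) (\<lambda>x. norm (u x + v x) powr p)"
  proof (rule Bochner_Integration.integrable_bound)
    show "integrable (lebesgue_on D) (\<lambda>x. 2 powr p * (norm (u x) powr p + norm (v x) powr p))"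
      using assms by (simp add: Lp_def)
    have "norm (u x + v x) powr p \<le> 2 powr p * (norm (u x) powr p + norm (v x) powr p)" for x
      using powr_mono2[OF less_imp_le[OF assms(1)] norm_ge_zero norm_triangle_ineq[of "u x" "v x"]]
        powr_add_le[OF assms(1), of "norm (u x)" "norm (v x)"] by simp
    then show "AE x in lebesgue_on D. norm (norm (u x + v x) powr p) \<le> norm (2 powr p * (norm (u x) powr p + norm (v x) powr p))"
      by simp
  qed (use m in auto)
  then show ?thesis using m by (simp add: Lp_def)
qed

lemma Lp_linear:
  fixes h :: "'b::euclidean_space \<Rightarrow> 'c::euclidean_space"
  assumes "0 < p" "u \<in> Lp p D" "bounded_linear h"
  shows "(\<lambda>x. h (u x)) \<in> Lp p D" "Lp_norm p D (\<lambda>x. h (u x)) \<le> onorm h * Lp_norm p D u"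
proof -
  have "(\<lambda>x. h (u x)) \<in> borel_measurable (lebesgue_on D)"
    using borel_measurable_continuous_on[OF linear_continuous_on[OF assms(3), of UNIV] Lp_measurable[OF assms(2)]] .
  then show "(\<lambda>x. h (u x)) \<in> Lp p D" "Lp_norm p D (\<lambda>x. h (u x)) \<le> onorm h * Lp_norm p D u"
    using Lp_bound[OF assms(1,2), of "\<lambda>x. h (u x)" "onorm h"] onorm[OF assms(3)] onorm_pos_le[OF assms(3)] by blast+
qed

lemma Lp_minus: "0 < p \<Longrightarrow> u \<in> Lp p D \<Longrightarrow> (\<lambda>x. - u x) \<in> Lp p D"
  using Lp_linear(1)[OF _ _ bounded_linear_minus[OF bounded_linear_ident]] .

lemma Lp_diff: "0 < p \<Longrightarrow> u \<in> Lp p D \<Longrightarrow> v \<in> Lp p D \<Longrightarrow> (\<lambda>x. u x - v x) \<in> Lp p D"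
  using Lp_add[OF _ _ Lp_minus, of p u D v] by simp

lemma Lp_zero: "(\<lambda>x. 0) \<in> Lp p D"
  by (simp add: Lp_def)

lemma Lp_norm_zero: "Lp_norm p D (\<lambda>x. 0) = 0"
  by (simp add: Lp_norm_def)

lemma Lp_norm_scaleR: "0 < p \<Longrightarrow> Lp_norm p D (\<lambda>x. c *\<^sub>R u x) = \<bar>c\<bar> * Lp_norm p D u"
  by (simp add: Lp_norm_def powr_mult powr_powr integral_nonneg_AE)

lemma Lp_norm_minus_commute: "Lp_norm p D (\<lambda>x. u x - v x) = Lp_norm p D (\<lambda>x. v x - u x)"
  by (simp add: Lp_norm_def norm_minus_commute)

text \<open>Minkowski's inequality from convexity of the power. With \<open>a\<close> and
  \<open>b\<close> slightly above the two norms, \<open>u + v\<close> is \<open>a + b\<close> times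
  a convex combination of \<open>u / a\<close> and \<open>v / b\<close>, whose power integrals are
  at most 1. The margin \<open>e / 2\<close> keeps \<open>a\<close> and \<open>b\<close> positive
  when a norm vanishes.\<close>

lemma Lp_norm_triangle:
  fixes u v :: "real^'n \<Rightarrow> 'b::euclidean_space"
  assumes p: "1 < p" and u: "u \<in> Lp p D" and v: "v \<in> Lp p D"
  shows "Lp_norm p D (\<lambda>x. u x + v x) \<le> Lp_norm p D u + Lp_norm p D v"
proof (rule field_le_epsilon)
  fix e :: real assume e: "0 < e"
  define a b where "a = Lp_norm p D u + e / 2" and "b = Lp_norm p D v + e / 2"
  have ab: "0 < a" "0 < b" using Lp_norm_nonneg[of p D u] Lp_norm_nonneg[of p D v] e by (auto simp: a_def b_def)
  define l where "l = b / (a + b)"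
  have l: "0 \<le> l" "l \<le> 1" "(a + b) * l = b" "(a + b) * (1 - l) = a"
    using ab by (auto simp: l_def field_simps)
  have pt: "norm (u x + v x) powr p \<le> (a + b) powr p * ((1 - l) * (norm (u x) powr p / a powr p) + l * (norm (v x) powr p / b powr p))" for x
  proof -
    have "(a + b) * ((1 - l) * (norm (u x) / a) + l * (norm (v x) / b))
        = ((a + b) * (1 - l)) * (norm (u x) / a) + ((a + b) * l) * (norm (v x) / b)" by (simp only: distrib_left mult.assoc)
    also have "\<dots> = norm (u x) + norm (v x)" unfolding l using ab by simp
    finally have "norm (u x + v x) \<le> (a + b) * ((1 - l) * (norm (u x) / a) + l * (norm (v x) / b))"
      using norm_triangle_ineq[of "u x" "v x"] by simp
    then have "norm (u x + v x) powr p \<le> ((a + b) * ((1 - l) * (norm (u x) / a) + l * (norm (v x) / b))) powr p"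
      using p by (intro powr_mono2) auto
    also have "\<dots> = (a + b) powr p * ((1 - l) * (norm (u x) / a) + l * (norm (v x) / b)) powr p"
      using ab l by (intro powr_mult)
    also have "\<dots> \<le> (a + b) powr p * ((1 - l) * (norm (u x) / a) powr p + l * (norm (v x) / b) powr p)"
      using ab l p by (intro mult_left_mono powr_convex_combination) auto
    finally show ?thesis using ab by (simp add: powr_divide)
  qed
  have iu: "(\<integral>x. norm (u x) powr p \<partial>lebesgue_on D) / a powr p \<le> 1"
    using Lp_norm_le_iff[of p a D u] ab p e by (simp add: a_def)
  have iv: "(\<integral>x. norm (v x) powr p \<partial>lebesgue_on D) / b powr p \<le> 1"
    using Lp_norm_le_iff[of p b D v] ab p e by (simp add: b_def)
  have "(\<integral>x. norm (u x + v x) powr p \<partial>lebesgue_on D) \<le> (\<integral>x. (a + b) powr p * ((1 - l) * (norm (u x) powr p / a powr p) + l * (norm (v x) powr p / b powr p)) \<partial>lebesgue_on D)"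
    using Lp_integrable[OF Lp_add[OF _ u v]] Lp_integrable[OF u] Lp_integrable[OF v] p pt
    by (intro integral_mono) auto
  also have "\<dots> = (a + b) powr p * ((1 - l) * ((\<integral>x. norm (u x) powr p \<partial>lebesgue_on D) / a powr p) + l * ((\<integral>x. norm (v x) powr p \<partial>lebesgue_on D) / b powr p))"
    using Lp_integrable[OF u] Lp_integrable[OF v] by simp
  also have "\<dots> \<le> (a + b) powr p * ((1 - l) * 1 + l * 1)"
    using l iu iv by (intro mult_left_mono add_mono) auto
  finally have "Lp_norm p D (\<lambda>x. u x + v x) \<le> a + b"
    using Lp_norm_le_iff[of p "a + b" D "\<lambda>x. u x + v x"] ab p by simp
  then show "Lp_norm p D (\<lambda>x. u x + v x) \<le> Lp_norm p D u + Lp_norm p D v + e"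
    by (simp add: a_def b_def)
qed

lemma Lp_norm_triangle_diff:
  assumes "1 < p" "u \<in> Lp p D" "v \<in> Lp p D" "w \<in> Lp p D"
  shows "Lp_norm p D (\<lambda>x. u x - w x) \<le> Lp_norm p D (\<lambda>x. u x - v x) + Lp_norm p D (\<lambda>x. v x - w x)"
  using Lp_norm_triangle[OF assms(1) Lp_diff[OF _ assms(2,3)] Lp_diff[OF _ assms(3,4)]] assms(1) by simp

text \<open>Young's inequality for the normalized functions. The norms are increased by
  \<open>e\<close> to allow division even if one is 0, and then \<open>e\<close> tends to 0.\<close>

lemma Holder:
  fixes u v :: "real^'n \<Rightarrow> 'b::euclidean_space"
  assumes pq: "1 < p" "1 < q" "1 / p + 1 / q = 1" and u: "u \<in> Lp p D" and v: "v \<in> Lp q D"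
  shows "integrable (lebesgue_on D) (\<lambda>x. u x \<bullet> v x)"
    "\<bar>\<integral>x. u x \<bullet> v x \<partial>lebesgue_on D\<bar> \<le> Lp_norm p D u * Lp_norm q D v"
proof -
  have le: "\<bar>u x \<bullet> v x\<bar> \<le> a * b * (norm (u x) powr p / a powr p / p + norm (v x) powr q / b powr q / q)"
    if "0 < a" "0 < b" for a b x
  proof -
    have "\<bar>u x \<bullet> v x\<bar> \<le> a * b * ((norm (u x) / a) * (norm (v x) / b))"
      using Cauchy_Schwarz_ineq2[of "u x" "v x"] that by simp
    also have "\<dots> \<le> a * b * ((norm (u x) / a) powr p / p + (norm (v x) / b) powr q / q)"
      using that pq by (intro mult_left_mono Youngs_inequality) auto
    finally show ?thesis using that by (simp add: powr_divide)
  qed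
  have m: "(\<lambda>x. u x \<bullet> v x) \<in> borel_measurable (lebesgue_on D)"
    using Lp_measurable[OF u] Lp_measurable[OF v] by simp
  have i: "integrable (lebesgue_on D) (\<lambda>x. a * b * (norm (u x) powr p / a powr p / p + norm (v x) powr q / b powr q / q))" for a b
    using Lp_integrable[OF u] Lp_integrable[OF v] by simp
  show iuv: "integrable (lebesgue_on D) (\<lambda>x. u x \<bullet> v x)"
    by (rule Bochner_Integration.integrable_bound[OF i[of 1 1] m])
       (use le[of 1 1] in \<open>auto intro!: order_trans[OF _ abs_ge_self]\<close>)
  define A B where "A = Lp_norm p D u" and "B = Lp_norm q D v"
  have AB: "0 \<le> A" "0 \<le> B" by (auto simp: A_def B_def Lp_norm_nonneg)
  have bd: "\<bar>\<integral>x. u x \<bullet> v x \<partial>lebesgue_on D\<bar> \<le> (A + e) * (B + e)" if e: "0 < e" for e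
  proof -
    define a b where "a = A + e" and "b = B + e"
    have ab: "0 < a" "0 < b" using AB e by (auto simp: a_def b_def)
    have iu: "(\<integral>x. norm (u x) powr p \<partial>lebesgue_on D) / a powr p \<le> 1"
      using Lp_norm_le_iff[of p a D u] ab pq e by (simp add: a_def A_def)
    have iv: "(\<integral>x. norm (v x) powr q \<partial>lebesgue_on D) / b powr q \<le> 1"
      using Lp_norm_le_iff[of q b D v] ab pq e by (simp add: b_def B_def)
    have "\<bar>\<integral>x. u x \<bullet> v x \<partial>lebesgue_on D\<bar> \<le> (\<integral>x. \<bar>u x \<bullet> v x\<bar> \<partial>lebesgue_on D)"
      by (rule integral_abs_bound)
    also have "\<dots> \<le> (\<integral>x. a * b * (norm (u x) powr p / a powr p / p + norm (v x) powr q / b powr q / q) \<partial>lebesgue_on D)"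
      using le[OF ab] i iuv by (intro integral_mono) auto
    also have "\<dots> = a * b * ((\<integral>x. norm (u x) powr p \<partial>lebesgue_on D) / a powr p / p + (\<integral>x. norm (v x) powr q \<partial>lebesgue_on D) / b powr q / q)"
      using Lp_integrable[OF u] Lp_integrable[OF v] by simp
    also have "\<dots> \<le> a * b * (1 / p + 1 / q)"
      using iu iv ab pq by (intro mult_left_mono add_mono divide_right_mono) auto
    finally show ?thesis using pq by (simp add: a_def b_def)
  qed
  have "(\<lambda>n. (A + inverse (real (Suc n))) * (B + inverse (real (Suc n)))) \<longlonglongrightarrow> (A + 0) * (B + 0)"
    by (intro tendsto_intros LIMSEQ_inverse_real_of_nat)
  then have "\<bar>\<integral>x. u x \<bullet> v x \<partial>lebesgue_on D\<bar> \<le> (A + 0) * (B + 0)"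
    by (rule LIMSEQ_le_const) (use bd in auto)
  then show "\<bar>\<integral>x. u x \<bullet> v x \<partial>lebesgue_on D\<bar> \<le> Lp_norm p D u * Lp_norm q D v"
    by (simp add: A_def B_def)
qed

lemma Lp_bounded:
  assumes "0 < p" "D \<in> lmeasurable" "u \<in> borel_measurable (lebesgue_on D)" "\<And>x. x \<in> D \<Longrightarrow> norm (u x) \<le> B"
  shows "u \<in> Lp p D"
proof -
  interpret finite_measure "lebesgue_on D" by (rule finite_measure_lebesgue_on[OF assms(2)])
  have "norm (u x) powr p \<le> B powr p" if "x \<in> D" for x
    using assms that by (intro powr_mono2) auto
  then have "integrable (lebesgue_on D) (\<lambda>x. norm (u x) powr p)"
    using assms(3) by (intro integrable_const_bound[where B="B powr p"]) auto
  then show ?thesis using assms(3) by (simp add: Lp_def)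
qed

lemma Lp_subset:
  assumes "D' \<subseteq> D" "D \<in> sets lebesgue" "D' \<in> sets lebesgue" "u \<in> Lp p D"
  shows "u \<in> Lp p D'"
    "(\<integral>x. norm (u x) powr p \<partial>lebesgue_on D') \<le> (\<integral>x. norm (u x) powr p \<partial>lebesgue_on D)"
proof -
  have m: "u \<in> borel_measurable (lebesgue_on D')"
    using measurable_restrict_mono[OF Lp_measurable[OF assms(4)] assms(1)] .
  have i: "integrable lebesgue (\<lambda>x. indicator D x *\<^sub>R norm (u x) powr p)"
    using Lp_integrable[OF assms(4)] assms(2) by (simp add: integrable_restrict_space)
  have eq: "(\<lambda>x. indicator D' x *\<^sub>R norm (u x) powr p) = (\<lambda>x. indicator D' x *\<^sub>R (indicator D x *\<^sub>R norm (u x) powr p))"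
    using assms(1) by (intro ext) (auto simp: indicator_def)
  have i': "integrable lebesgue (\<lambda>x. indicator D' x *\<^sub>R norm (u x) powr p)"
    unfolding eq by (rule integrable_mult_indicator[OF assms(3) i])
  then have "integrable (lebesgue_on D') (\<lambda>x. norm (u x) powr p)"
    using assms(3) by (simp add: integrable_restrict_space)
  then show "u \<in> Lp p D'" using m by (simp add: Lp_def)
  have "(\<integral>x. indicator D' x *\<^sub>R norm (u x) powr p \<partial>lebesgue) \<le> (\<integral>x. indicator D x *\<^sub>R norm (u x) powr p \<partial>lebesgue)"
    by (rule integral_mono[OF i' i]) (use assms(1) in \<open>auto simp: indicator_def\<close>)
  then show "(\<integral>x. norm (u x) powr p \<partial>lebesgue_on D') \<le> (\<integral>x. norm (u x) powr p \<partial>lebesgue_on D)"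
    using assms(2,3) by (simp add: integral_restrict_space)
qed

section \<open>Density of test functions and separability\<close>

lemma lebesgue_sandwich:
  fixes E :: "(real^'n) set"
  assumes "E \<in> sets lebesgue" "bounded E" "0 < \<delta>"
  obtains K U where "compact K" "open U" "K \<subseteq> E" "E \<subseteq> U" "U - K \<in> lmeasurable" "measure lebesgue (U - K) < \<delta>"
proof -
  obtain K where K: "closed K" "K \<subseteq> E" "E - K \<in> lmeasurable" "emeasure lebesgue (E - K) < ennreal (\<delta> / 2)"
    using sets_lebesgue_inner_closed[OF assms(1), of "\<delta> / 2"] assms(3) by auto
  obtain U where U: "open U" "E \<subseteq> U" "U - E \<in> lmeasurable" "emeasure lebesgue (U - E) < ennreal (\<delta> / 2)"
    using sets_lebesgue_outer_open[OF assms(1), of "\<delta> / 2"] assms(3) by auto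
  have eq: "U - K = (U - E) \<union> (E - K)" using K(2) U(2) by auto
  have "measure lebesgue (U - K) \<le> measure lebesgue (U - E) + measure lebesgue (E - K)"
    unfolding eq using K(3) U(3) by (intro measure_Un_le) auto
  also have "\<dots> < \<delta> / 2 + \<delta> / 2"
    using K(3,4) U(3,4) assms(3) by (intro add_strict_mono) (auto simp: emeasure_eq_measure2 ennreal_less_iff)
  finally have "measure lebesgue (U - K) < \<delta>" by simp
  moreover have "compact K" using K(1,2) assms(2) bounded_subset compact_eq_bounded_closed by blast
  moreover have "U - K \<in> lmeasurable" unfolding eq by (rule fmeasurable.Un[OF U(3) K(3)])
  ultimately show ?thesis using that K U by blast
qed

text \<open>\<open>f\<close> differs from the indicator of \<open>E\<close> only on
  \<open>U - K\<close>, and there by at most 1. It is left general because it is a smooth cutoff in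
  one application and the indicator of an open set in another.\<close>

lemma Lp_norm_indicator_approx:
  fixes f :: "real^'n \<Rightarrow> real"
  assumes p: "0 < p" and D: "D \<in> sets lebesgue" and f: "f \<in> borel_measurable (lebesgue_on D)" "\<And>x. 0 \<le> f x" "\<And>x. f x \<le> 1"
    and K: "K \<subseteq> E" "E \<subseteq> U" "\<And>x. x \<in> K \<Longrightarrow> f x = 1" "\<And>x. x \<in> D - U \<Longrightarrow> f x = 0"
    and m: "U - K \<in> lmeasurable" "E \<in> sets lebesgue"
  shows "Lp_norm p D (\<lambda>x. indicator E x *\<^sub>R c - f x *\<^sub>R c) \<le> norm c * measure lebesgue (U - K) powr (1 / p)"
proof -
  have le: "norm (indicator E x *\<^sub>R c - f x *\<^sub>R c) powr p \<le> norm c powr p * indicator (U - K) x" if "x \<in> D" for x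
  proof (cases "x \<in> U - K")
    case True
    have "norm (indicator E x *\<^sub>R c - f x *\<^sub>R c) = \<bar>indicator E x - f x\<bar> * norm c"
      unfolding scaleR_left_diff_distrib[symmetric] by simp
    also have "\<dots> \<le> 1 * norm c" using f(2,3)[of x] by (intro mult_right_mono) (auto simp: indicator_def)
    finally show ?thesis using True p by (simp add: powr_mono2)
  next
    case False
    then have "indicator E x = f x" using that K by (cases "x \<in> K") (auto simp: indicator_def)
    then show ?thesis by simp
  qed
  have i: "integrable (lebesgue_on D) (\<lambda>x. norm c powr p * indicator (U - K) x)"
  proof -
    have "integrable lebesgue (\<lambda>x. indicator D x *\<^sub>R indicator (U - K) x :: real)"
      using m D by (intro integrable_mult_indicator) (auto simp: integrable_indicator_iff fmeasurable_def)
    then show ?thesis using D by (simp add: integrable_restrict_space mult.left_commute)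
  qed
  have meas: "(\<lambda>x. norm (indicator E x *\<^sub>R c - f x *\<^sub>R c) powr p) \<in> borel_measurable (lebesgue_on D)"
  proof -
    have [measurable]: "(indicator E :: _ \<Rightarrow> real) \<in> borel_measurable (lebesgue_on D)"
      using m(2) by (intro measurable_restrict_space1 borel_measurable_indicator)
    note f(1)[measurable]
    show ?thesis by measurable
  qed
  have "(\<integral>x. norm (indicator E x *\<^sub>R c - f x *\<^sub>R c) powr p \<partial>lebesgue_on D) \<le> (\<integral>x. norm c powr p * indicator (U - K) x \<partial>lebesgue_on D)"
    by (rule integral_mono[OF Bochner_Integration.integrable_bound[OF i meas] i]) (use le in auto)
  also have "\<dots> = norm c powr p * (\<integral>x. indicator D x * indicator (U - K) x \<partial>lebesgue)"
    using D by (subst integral_restrict_space) (auto simp: mult.left_commute[of "indicator D _"])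
  also have "(\<integral>x. indicator D x * indicator (U - K) x \<partial>lebesgue) = measure lebesgue (D \<inter> (U - K))"
    by (simp add: indicator_inter_arith[symmetric])
  also have "\<dots> \<le> measure lebesgue (U - K)"
    using m(1) D by (intro measure_mono_fmeasurable) (auto simp: fmeasurableD)
  finally have "(\<integral>x. norm (indicator E x *\<^sub>R c - f x *\<^sub>R c) powr p \<partial>lebesgue_on D)
      \<le> (norm c * measure lebesgue (U - K) powr (1 / p)) powr p"
    using p by (simp add: powr_mult powr_powr mult_left_mono)
  then show ?thesis using p by (simp add: Lp_norm_le_iff)
qed

lemma indicator_Lp:
  fixes c :: "'b::euclidean_space"
  assumes "0 < p" "D \<in> lmeasurable" "E \<in> sets lebesgue"
  shows "(\<lambda>x. indicator E x *\<^sub>R c) \<in> Lp p D"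
proof (rule Lp_bounded[OF assms(1,2)])
  show "(\<lambda>x. indicator E x *\<^sub>R c) \<in> borel_measurable (lebesgue_on D)"
    by (intro borel_measurable_scaleR borel_measurable_const measurable_restrict_space1 borel_measurable_indicator assms)
  show "norm (indicator E x *\<^sub>R c) \<le> norm c" for x by (simp add: indicator_def)
qed

text \<open>Reduction to single indicators through simple functions. The vector \<open>c\<close> is
  part of the hypothesis on indicators, so closure under sums is the only algebraic property asked
  of \<open>S\<close>; it serves both for test functions and for a countable set without linear
  structure.\<close>

lemma Lp_dense:
  fixes S :: "(real^'n \<Rightarrow> 'b::euclidean_space) set"
  assumes p: "1 < p" and D: "D \<in> lmeasurable" and S: "S \<subseteq> Lp p D" "(\<lambda>x. 0) \<in> S"
    and add: "\<And>s t. s \<in> S \<Longrightarrow> t \<in> S \<Longrightarrow> (\<lambda>x. s x + t x) \<in> S"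
    and ind: "\<And>E c \<epsilon>. E \<in> sets lebesgue \<Longrightarrow> E \<subseteq> D \<Longrightarrow> 0 < \<epsilon> \<Longrightarrow> \<exists>s\<in>S. Lp_norm p D (\<lambda>x. indicator E x *\<^sub>R c - s x) < \<epsilon>"
    and u: "u \<in> Lp p D" and e: "0 < \<epsilon>"
  shows "\<exists>s\<in>S. Lp_norm p D (\<lambda>x. u x - s x) < \<epsilon>"
proof -
  have p0: "0 < p" using p by simp
  have Ds: "D \<in> sets lebesgue" using D by auto
  note Lind = indicator_Lp[OF p0 D]
  have fin: "(\<lambda>x. \<Sum>y\<in>Y. indicator (E y) x *\<^sub>R y) \<in> Lp p D \<and>
      (\<forall>\<epsilon>>0. \<exists>s\<in>S. Lp_norm p D (\<lambda>x. (\<Sum>y\<in>Y. indicator (E y) x *\<^sub>R y) - s x) < \<epsilon>)"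
    if "finite Y" "\<And>y. y \<in> Y \<Longrightarrow> E y \<in> sets lebesgue \<and> E y \<subseteq> D" for Y :: "'b set" and E
    using that
  proof (induction Y rule: finite_induct)
    case empty
    have "Lp_norm p D (\<lambda>x. (\<Sum>y\<in>{}. indicator (E y) x *\<^sub>R y) - 0) = 0"
      by (simp add: Lp_norm_zero)
    then show ?case using S(2) Lp_zero by (auto intro!: bexI[of _ "\<lambda>x. 0"])
  next
    case (insert y Y)
    let ?f = "\<lambda>x. \<Sum>y\<in>Y. indicator (E y) x *\<^sub>R y" and ?g = "\<lambda>x. indicator (E y) x *\<^sub>R y"
    have f: "?f \<in> Lp p D" using insert by auto
    have g: "?g \<in> Lp p D" using insert Lind by auto
    have "\<exists>s\<in>S. Lp_norm p D (\<lambda>x. ?g x + ?f x - s x) < \<epsilon>" if "0 < \<epsilon>" for \<epsilon>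
    proof -
      obtain s where s: "s \<in> S" "Lp_norm p D (\<lambda>x. ?f x - s x) < \<epsilon> / 2" using insert \<open>0 < \<epsilon>\<close> half_gt_zero by blast
      obtain t where t: "t \<in> S" "Lp_norm p D (\<lambda>x. ?g x - t x) < \<epsilon> / 2"
        using ind[of "E y" "\<epsilon> / 2" y] insert \<open>0 < \<epsilon>\<close> by auto
      have "(\<lambda>x. ?g x - t x) \<in> Lp p D" "(\<lambda>x. ?f x - s x) \<in> Lp p D"
        using Lp_diff[OF p0 g, of t] Lp_diff[OF p0 f, of s] s t S(1) by auto
      from Lp_norm_triangle[OF p this]
      have "Lp_norm p D (\<lambda>x. ?g x + ?f x - (t x + s x)) < \<epsilon>" using s t by (simp add: algebra_simps)
      then show ?thesis using add[OF t(1) s(1)] by (intro bexI[of _ "\<lambda>x. t x + s x"])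
    qed
    then show ?case using Lp_add[OF p0 g f] by (simp only: sum.insert[OF insert.hyps]) blast
  qed
  obtain F where F: "\<And>i. simple_function (lebesgue_on D) (F i)" "\<And>x. x \<in> D \<Longrightarrow> (\<lambda>i. F i x) \<longlonglongrightarrow> u x"
     "\<And>i x. x \<in> D \<Longrightarrow> norm (F i x) \<le> 2 * norm (u x)"
  proof -
    obtain F where "\<forall>i. simple_function (lebesgue_on D) (F i)" "\<forall>x\<in>space (lebesgue_on D). (\<lambda>i. F i x) \<longlonglongrightarrow> u x"
     "\<forall>i. \<forall>x\<in>space (lebesgue_on D). dist (F i x) 0 \<le> 2 * dist (u x) 0"
      using borel_measurable_implies_sequence_metric[OF Lp_measurable[OF u], of 0] by blast
    then show ?thesis by (intro that[of F]) auto
  qed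
  have Fm: "F i \<in> borel_measurable (lebesgue_on D)" for i
    using borel_measurable_simple_function[OF F(1)] .
  have FL: "F i \<in> Lp p D" for i by (rule Lp_bound[OF p0 u Fm, of 2]) (use F(3) in auto)
  \<comment> \<open>The simple functions satisfy \<open>|F i| \<le> 2 |u|\<close>, whence
    \<open>|u - F i| \<le> 3 |u|\<close> and the dominating function
    \<open>3^p |u|^p\<close>.\<close>
  have "(\<lambda>i. \<integral>x. norm (u x - F i x) powr p \<partial>lebesgue_on D) \<longlonglongrightarrow> (\<integral>x. 0 \<partial>lebesgue_on D)"
  proof (rule integral_dominated_convergence[where w="\<lambda>x. 3 powr p * norm (u x) powr p"])
    show "(\<lambda>x. norm (u x - F i x) powr p) \<in> borel_measurable (lebesgue_on D)" for i
      using Fm[of i] Lp_measurable[OF u] by simp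
    show "integrable (lebesgue_on D) (\<lambda>x. 3 powr p * norm (u x) powr p)" using Lp_integrable[OF u] by simp
    show "AE x in lebesgue_on D. (\<lambda>i. norm (u x - F i x) powr p) \<longlonglongrightarrow> 0"
    proof (rule AE_I2)
      fix x assume "x \<in> space (lebesgue_on D)"
      then have "(\<lambda>i. norm (u x - F i x)) \<longlonglongrightarrow> norm (u x - u x)" using F(2) by (intro tendsto_intros) auto
      then have "(\<lambda>i. norm (u x - F i x) powr p) \<longlonglongrightarrow> norm (u x - u x) powr p"
        using p0 by (intro tendsto_powr') auto
      then show "(\<lambda>i. norm (u x - F i x) powr p) \<longlonglongrightarrow> 0" by simp
    qed
    show "AE x in lebesgue_on D. norm (norm (u x - F i x) powr p) \<le> 3 powr p * norm (u x) powr p" for i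
    proof (rule AE_I2)
      fix x assume "x \<in> space (lebesgue_on D)"
      then have "norm (u x - F i x) \<le> 3 * norm (u x)" using F(3)[of x i] norm_triangle_ineq4[of "u x" "F i x"] by simp
      then have "norm (u x - F i x) powr p \<le> (3 * norm (u x)) powr p" using p0 by (intro powr_mono2) auto
      then show "norm (norm (u x - F i x) powr p) \<le> 3 powr p * norm (u x) powr p" by (simp add: powr_mult)
    qed
  qed auto
  then have "\<forall>\<^sub>F i in sequentially. (\<integral>x. norm (u x - F i x) powr p \<partial>lebesgue_on D) < (\<epsilon> / 3) powr p"
    using e by (intro order_tendstoD) auto
  then obtain i where i: "(\<integral>x. norm (u x - F i x) powr p \<partial>lebesgue_on D) < (\<epsilon> / 3) powr p"
    by (meson eventually_happens trivial_limit_sequentially)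
  then have 1: "Lp_norm p D (\<lambda>x. u x - F i x) \<le> \<epsilon> / 3" using p0 e by (subst Lp_norm_le_iff) auto
  define E where "E y = F i -` {y} \<inter> D" for y
  have E: "E y \<in> sets lebesgue \<and> E y \<subseteq> D" for y
  proof -
    have "E y \<in> sets (lebesgue_on D)"
      using simple_functionD(2)[OF F(1)[of i], of "{y}"] by (simp add: E_def)
    then show ?thesis using Ds by (simp add: sets_restrict_space_iff)
  qed
  have fY: "finite (F i ` D)" using simple_functionD(1)[OF F(1)[of i]] by simp
  have rep: "(\<Sum>y\<in>F i ` D. indicator (E y) x *\<^sub>R y) = F i x" if "x \<in> D" for x
  proof -
    have "(\<Sum>y\<in>F i ` D. indicator (E y) x *\<^sub>R y) = (\<Sum>y\<in>F i ` D. if y = F i x then y else 0)"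
      using that by (intro sum.cong) (auto simp: E_def indicator_def)
    also have "\<dots> = F i x" using fY that by (simp add: sum.delta)
    finally show ?thesis .
  qed
  obtain s where s: "s \<in> S" "Lp_norm p D (\<lambda>x. (\<Sum>y\<in>F i ` D. indicator (E y) x *\<^sub>R y) - s x) < \<epsilon> / 3"
    using fin[OF fY, of E] E e by (meson zero_less_divide_iff zero_less_numeral)
  have "Lp_norm p D (\<lambda>x. F i x - s x) < \<epsilon> / 3"
    using s(2) Lp_norm_cong[of D "\<lambda>x. (\<Sum>y\<in>F i ` D. indicator (E y) x *\<^sub>R y) - s x" "\<lambda>x. F i x - s x"] rep by simp
  moreover have "Lp_norm p D (\<lambda>x. u x - s x) \<le> Lp_norm p D (\<lambda>x. u x - F i x) + Lp_norm p D (\<lambda>x. F i x - s x)"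
    using Lp_norm_triangle_diff[OF p u FL] s(1) S(1) by blast
  ultimately show ?thesis using 1 s(1) e by (intro bexI[of _ s]) auto
qed

lemma small_powr_factor:
  fixes p \<epsilon> C :: real
  assumes "0 < p" "0 < \<epsilon>" "0 \<le> C"
  obtains \<delta> where "0 < \<delta>" "\<And>m. 0 \<le> m \<Longrightarrow> m < \<delta> \<Longrightarrow> C * m powr (1 / p) < \<epsilon>"
proof
  show "0 < (\<epsilon> / (C + 1)) powr p" using assms by simp
  fix m :: real assume m: "0 \<le> m" "m < (\<epsilon> / (C + 1)) powr p"
  have "m powr (1 / p) < ((\<epsilon> / (C + 1)) powr p) powr (1 / p)" using m assms by (intro powr_less_mono2) auto
  also have "\<dots> = \<epsilon> / (C + 1)" using assms by (simp add: powr_powr)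
  finally have "(C + 1) * m powr (1 / p) < \<epsilon>" using assms by (simp add: field_simps)
  then show "C * m powr (1 / p) < \<epsilon>" by (simp add: distrib_right add_strict_increasing2) (smt (verit) powr_ge_zero)
qed

lemma bounded_opens_lmeasurable: "D \<in> bounded_opens \<Longrightarrow> D \<in> lmeasurable"
  by (simp add: bounded_opens_def lmeasurable_open)

lemma test_functions_Lp:
  assumes "0 < p" "\<phi> \<in> test_functions D'" "D \<in> lmeasurable"
  shows "\<phi> \<in> Lp p D"
proof -
  obtain K where K: "compact K" "K \<subseteq> D'" "\<And>x. x \<notin> K \<Longrightarrow> \<phi> x = 0"
    using test_functionsE[OF assms(2)] by blast
  have c: "continuous_on UNIV \<phi>" by (rule C_infinity_continuous[OF test_functions_C_infinity[OF assms(2)]])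
  obtain B where "0 \<le> B" "\<And>x. norm (\<phi> x) \<le> B"
    using continuous_compact_support_bounded[OF c K(1,3)] by blast
  then show ?thesis
    using assms(3) by (intro Lp_bounded[OF assms(1,3), of _ B] borel_measurable_integrable
        test_functions_integrable[OF assms(2)]) auto
qed

lemma test_functions_dense:
  fixes u :: "real^'n \<Rightarrow> 'b::euclidean_space"
  assumes p: "1 < p" and D: "D \<in> bounded_opens" and u: "u \<in> Lp p D" and e: "0 < \<epsilon>"
  shows "\<exists>\<phi>\<in>test_functions D. Lp_norm p D (\<lambda>x. u x - \<phi> x) < \<epsilon>"
proof (rule Lp_dense[OF p bounded_opens_lmeasurable[OF D] _ test_functions_zero test_functions_add _ u e])
  have p0: "0 < p" using p by simp
  show "test_functions D \<subseteq> Lp p D"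
    using test_functions_Lp[OF p0 _ bounded_opens_lmeasurable[OF D]] by blast
  fix E :: "(real^'n) set" and c :: 'b and \<epsilon> :: real
  assume E: "E \<in> sets lebesgue" "E \<subseteq> D" and "0 < \<epsilon>"
  obtain \<delta> where \<delta>: "0 < \<delta>" "\<And>m. 0 \<le> m \<Longrightarrow> m < \<delta> \<Longrightarrow> norm c * m powr (1 / p) < \<epsilon>"
    using small_powr_factor[OF p0 \<open>0 < \<epsilon>\<close> norm_ge_zero] by metis
  have "bounded E" using E(2) D bounded_subset by (auto simp: bounded_opens_def)
  from lebesgue_sandwich[OF E(1) this \<delta>(1)] obtain K U where KU: "compact K" "open U" "K \<subseteq> E" "E \<subseteq> U"
    "U - K \<in> lmeasurable" "measure lebesgue (U - K) < \<delta>" by blast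
  have "open (U \<inter> D)" "K \<subseteq> U \<inter> D" using KU E D by (auto simp: bounded_opens_def)
  from smooth_Urysohn[OF KU(1) this] obtain \<phi> V where \<phi>: "\<phi> \<in> test_functions (U \<inter> D)" "\<And>x. 0 \<le> \<phi> x" "\<And>x. \<phi> x \<le> (1::real)"
    "K \<subseteq> V" "\<And>x. x \<in> V \<Longrightarrow> \<phi> x = 1" by metis
  have "Lp_norm p D (\<lambda>x. indicator E x *\<^sub>R c - \<phi> x *\<^sub>R c) \<le> norm c * measure lebesgue (U - K) powr (1 / p)"
  proof (rule Lp_norm_indicator_approx[OF p0 _ _ \<phi>(2,3) KU(3,4) _ _ KU(5) E(1)])
    show "D \<in> sets lebesgue" using bounded_opens_lmeasurable[OF D] by auto
    then show "\<phi> \<in> borel_measurable (lebesgue_on D)" using test_functions_integrable[OF \<phi>(1)] by auto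
    show "\<phi> x = 1" if "x \<in> K" for x using that \<phi> by auto
    show "\<phi> x = 0" if "x \<in> D - U" for x using that test_functions_zero_outside[OF \<phi>(1)] by auto
  qed
  also have "\<dots> < \<epsilon>" using \<delta>(2) KU(6) by simp
  finally show "\<exists>s\<in>test_functions D. Lp_norm p D (\<lambda>x. indicator E x *\<^sub>R c - s x) < \<epsilon>"
    using test_functions_linear[OF \<phi>(1) bounded_linear_scaleR_left[of c]] test_functions_mono[of "U \<inter> D" D]
    by (intro bexI[of _ "\<lambda>x. \<phi> x *\<^sub>R c"]) auto
qed

lemma bounded_opens_subset: "D \<in> bounded_opens \<Longrightarrow> open B \<Longrightarrow> B \<subseteq> D \<Longrightarrow> B \<in> bounded_opens"
  unfolding bounded_opens_def using bounded_subset by blast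

text \<open>The bounded finite unions of sets from a countable basis: a compact subset of an open
  set is covered by finitely many basis sets inside that open set. This is the family of domains for
  which the subsequence is selected.\<close>

lemma countable_open_family:
  obtains \<V> :: "(real^'n) set set" where "countable \<V>" "\<V> \<subseteq> bounded_opens"
    "\<And>K D. compact K \<Longrightarrow> D \<in> bounded_opens \<Longrightarrow> K \<subseteq> D \<Longrightarrow> \<exists>V\<in>\<V>. K \<subseteq> V \<and> V \<subseteq> D"
proof -
  obtain \<B> :: "(real^'n) set set" where B: "countable \<B>" "topological_basis \<B>" using ex_countable_basis by blast
  define \<V> where "\<V> = (\<lambda>l. \<Union>(set l)) ` lists \<B> \<inter> bounded_opens"
  show ?thesis
  proof
    show "countable \<V>" unfolding \<V>_def using B(1) by (intro countable_Int1 countable_image countable_lists)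
    show "\<V> \<subseteq> bounded_opens" by (simp add: \<V>_def)
    fix K D :: "(real^'n) set" assume K: "compact K" and D: "D \<in> bounded_opens" and KD: "K \<subseteq> D"
    have oD: "open D" using D by (simp add: bounded_opens_def)
    have "\<exists>b\<in>\<B>. x \<in> b \<and> b \<subseteq> D" if "x \<in> K" for x
      using topological_basisE[OF B(2) oD] that KD by (metis subsetD)
    then obtain b where b: "\<And>x. x \<in> K \<Longrightarrow> b x \<in> \<B> \<and> x \<in> b x \<and> b x \<subseteq> D" by metis
    have "\<And>x. x \<in> K \<Longrightarrow> open (b x)" "K \<subseteq> (\<Union>x\<in>K. b x)" using b topological_basis_open[OF B(2)] by auto
    then obtain C where C: "C \<subseteq> K" "finite C" "K \<subseteq> (\<Union>x\<in>C. b x)" by (rule compactE_image[OF K])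
    obtain l where l: "set l = b ` C" using finite_list[OF finite_imageI[OF C(2), of b]] by blast
    have "b ` C \<subseteq> \<B>" "b ` C \<subseteq> Pow D" using b C(1) by auto
    then have "l \<in> lists \<B>" "\<Union>(set l) \<subseteq> D" using l by auto
    moreover have "open (\<Union>(set l))" unfolding l using \<open>b ` C \<subseteq> \<B>\<close> topological_basis_open[OF B(2)] by blast
    ultimately have "\<Union>(set l) \<in> \<V>" unfolding \<V>_def using bounded_opens_subset[OF D] by blast
    then show "\<exists>V\<in>\<V>. K \<subseteq> V \<and> V \<subseteq> D" using C(3) l \<open>\<Union>(set l) \<subseteq> D\<close> by (intro bexI[of _ "\<Union>(set l)"]) auto
  qed
qed

text \<open>An indicator is approximated in two steps: the set \<open>E\<close> is replaced by a
  member of the countable family between compact and open approximations of \<open>E\<close>, then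
  the vector by one from a countable dense set.\<close>

lemma Lp_separable:
  assumes p: "1 < p" and D: "D \<in> bounded_opens"
  obtains S :: "(real^'n \<Rightarrow> 'b::euclidean_space) set" where "countable S" "S \<subseteq> Lp p D"
    "\<And>u \<epsilon>. u \<in> Lp p D \<Longrightarrow> 0 < \<epsilon> \<Longrightarrow> \<exists>s\<in>S. Lp_norm p D (\<lambda>x. u x - s x) < \<epsilon>"
proof -
  have p0: "0 < p" using p by simp
  have Dl: "D \<in> lmeasurable" by (rule bounded_opens_lmeasurable[OF D])
  then have Ds: "D \<in> sets lebesgue" by auto
  obtain \<V> :: "(real^'n) set set" where \<V>: "countable \<V>" "\<V> \<subseteq> bounded_opens"
    "\<And>K D. compact K \<Longrightarrow> D \<in> bounded_opens \<Longrightarrow> K \<subseteq> D \<Longrightarrow> \<exists>V\<in>\<V>. K \<subseteq> V \<and> V \<subseteq> D"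
    by (rule countable_open_family) (rule that)
  obtain Q :: "'b set" where Q: "countable Q" "\<And>X. open X \<Longrightarrow> X \<noteq> {} \<Longrightarrow> \<exists>d\<in>Q. d \<in> X"
    using countable_dense_setE by blast
  have oV: "open V" if "V \<in> \<V>" for V using that \<V>(2) by (auto simp: bounded_opens_def)
  \<comment> \<open>Finite sums are encoded by lists over a countable set: countability is then
    immediate, and addition of functions is concatenation.\<close>
  define f :: "('b \<times> (real^'n) set) list \<Rightarrow> real^'n \<Rightarrow> 'b" where "f l x = (\<Sum>(c, V)\<leftarrow>l. indicator V x *\<^sub>R c)" for l x
  define S where "S = f ` lists (Q \<times> \<V>)"
  note Lind = indicator_Lp[OF p0 Dl]
  have fL: "f l \<in> Lp p D" if "l \<in> lists (Q \<times> \<V>)" for l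
    using that
  proof (induction l)
    case Nil
    then show ?case using Lp_zero by (simp add: f_def)
  next
    case (Cons a l)
    obtain c V where a: "a = (c, V)" by (cases a)
    have "V \<in> sets lebesgue" using oV Cons a by (auto simp: lebesgue_openin)
    then have "(\<lambda>x. indicator V x *\<^sub>R c + f l x) \<in> Lp p D" using Cons by (intro Lp_add p0 Lind) auto
    moreover have "f (a # l) = (\<lambda>x. indicator V x *\<^sub>R c + f l x)" by (auto simp: f_def a)
    ultimately show ?case by simp
  qed
  have add: "(\<lambda>x. s x + t x) \<in> S" if "s \<in> S" "t \<in> S" for s t
  proof -
    obtain l m where lm: "s = f l" "t = f m" "l \<in> lists (Q \<times> \<V>)" "m \<in> lists (Q \<times> \<V>)" using \<open>s \<in> S\<close> \<open>t \<in> S\<close> unfolding S_def by blast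
    have "(\<lambda>x. s x + t x) = f (l @ m)" by (auto simp: f_def lm)
    then show ?thesis unfolding S_def using lm by (metis append_in_lists_conv imageI)
  qed
  show ?thesis
  proof
    show "countable S" unfolding S_def using Q(1) \<V>(1) by (intro countable_image countable_lists countable_SIGMA)
    show "S \<subseteq> Lp p D" unfolding S_def using fL by blast
    show "\<exists>s\<in>S. Lp_norm p D (\<lambda>x. u x - s x) < \<epsilon>" if "u \<in> Lp p D" "0 < \<epsilon>" for u \<epsilon>
    proof (rule Lp_dense[OF p Dl \<open>S \<subseteq> Lp p D\<close> _ add _ that])
      show "(\<lambda>x. 0) \<in> S" unfolding S_def by (rule image_eqI[of _ _ "[]"]) (auto simp: f_def)
      fix E :: "(real^'n) set" and c :: 'b and \<epsilon> :: real
      assume E: "E \<in> sets lebesgue" "E \<subseteq> D" and e: "0 < \<epsilon>"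
      obtain \<delta> where \<delta>: "0 < \<delta>" "\<And>m. 0 \<le> m \<Longrightarrow> m < \<delta> \<Longrightarrow> norm c * m powr (1 / p) < \<epsilon> / 2"
        using small_powr_factor[OF p0 half_gt_zero[OF e] norm_ge_zero] by metis
      have "bounded E" using E(2) D bounded_subset by (auto simp: bounded_opens_def)
      from lebesgue_sandwich[OF E(1) this \<delta>(1)] obtain K U where KU: "compact K" "open U" "K \<subseteq> E" "E \<subseteq> U"
        "U - K \<in> lmeasurable" "measure lebesgue (U - K) < \<delta>" by blast
      have UD: "U \<inter> D \<in> bounded_opens" "K \<subseteq> U \<inter> D"
        using KU(2,3,4) E(2) D by (auto intro!: bounded_opens_subset[OF D] simp: bounded_opens_def)
      obtain V where V: "V \<in> \<V>" "K \<subseteq> V" "V \<subseteq> U" using \<V>(3)[OF KU(1) UD] by blast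
      have Vs: "V \<in> sets lebesgue" using oV[OF V(1)] by (auto simp: lebesgue_openin)
      have "Lp_norm p D (\<lambda>x. indicator E x *\<^sub>R c - indicator V x *\<^sub>R c) \<le> norm c * measure lebesgue (U - K) powr (1 / p)"
      proof (rule Lp_norm_indicator_approx[OF p0 Ds _ _ _ KU(3,4) _ _ KU(5) E(1)])
        show "indicator V \<in> borel_measurable (lebesgue_on D)"
          using Vs by (auto intro!: borel_measurable_indicator' simp: measurable_restrict_space1)
      qed (use V in \<open>auto simp: indicator_def\<close>)
      also have "\<dots> < \<epsilon> / 2" using \<delta>(2) KU(6) by simp
      finally have 1: "Lp_norm p D (\<lambda>x. indicator E x *\<^sub>R c - indicator V x *\<^sub>R c) < \<epsilon> / 2" .
      \<comment> \<open>The norm by which an error in the vector \<open>c\<close> is multiplied;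
        division by \<open>M + 1\<close> below is safe even if \<open>M = 0\<close>.\<close>
      define M where "M = Lp_norm p D (indicator V :: _ \<Rightarrow> real)"
      have M: "0 \<le> M" by (simp add: M_def Lp_norm_nonneg)
      have "\<epsilon> / 2 / (M + 1) > 0" using e M by simp
      then have "ball c (\<epsilon> / 2 / (M + 1)) \<noteq> {}" by simp
      then obtain c' where c': "c' \<in> Q" "dist c c' < \<epsilon> / 2 / (M + 1)" using Q(2)[OF open_ball] by (metis mem_ball)
      have "Lp_norm p D (\<lambda>x. indicator V x *\<^sub>R c - indicator V x *\<^sub>R c') \<le> norm (c - c') * M"
        unfolding M_def
      proof (rule Lp_bound(2)[OF p0])
        show "(indicator V :: _ \<Rightarrow> real) \<in> Lp p D"
          using Vs by (intro Lp_bounded[OF p0 Dl, where B=1])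
            (auto intro!: borel_measurable_indicator' simp: measurable_restrict_space1 indicator_def)
        show "(\<lambda>x. indicator V x *\<^sub>R c - indicator V x *\<^sub>R c') \<in> borel_measurable (lebesgue_on D)"
          using Lp_measurable[OF Lp_diff[OF p0 Lind[OF Vs] Lind[OF Vs]]] .
      qed (auto simp: indicator_def)
      also have "\<dots> \<le> norm (c - c') * (M + 1)" by (intro mult_left_mono) auto
      also have "\<dots> < \<epsilon> / 2" using c'(2) M by (simp add: dist_norm field_simps)
      finally have 2: "Lp_norm p D (\<lambda>x. indicator V x *\<^sub>R c - indicator V x *\<^sub>R c') < \<epsilon> / 2" .
      have "Lp_norm p D (\<lambda>x. indicator E x *\<^sub>R c - indicator V x *\<^sub>R c') < \<epsilon>"
        using 1 2 Lp_norm_triangle_diff[OF p Lind[OF E(1), of c] Lind[OF Vs, of c] Lind[OF Vs, of c']] by linarith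
      moreover have "(\<lambda>x. indicator V x *\<^sub>R c') \<in> S"
        unfolding S_def by (rule image_eqI[of _ _ "[(c', V)]"]) (use c' V in \<open>auto simp: f_def\<close>)
      ultimately show "\<exists>s\<in>S. Lp_norm p D (\<lambda>x. indicator E x *\<^sub>R c - s x) < \<epsilon>"
        by (intro bexI[of _ "\<lambda>x. indicator V x *\<^sub>R c'"])
    qed
  qed
qed

section \<open>Weak gradients and dual norms\<close>

lemma open_sets_lebesgue: "open (D :: (real^'n) set) \<Longrightarrow> D \<in> sets lebesgue"
  by (simp add: lebesgue_openin)

lemma bounded_opens_sets: "D \<in> bounded_opens \<Longrightarrow> D \<in> sets lebesgue"
  using bounded_opens_lmeasurable by blast

lemma test_functions_bounded:
  assumes "\<phi> \<in> test_functions D"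
  obtains B where "0 \<le> B" "\<And>x. norm (\<phi> x) \<le> B"
proof -
  obtain K where K: "compact K" "K \<subseteq> D" "\<And>x. x \<notin> K \<Longrightarrow> \<phi> x = 0"
    using test_functionsE[OF assms] by blast
  from continuous_compact_support_bounded[OF C_infinity_continuous[OF test_functions_C_infinity[OF assms]] K(1,3)]
  show ?thesis using that by blast
qed

lemma C_infinity_measurable: "\<phi> \<in> C_infinity \<Longrightarrow> \<phi> \<in> borel_measurable (lebesgue_on D)"
  using borel_measurable_continuous_onI[OF C_infinity_continuous[of \<phi> UNIV]]
  by (intro measurable_restrict_space1 measurable_completion) simp

section \<open>The fundamental lemma of the calculus of variations\<close>

lemma locally_integrable_mult_test:
  fixes g \<phi> :: "real^'n \<Rightarrow> real"
  assumes "locally_integrable D g" "\<phi> \<in> test_functions D" "D \<in> sets lebesgue"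
  shows "integrable (lebesgue_on D) (\<lambda>x. g x * \<phi> x)"
proof -
  obtain K where K: "compact K" "K \<subseteq> D" "\<And>x. x \<notin> K \<Longrightarrow> \<phi> x = 0"
    using test_functionsE[OF assms(2)] by blast
  have Ks: "K \<in> sets lebesgue" using K(1) by (simp add: borel_compact sets_completionI_sets)
  have "integrable (lebesgue_on K) g" using assms(1) K(1,2) by (simp add: locally_integrable_def)
  then have i: "integrable lebesgue (\<lambda>x. indicator K x *\<^sub>R g x)" using Ks by (simp add: integrable_restrict_space)
  obtain B where B: "0 \<le> B" "\<And>x. norm (\<phi> x) \<le> B" using test_functions_bounded[OF assms(2)] by blast
  have m: "\<phi> \<in> borel_measurable lebesgue"
    using C_infinity_measurable[OF test_functions_C_infinity[OF assms(2)], of UNIV] by (simp add: lebesgue_on_UNIV_eq)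
  have eq: "(indicator K x *\<^sub>R g x) * \<phi> x = g x * \<phi> x" for x using K(3) by (cases "x \<in> K") auto
  have "integrable lebesgue (\<lambda>x. (indicator K x *\<^sub>R g x) * \<phi> x)"
  proof (rule Bochner_Integration.integrable_bound)
    show "integrable lebesgue (\<lambda>x. B * (indicator K x *\<^sub>R g x))" using i by simp
    show "(\<lambda>x. (indicator K x *\<^sub>R g x) * \<phi> x) \<in> borel_measurable lebesgue" using i m by auto
    show "AE x in lebesgue. norm ((indicator K x *\<^sub>R g x) * \<phi> x) \<le> norm (B * (indicator K x *\<^sub>R g x))"
      using B by (auto simp: abs_mult mult.commute[of B] intro!: mult_left_mono)
  qed
  then have "integrable lebesgue (\<lambda>x. g x * \<phi> x)" unfolding eq .
  then show ?thesis
    by (subst integrable_lebesgue_on_support[OF assms(3)]) (use test_functions_zero_outside[OF assms(2)] in auto)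
qed

text \<open>\<open>g\<close> is integrable only over compact subsets of \<open>D\<close>, so it is
  cut off to \<open>W\<close> inside a compact set. Smooth cutoffs tending to the indicator of
  \<open>V \<inter> W\<close> show that the resulting \<open>h\<close> has integral 0 over each open
  \<open>V\<close>. Generation of the Borel sets by the intersection-stable family of open sets
  extends this to Borel sets, and null sets extend it to Lebesgue sets; the sets where
  \<open>h\<close> is positive or negative then give \<open>h = 0\<close> almost everywhere.\<close>

lemma du_Bois_Reymond_aux:
  fixes g :: "real^'n \<Rightarrow> real"
  assumes g: "locally_integrable D g" and D: "D \<in> sets lebesgue"
    and zero: "\<And>\<phi>. \<phi> \<in> test_functions D \<Longrightarrow> (\<integral>x. g x * \<phi> x \<partial>lebesgue_on D) = 0"
    and W: "open W" "W \<subseteq> L" "compact L" "L \<subseteq> D"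
  shows "AE x in lebesgue. x \<in> W \<longrightarrow> g x = 0"
proof -
  define h where "h x = indicator W x *\<^sub>R g x" for x
  have Ls: "L \<in> sets lebesgue" using W(3) by (simp add: borel_compact sets_completionI_sets)
  have "integrable lebesgue (\<lambda>x. indicator L x *\<^sub>R g x)"
  proof -
    have "integrable (lebesgue_on L) g" using g W(3,4) by (simp add: locally_integrable_def)
    then show ?thesis using Ls by (simp add: integrable_restrict_space)
  qed
  then have "integrable lebesgue (\<lambda>x. indicator W x *\<^sub>R (indicator L x *\<^sub>R g x))"
    by (rule integrable_mult_indicator[OF open_sets_lebesgue[OF W(1)]])
  moreover have "indicator W x *\<^sub>R (indicator L x *\<^sub>R g x) = h x" for x
    using W(2) by (auto simp: h_def indicator_def)
  ultimately have hi: "integrable lebesgue h" by simp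
  have hV: "(\<integral>x. indicator V x *\<^sub>R h x \<partial>lebesgue) = 0" if V: "open V" for V
  proof -
    obtain C where C: "\<And>n. compact (C n)" "\<And>n. C n \<subseteq> V \<inter> W" "\<And>n. C n \<subseteq> interior (C (Suc n))"
       "\<Union>(range C) = V \<inter> W" "\<And>K. \<lbrakk>compact K; K \<subseteq> V \<inter> W\<rbrakk> \<Longrightarrow> \<exists>N. \<forall>n\<ge>N. K \<subseteq> C n"
      by (rule open_Union_compact_subsets[OF open_Int[OF V W(1)]]) (rule that)
    have "\<exists>\<phi>. \<phi> \<in> test_functions (V \<inter> W) \<and> (\<forall>x. 0 \<le> \<phi> x \<and> \<phi> x \<le> (1::real)) \<and> (\<forall>x\<in>C n. \<phi> x = 1)" for n
      using smooth_Urysohn[OF C(1) open_Int[OF V W(1)] C(2), of n] by (metis subsetD)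
    then obtain \<phi> where \<phi>: "\<And>n. \<phi> n \<in> test_functions (V \<inter> W)" "\<And>n x. 0 \<le> \<phi> n x \<and> \<phi> n x \<le> (1::real)"
        "\<And>n x. x \<in> C n \<Longrightarrow> \<phi> n x = 1" by metis
    have m: "\<phi> n \<in> borel_measurable lebesgue" for n
      using C_infinity_measurable[OF test_functions_C_infinity[OF \<phi>(1)], where D=UNIV] by (simp add: lebesgue_on_UNIV_eq)
    have mV: "(\<lambda>x. indicator V x *\<^sub>R h x) \<in> borel_measurable lebesgue"
      using hi open_sets_lebesgue[OF V] by (intro borel_measurable_scaleR borel_measurable_indicator) auto
    have "(\<lambda>n. \<integral>x. \<phi> n x *\<^sub>R h x \<partial>lebesgue) \<longlonglongrightarrow> (\<integral>x. indicator V x *\<^sub>R h x \<partial>lebesgue)"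
    proof (rule integral_dominated_convergence[where w="\<lambda>x. norm (h x)"])
      show "(\<lambda>x. \<phi> n x *\<^sub>R h x) \<in> borel_measurable lebesgue" for n using m hi by auto
      show "AE x in lebesgue. (\<lambda>n. \<phi> n x *\<^sub>R h x) \<longlonglongrightarrow> indicator V x *\<^sub>R h x"
      proof (rule AE_I2)
        fix x
        show "(\<lambda>n. \<phi> n x *\<^sub>R h x) \<longlonglongrightarrow> indicator V x *\<^sub>R h x"
        proof (cases "x \<in> V \<inter> W")
          case True
          then obtain N where "\<forall>n\<ge>N. {x} \<subseteq> C n" using C(5)[of "{x}"] by auto
          then have "\<forall>\<^sub>F n in sequentially. indicator V x *\<^sub>R h x = \<phi> n x *\<^sub>R h x"
            unfolding eventually_sequentially using \<phi>(3) True by (intro exI[of _ N]) auto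
          then show ?thesis by (rule Lim_transform_eventually[OF tendsto_const])
        next
          case False
          then have "\<phi> n x = 0" for n using test_functions_zero_outside[OF \<phi>(1)] by blast
          moreover have "indicator V x *\<^sub>R h x = 0" using False by (auto simp: h_def indicator_def)
          ultimately show ?thesis by (simp only: scaleR_zero_left tendsto_const)
        qed
      qed
      show "AE x in lebesgue. norm (\<phi> n x *\<^sub>R h x) \<le> norm (h x)" for n
        using \<phi>(2) by (auto intro!: mult_left_le_one_le simp: abs_mult)
    qed (use hi mV in auto)
    moreover have "(\<integral>x. \<phi> n x *\<^sub>R h x \<partial>lebesgue) = 0" for n
    proof -
      have t: "\<phi> n \<in> test_functions D" using \<phi>(1) test_functions_mono[of "V \<inter> W" D] W by blast
      have "\<phi> n x *\<^sub>R h x = g x * \<phi> n x" for x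
        using test_functions_zero_outside[OF \<phi>(1), of x n] by (auto simp: h_def indicator_def)
      then have "(\<lambda>x. \<phi> n x *\<^sub>R h x) = (\<lambda>x. g x * \<phi> n x)" by blast
      moreover have "(\<integral>x. g x * \<phi> n x \<partial>lebesgue_on D) = (\<integral>x. g x * \<phi> n x \<partial>lebesgue)"
        by (rule integral_lebesgue_on_support[OF D]) (simp add: test_functions_zero_outside[OF t])
      ultimately have "(\<integral>x. \<phi> n x *\<^sub>R h x \<partial>lebesgue) = (\<integral>x. g x * \<phi> n x \<partial>lebesgue_on D)"
        by simp
      then show ?thesis using zero[OF t] by simp
    qed
    ultimately show ?thesis by (simp add: LIMSEQ_const_iff)
  qed
  have set_int: "set_integrable lebesgue A h" if "A \<in> sets lebesgue" for A
    unfolding set_integrable_def by (rule integrable_mult_indicator[OF that hi])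
  have hB: "set_lebesgue_integral lebesgue B h = 0" if "B \<in> sets borel" for B
  proof -
    have "Int_stable {S :: (real^'n) set. open S}" "{S :: (real^'n) set. open S} \<subseteq> Pow UNIV" "B \<in> sigma_sets UNIV {S. open S}"
      using that by (auto simp: sets_borel Int_stable_def)
    then show ?thesis
    proof (induction rule: sigma_sets_induct_disjoint)
      case (basic A)
      then show ?case using hV by (simp add: set_lebesgue_integral_def)
    next
      case (compl A)
      have A: "A \<in> sets lebesgue" using compl(1) by (metis sets_borel sets_completionI_sets sets_lborel)
      have "indicator (UNIV - A) x *\<^sub>R h x = h x - indicator A x *\<^sub>R h x" for x by (simp add: indicator_def)
      then show ?case using compl(2) hi set_int[OF A] hV[of UNIV]
        by (simp add: set_lebesgue_integral_def set_integrable_def)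
    next
      case (union A)
      have "A i \<in> sets lebesgue" for i using union(2) by (metis range_subsetD sets_borel sets_completionI_sets sets_lborel)
      then have "set_lebesgue_integral lebesgue (\<Union>i. A i) h = (\<Sum>i. set_lebesgue_integral lebesgue (A i) h)"
        using union(1) by (intro lebesgue_integral_countable_add set_int) (auto simp: disjoint_family_on_def)
      then show ?case using union(3) by simp
    qed (auto simp: Int_stable_def set_lebesgue_integral_def)
  qed
  have hA: "set_lebesgue_integral lebesgue A h = 0" if A: "A \<in> sets lebesgue" for A
  proof -
    obtain B N where BN: "B \<in> sets borel" "negligible N" "B \<union> N = A" using sets_lebesgue_almost_borel[OF A] by blast
    have "AE x in lebesgue. x \<notin> N" using BN(2) by (simp add: AE_not_in negligible_iff_null_sets)
    then have "AE x in lebesgue. indicator A x *\<^sub>R h x = indicator B x *\<^sub>R h x"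
      by eventually_elim (use BN(3) in \<open>auto simp: indicator_def\<close>)
    moreover have "B \<in> sets lebesgue" using BN(1) by simp
    ultimately have "set_lebesgue_integral lebesgue A h = set_lebesgue_integral lebesgue B h"
      unfolding set_lebesgue_integral_def using A hi
      by (intro integral_cong_AE) (auto intro!: borel_measurable_scaleR borel_measurable_indicator)
    then show "set_lebesgue_integral lebesgue A h = 0" using hB[OF BN(1)] by simp
  qed
  have hm: "h \<in> borel_measurable lebesgue" using hi by auto
  have "AE x in lebesgue. indicator {x. 0 < h x} x *\<^sub>R h x = 0"
  proof -
    have A: "{x. 0 < h x} \<in> sets lebesgue" using borel_measurable_less[OF borel_measurable_const hm, of 0] by simp
    have "AE x in lebesgue. 0 \<le> indicator {x. 0 < h x} x *\<^sub>R h x" by (auto simp: indicator_def)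
    from integral_nonneg_eq_0_iff_AE[OF set_int[OF A, unfolded set_integrable_def] this] hA[OF A]
    show ?thesis by (simp add: set_lebesgue_integral_def)
  qed
  moreover have "AE x in lebesgue. - (indicator {x. h x < 0} x *\<^sub>R h x) = 0"
  proof -
    have A: "{x. h x < 0} \<in> sets lebesgue" using borel_measurable_less[OF hm borel_measurable_const, of 0] by simp
    have "AE x in lebesgue. 0 \<le> - (indicator {x. h x < 0} x *\<^sub>R h x)" by (auto simp: indicator_def)
    from integral_nonneg_eq_0_iff_AE[OF integrable_minus[OF set_int[OF A, unfolded set_integrable_def]] this] hA[OF A]
    show ?thesis by (simp add: set_lebesgue_integral_def)
  qed
  ultimately have "AE x in lebesgue. h x = 0"
    by eventually_elim (auto simp: indicator_def split: if_splits)
  then show ?thesis by eventually_elim (auto simp: h_def)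
qed

lemma du_Bois_Reymond:
  fixes g :: "real^'n \<Rightarrow> real"
  assumes g: "locally_integrable D g" and D: "open D"
    and zero: "\<And>\<phi>. \<phi> \<in> test_functions D \<Longrightarrow> (\<integral>x. g x * \<phi> x \<partial>lebesgue_on D) = 0"
  shows "AE x in lebesgue_on D. g x = 0"
proof -
  have Ds: "D \<in> sets lebesgue" by (rule open_sets_lebesgue[OF D])
  obtain C where C: "\<And>n. compact (C n)" "\<And>n. C n \<subseteq> D" "\<And>n. C n \<subseteq> interior (C (Suc n))" "\<Union>(range C) = D"
    using open_Union_compact_subsets[OF D] by metis
  have "AE x in lebesgue. x \<in> interior (C n) \<longrightarrow> g x = 0" for n
    by (rule du_Bois_Reymond_aux[OF g Ds zero open_interior interior_subset C(1,2)])
  then have "AE x in lebesgue. \<forall>n. x \<in> interior (C n) \<longrightarrow> g x = 0" unfolding AE_all_countable by blast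
  then have "AE x in lebesgue. x \<in> D \<longrightarrow> g x = 0"
    by eventually_elim (use C(3,4) in blast)
  then show ?thesis using Ds by (simp add: AE_restrict_space_iff)
qed

section \<open>Uniqueness and measurability of weak gradients\<close>

lemma locally_integrable_linear:
  assumes "bounded_linear h" "locally_integrable D u"
  shows "locally_integrable D (\<lambda>x. h (u x))"
  using assms unfolding locally_integrable_def by (blast intro: integrable_bounded_linear)

lemma locally_integrable_diff:
  "locally_integrable D u \<Longrightarrow> locally_integrable D v \<Longrightarrow> locally_integrable D (\<lambda>x. u x - v x)"
  unfolding locally_integrable_def by auto

lemma locally_integrable_continuous:
  assumes "continuous_on UNIV u"
  shows "locally_integrable D u"
  unfolding locally_integrable_def
proof (intro allI impI)
  fix K assume K: "compact K \<and> K \<subseteq> D"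
  then have "integrable lborel (\<lambda>x. indicator K x *\<^sub>R u x)"
    using assms continuous_on_subset by (blast intro: borel_integrable_compact)
  then have "integrable lebesgue (\<lambda>x. indicator K x *\<^sub>R u x)"
    by (subst integrable_completion) auto
  moreover have "K \<in> sets lebesgue" using K by (simp add: borel_compact sets_completionI_sets)
  ultimately show "integrable (lebesgue_on K) u" by (simp add: integrable_restrict_space)
qed

lemma has_weak_grad_diff:
  fixes \<psi> \<psi>' :: "real^'n \<Rightarrow> real^'m"
  assumes "has_weak_grad D \<psi> G" "has_weak_grad D \<psi>' G'" "D \<in> sets lebesgue"
  shows "has_weak_grad D (\<lambda>x. \<psi> x - \<psi>' x) (\<lambda>x. G x - G' x)"
  unfolding has_weak_grad_def
proof (intro conjI ballI allI)
  show "locally_integrable D (\<lambda>x. \<psi> x - \<psi>' x)" "locally_integrable D (\<lambda>x. G x - G' x)"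
    using assms by (auto simp: has_weak_grad_def intro: locally_integrable_diff)
  fix \<phi> :: "real^'n \<Rightarrow> real" and i j assume t: "\<phi> \<in> test_functions D"
  have l: "locally_integrable D (\<lambda>x. \<psi> x $ j)" "locally_integrable D (\<lambda>x. \<psi>' x $ j)"
     "locally_integrable D (\<lambda>x. G x $ j $ i)" "locally_integrable D (\<lambda>x. G' x $ j $ i)"
    using assms(1,2) unfolding has_weak_grad_def
    by (auto intro!: locally_integrable_linear[OF bounded_linear_vec_nth]
        locally_integrable_linear[OF bounded_linear_compose[OF bounded_linear_vec_nth bounded_linear_vec_nth]])
  have "(\<integral>x. (\<psi> x - \<psi>' x) $ j * partial_deriv i \<phi> x \<partial>lebesgue_on D)
      = (\<integral>x. \<psi> x $ j * partial_deriv i \<phi> x \<partial>lebesgue_on D) - (\<integral>x. \<psi>' x $ j * partial_deriv i \<phi> x \<partial>lebesgue_on D)"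
    using locally_integrable_mult_test[OF l(1) test_functions_partial_deriv[OF t] assms(3)]
      locally_integrable_mult_test[OF l(2) test_functions_partial_deriv[OF t] assms(3)]
    by (simp add: left_diff_distrib)
  also have "\<dots> = - (\<integral>x. G x $ j $ i * \<phi> x \<partial>lebesgue_on D) + (\<integral>x. G' x $ j $ i * \<phi> x \<partial>lebesgue_on D)"
    using assms(1,2) t unfolding has_weak_grad_def by simp
  also have "\<dots> = - (\<integral>x. (G x - G' x) $ j $ i * \<phi> x \<partial>lebesgue_on D)"
    using locally_integrable_mult_test[OF l(3) t assms(3)] locally_integrable_mult_test[OF l(4) t assms(3)]
    by (simp add: left_diff_distrib)
  finally show "(\<integral>x. (\<psi> x - \<psi>' x) $ j * partial_deriv i \<phi> x \<partial>lebesgue_on D) = - (\<integral>x. (G x - G' x) $ j $ i * \<phi> x \<partial>lebesgue_on D)" .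
qed

text \<open>The difference of two weak gradients is a weak gradient of 0, so each of its entries is
  annihilated by all test functions. As \<open>weak_grad\<close> is selected by choice, this is its
  only link to a concrete gradient.\<close>

lemma has_weak_grad_unique:
  fixes \<psi> :: "real^'n \<Rightarrow> real^'m"
  assumes "has_weak_grad D \<psi> G" "has_weak_grad D \<psi> G'" "open D"
  shows "AE x in lebesgue_on D. G x = G' x"
proof -
  have d: "has_weak_grad D (\<lambda>x. \<psi> x - \<psi> x) (\<lambda>x. G x - G' x)"
    by (rule has_weak_grad_diff[OF assms(1,2) open_sets_lebesgue[OF assms(3)]])
  have "AE x in lebesgue_on D. (G x - G' x) $ j $ i = 0" for j i
  proof (rule du_Bois_Reymond[OF _ assms(3)])
    show "locally_integrable D (\<lambda>x. (G x - G' x) $ j $ i)"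
      using d locally_integrable_linear[OF bounded_linear_compose[OF bounded_linear_vec_nth[of i] bounded_linear_vec_nth[of j]], of D "\<lambda>x. G x - G' x"]
      unfolding has_weak_grad_def by simp
    fix \<phi> :: "real^'n \<Rightarrow> real" assume "\<phi> \<in> test_functions D"
    then have "(\<integral>x. (\<psi> x - \<psi> x) $ j * partial_deriv i \<phi> x \<partial>lebesgue_on D) =
        - (\<integral>x. (G x - G' x) $ j $ i * \<phi> x \<partial>lebesgue_on D)"
      using d unfolding has_weak_grad_def by blast
    then show "(\<integral>x. (G x - G' x) $ j $ i * \<phi> x \<partial>lebesgue_on D) = 0" by simp
  qed
  then have "AE x in lebesgue_on D. \<forall>j i. (G x - G' x) $ j $ i = 0" by (simp add: AE_all_countable)
  then show ?thesis by eventually_elim (simp add: vec_eq_iff)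
qed

lemma weak_grad_AE:
  assumes "has_weak_grad D \<psi> G" "open D"
  shows "AE x in lebesgue_on D. weak_grad D \<psi> x = G x"
  using has_weak_grad_unique[OF _ assms(1,2)] someI[of "has_weak_grad D \<psi>", OF assms(1)]
  unfolding weak_grad_def by blast

text \<open>Completeness of Lebesgue measure. The chosen weak gradient inherits its measurability on
  \<open>D\<close> in this way from a known one.\<close>

lemma borel_measurable_lebesgue_on_AE:
  fixes f g :: "'a::euclidean_space \<Rightarrow> 'b::euclidean_space"
  assumes "f \<in> borel_measurable (lebesgue_on D)" "AE x in lebesgue_on D. f x = g x" "D \<in> sets lebesgue"
  shows "g \<in> borel_measurable (lebesgue_on D)"
proof -
  have f: "(\<lambda>x. if x \<in> D then f x else 0) \<in> borel_measurable lebesgue"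
    using assms(1,3) by (simp add: borel_measurable_if)
  have "AE x in lebesgue. x \<in> D \<longrightarrow> f x = g x" using assms(2,3) by (simp add: AE_restrict_space_iff)
  then have "AE x in lebesgue. (if x \<in> D then f x else 0) = (if x \<in> D then g x else 0)"
    by eventually_elim auto
  from borel_measurable_AE[OF f this] show ?thesis using assms(3) by (simp add: borel_measurable_if)
qed

lemma weak_grad_measurable:
  assumes "has_weak_grad D \<psi> G" "open D" "G \<in> borel_measurable (lebesgue_on D)"
  shows "weak_grad D \<psi> \<in> borel_measurable (lebesgue_on D)"
  using borel_measurable_lebesgue_on_AE[OF assms(3) _ open_sets_lebesgue[OF assms(2)]] weak_grad_AE[OF assms(1,2)]
  by (simp add: eq_commute)

lemma Lp_norm_weak_grad:
  assumes "has_weak_grad D \<psi> G" "open D" "G \<in> borel_measurable (lebesgue_on D)"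
  shows "Lp_norm q D (weak_grad D \<psi>) = Lp_norm q D G"
  by (rule Lp_norm_cong_AE[OF weak_grad_measurable[OF assms] assms(3) weak_grad_AE[OF assms(1,2)]])

lemma Lp_AE:
  assumes "u \<in> Lp p D" "AE x in lebesgue_on D. u x = v x" "D \<in> sets lebesgue"
  shows "v \<in> Lp p D"
proof -
  have m: "v \<in> borel_measurable (lebesgue_on D)"
    by (rule borel_measurable_lebesgue_on_AE[OF Lp_measurable[OF assms(1)] assms(2,3)])
  have "integrable (lebesgue_on D) (\<lambda>x. norm (v x) powr p)"
    by (rule Bochner_Integration.integrable_cong_AE_imp[OF Lp_integrable[OF assms(1)]])
      (use m assms(2) in \<open>auto elim: eventually_mono\<close>)
  then show ?thesis using m by (simp add: Lp_def)
qed

section \<open>Classical gradients and dual norms on test functions\<close>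

definition grad :: "(real^'n \<Rightarrow> real^'m) \<Rightarrow> real^'n \<Rightarrow> real^'n^'m" where
  "grad \<psi> x = (\<chi> j i. partial_deriv i \<psi> x $ j)"

lemma column_grad: "column i (grad \<psi> x) = partial_deriv i \<psi> x"
  by (simp add: grad_def column_def vec_eq_iff)

lemma partial_deriv_const: "partial_deriv i (\<lambda>x. c) x = 0"
  by (rule partial_deriv_eq[OF has_derivative_const])

lemma grad_zero: "grad (\<lambda>x. 0) = (\<lambda>x. 0)"
  by (rule ext) (simp add: grad_def vec_eq_iff partial_deriv_const)

lemma grad_continuous: "\<psi> \<in> C_infinity \<Longrightarrow> continuous_on UNIV (grad \<psi>)"
  unfolding grad_def[abs_def]
  by (intro continuous_on_vec_lambda continuous_intros C_infinity_continuous C_infinity_partial_deriv)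

lemma has_weak_grad_grad:
  fixes \<psi> :: "real^'n \<Rightarrow> real^'m"
  assumes "\<psi> \<in> C_infinity" "D \<in> sets lebesgue"
  shows "has_weak_grad D \<psi> (grad \<psi>)"
  unfolding has_weak_grad_def
proof (intro conjI ballI allI)
  show "locally_integrable D \<psi>" "locally_integrable D (grad \<psi>)"
    by (intro locally_integrable_continuous C_infinity_continuous grad_continuous assms)+
  fix \<phi> :: "real^'n \<Rightarrow> real" and i j assume t: "\<phi> \<in> test_functions D"
  have c: "(\<lambda>x. \<psi> x $ j) \<in> C_infinity" using assms(1) by (rule C_infinity_linear[OF bounded_linear_vec_nth])
  have "partial_deriv i (\<lambda>x. \<psi> x $ j) x = partial_deriv i \<psi> x $ j" for x
    by (rule partial_deriv_linear[OF bounded_linear_vec_nth C_infinity_differentiable[OF assms(1)]])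
  then show "(\<integral>x. \<psi> x $ j * partial_deriv i \<phi> x \<partial>lebesgue_on D) = - (\<integral>x. grad \<psi> x $ j $ i * \<phi> x \<partial>lebesgue_on D)"
    using integral_by_parts_test_function[OF c t assms(2), of i] by (simp add: grad_def)
qed

lemma norm_column_le: "norm (column i (G :: real^'n^'m)) \<le> norm G"
  unfolding norm_vec_def[of G] norm_vec_def[of "column i G"]
proof (rule L2_set_mono)
  show "norm (column i G $ j) \<le> norm (G $ j)" for j
    using component_le_norm_cart[of "G $ j" i] by (simp add: column_def)
qed auto

lemma norm_partial_deriv_le: "norm (partial_deriv i \<psi> x) \<le> norm (grad \<psi> x)"
  using norm_column_le[of i "grad \<psi> x"] by (simp add: column_grad)

lemma norm_matrix_le_sum: "norm (G :: real^'n^'m) \<le> (\<Sum>i\<in>UNIV. norm (column i G))"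
proof -
  have "G = (\<Sum>i\<in>UNIV. (\<chi> j k. if k = i then G $ j $ i else 0))"
    by (simp add: vec_eq_iff)
  then have "norm G \<le> (\<Sum>i\<in>UNIV. norm ((\<chi> j k. if k = i then G $ j $ i else 0) :: real^'n^'m))"
    using norm_sum[of "\<lambda>i. (\<chi> j k. if k = i then G $ j $ i else 0)" UNIV] by simp
  moreover have "norm ((\<chi> j k. if k = i then G $ j $ i else 0) :: real^'n^'m) = norm (column i G)" for i
  proof -
    have "(\<chi> k. if k = i then G $ j $ i else 0) = axis i (G $ j $ i)" for j
      by (simp add: axis_def vec_eq_iff)
    moreover have "norm (axis i c) = \<bar>c\<bar>" for c :: real
      by (simp add: norm_eq_sqrt_inner inner_axis_axis power2_eq_square[symmetric])
    ultimately show ?thesis by (simp add: norm_vec_def[of "column i G"] norm_vec_def[of "\<chi> j. _ j"] column_def)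
  qed
  ultimately show ?thesis by simp
qed

lemma grad_test_functions_zero: "\<phi> \<in> test_functions D \<Longrightarrow> x \<notin> D \<Longrightarrow> grad \<phi> x = 0"
  using test_functions_zero_outside[OF test_functions_partial_deriv[of \<phi> D]] by (simp add: grad_def vec_eq_iff)

lemma grad_Lp:
  assumes "0 < q" "\<phi> \<in> test_functions D'" "D \<in> lmeasurable"
  shows "grad \<phi> \<in> Lp q D"
proof -
  obtain K where K: "compact K" "K \<subseteq> D'" "\<And>x. x \<notin> K \<Longrightarrow> \<phi> x = 0"
    using test_functionsE[OF assms(2)] by blast
  have "partial_deriv i \<phi> x = 0" if "x \<notin> K" for i x
    by (rule partial_deriv_outside_support[OF compact_imp_closed[OF K(1)] K(3) that])
  then have K': "grad \<phi> x = 0" if "x \<notin> K" for x using that by (simp add: grad_def vec_eq_iff)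
  have c: "continuous_on UNIV (grad \<phi>)" by (rule grad_continuous[OF test_functions_C_infinity[OF assms(2)]])
  obtain B where "0 \<le> B" "\<And>x. norm (grad \<phi> x) \<le> B"
    using continuous_compact_support_bounded[OF c K(1) K'] by blast
  then show ?thesis
    using assms(3) by (intro Lp_bounded[OF assms(1,3), of _ B] borel_measurable_integrable
        integrable_compact_support[OF c K(1) K']) auto
qed

lemma weak_grad_test:
  assumes "\<phi> \<in> test_functions D" "D \<in> bounded_opens"
  shows "AE x in lebesgue_on D. weak_grad D \<phi> x = grad \<phi> x" "Lp_norm q D (weak_grad D \<phi>) = Lp_norm q D (grad \<phi>)"
    "weak_grad D \<phi> \<in> borel_measurable (lebesgue_on D)"
proof -
  have o: "open D" using assms(2) by (simp add: bounded_opens_def)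
  have w: "has_weak_grad D \<phi> (grad \<phi>)"
    by (rule has_weak_grad_grad[OF test_functions_C_infinity[OF assms(1)] bounded_opens_sets[OF assms(2)]])
  have m: "grad \<phi> \<in> borel_measurable (lebesgue_on D)"
    using Lp_measurable[OF grad_Lp[OF zero_less_one assms(1) bounded_opens_lmeasurable[OF assms(2)]]] .
  show "AE x in lebesgue_on D. weak_grad D \<phi> x = grad \<phi> x" by (rule weak_grad_AE[OF w o])
  show "Lp_norm q D (weak_grad D \<phi>) = Lp_norm q D (grad \<phi>)" by (rule Lp_norm_weak_grad[OF w o m])
  show "weak_grad D \<phi> \<in> borel_measurable (lebesgue_on D)" by (rule weak_grad_measurable[OF w o m])
qed

lemma test_functions_W10:
  assumes "0 < q" "\<phi> \<in> test_functions D" "D \<in> bounded_opens"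
  shows "\<phi> \<in> W10 q D"
proof -
  have l: "D \<in> lmeasurable" by (rule bounded_opens_lmeasurable[OF assms(3)])
  have "\<phi> \<in> W1 q D"
    unfolding W1_def using test_functions_Lp[OF assms(1,2) l] grad_Lp[OF assms(1,2) l]
      has_weak_grad_grad[OF test_functions_C_infinity[OF assms(2)] bounded_opens_sets[OF assms(3)]] by blast
  moreover have "W1_norm q D (\<lambda>x. \<phi> x - \<phi> x) = 0"
  proof -
    show ?thesis
      using weak_grad_test(2)[OF test_functions_zero assms(3), of q]
      by (simp add: W1_norm_def Lp_norm_zero grad_zero)
  qed
  ultimately show ?thesis unfolding W10_def using assms(2) by (auto intro!: exI[of _ "\<lambda>_. \<phi>"])
qed

text \<open>The norm in the definition of \<open>W10\<close> involves \<open>weak_grad\<close> of a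
  difference, which is a separate choice for each \<open>k\<close>. By uniqueness it equals
  \<open>grad (\<phi> k) - weak_grad D \<psi>\<close> almost everywhere, which yields a convergence
  statement about fixed functions.\<close>

lemma W10_approx:
  fixes \<psi> :: "real^'n \<Rightarrow> real^'m"
  assumes "1 < q" "\<psi> \<in> W10 q D" "D \<in> bounded_opens"
  obtains \<phi> where "\<And>k::nat. \<phi> k \<in> test_functions D" "(\<lambda>k. Lp_norm q D (\<lambda>x. \<phi> k x - \<psi> x)) \<longlonglongrightarrow> 0"
    "(\<lambda>k. Lp_norm q D (\<lambda>x. grad (\<phi> k) x - weak_grad D \<psi> x)) \<longlonglongrightarrow> 0"
    "\<psi> \<in> Lp q D" "weak_grad D \<psi> \<in> Lp q D"
proof -
  have o: "open D" using assms(3) by (simp add: bounded_opens_def)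
  have Ds: "D \<in> sets lebesgue" by (rule open_sets_lebesgue[OF o])
  have l: "D \<in> lmeasurable" by (rule bounded_opens_lmeasurable[OF assms(3)])
  obtain G where G: "G \<in> Lp q D" "has_weak_grad D \<psi> G" and \<psi>: "\<psi> \<in> Lp q D"
    using assms(2) unfolding W10_def W1_def by blast
  obtain \<phi> where \<phi>: "\<And>k::nat. \<phi> k \<in> test_functions D" "(\<lambda>k. W1_norm q D (\<lambda>x. \<phi> k x - \<psi> x)) \<longlonglongrightarrow> 0"
    using assms(2) unfolding W10_def by blast
  have wL: "weak_grad D \<psi> \<in> Lp q D"
    using Lp_AE[OF G(1) _ Ds] weak_grad_AE[OF G(2) o] by (simp add: eq_commute)
  have w: "has_weak_grad D \<psi> (weak_grad D \<psi>)" unfolding weak_grad_def using someI[of "has_weak_grad D \<psi>", OF G(2)] .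
  have eq: "Lp_norm q D (weak_grad D (\<lambda>x. \<phi> k x - \<psi> x)) = Lp_norm q D (\<lambda>x. grad (\<phi> k) x - weak_grad D \<psi> x)" for k
  proof (rule Lp_norm_weak_grad[OF _ o])
    show "has_weak_grad D (\<lambda>x. \<phi> k x - \<psi> x) (\<lambda>x. grad (\<phi> k) x - weak_grad D \<psi> x)"
      by (rule has_weak_grad_diff[OF has_weak_grad_grad[OF test_functions_C_infinity[OF \<phi>(1)] Ds] w Ds])
    show "(\<lambda>x. grad (\<phi> k) x - weak_grad D \<psi> x) \<in> borel_measurable (lebesgue_on D)"
      using assms(1) by (intro Lp_measurable[OF Lp_diff[OF _ grad_Lp[OF _ \<phi>(1) l] wL]]) auto
  qed
  have s: "(\<lambda>k. Lp_norm q D (\<lambda>x. \<phi> k x - \<psi> x) + Lp_norm q D (\<lambda>x. grad (\<phi> k) x - weak_grad D \<psi> x)) \<longlonglongrightarrow> 0"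
    using \<phi>(2) by (simp add: W1_norm_def eq)
  show ?thesis
  proof (rule that[OF \<phi>(1) _ _ \<psi> wL])
    show "(\<lambda>k. Lp_norm q D (\<lambda>x. \<phi> k x - \<psi> x)) \<longlonglongrightarrow> 0"
      by (rule tendsto_sandwich[OF _ _ tendsto_const s]) (auto simp: Lp_norm_nonneg)
    show "(\<lambda>k. Lp_norm q D (\<lambda>x. grad (\<phi> k) x - weak_grad D \<psi> x)) \<longlonglongrightarrow> 0"
      by (rule tendsto_sandwich[OF _ _ tendsto_const s]) (auto simp: Lp_norm_nonneg)
  qed
qed

text \<open>Test functions are dense in \<open>W10\<close>, so they determine the dual norm.
  \<open>T\<close> is an arbitrary total function on functions, of which only estimates on
  admissible arguments and homogeneity on test functions are assumed; this suits both
  \<open>of_Lp D u\<close> and \<open>A_op A D u\<close>.\<close>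

lemma dual_norm_test_functions:
  fixes T :: "(real^'n \<Rightarrow> real^'m) \<Rightarrow> real"
  assumes q: "1 < q" and D: "D \<in> bounded_opens" and B: "0 \<le> B" and C0: "0 \<le> C0"
    and cont': "\<forall>\<phi>\<in>test_functions D. \<forall>\<psi>\<in>Lp q D. weak_grad D \<psi> \<in> Lp q D \<longrightarrow>
       \<bar>T \<phi> - T \<psi>\<bar> \<le> B * (Lp_norm q D (\<lambda>x. \<phi> x - \<psi> x) + Lp_norm q D (\<lambda>x. grad \<phi> x - weak_grad D \<psi> x))"
    and bd': "\<forall>\<phi>\<in>test_functions D. \<bar>T \<phi>\<bar> \<le> C0 * Lp_norm q D (grad \<phi>)"
    and hom': "\<forall>\<phi>\<in>test_functions D. \<forall>c. T (\<lambda>x. c *\<^sub>R \<phi> x) = c * T \<phi>"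
  shows "\<And>\<phi>. \<phi> \<in> test_functions D \<Longrightarrow> \<bar>T \<phi>\<bar> \<le> dual_norm q D T * Lp_norm q D (grad \<phi>)"
    "\<And>C. 0 \<le> C \<Longrightarrow> (\<And>\<phi>. \<phi> \<in> test_functions D \<Longrightarrow> \<bar>T \<phi>\<bar> \<le> C * Lp_norm q D (grad \<phi>)) \<Longrightarrow> dual_norm q D T \<le> C"
    "0 \<le> dual_norm q D T"
proof -
  note cont = cont'[rule_format] and bd0 = bd'[rule_format] and hom = hom'[rule_format]
  have q0: "0 < q" using q by simp
  have l: "D \<in> lmeasurable" by (rule bounded_opens_lmeasurable[OF D])
  let ?S = "{\<psi> \<in> (W10 q D :: (real^'n \<Rightarrow> real^'m) set). Lp_norm q D (weak_grad D \<psi>) \<le> 1}"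
  have up: "\<bar>T \<psi>\<bar> \<le> C" if C: "0 \<le> C" "\<And>\<phi>. \<phi> \<in> test_functions D \<Longrightarrow> \<bar>T \<phi>\<bar> \<le> C * Lp_norm q D (grad \<phi>)" and \<psi>: "\<psi> \<in> ?S" for C \<psi>
  proof -
    obtain \<phi> where \<phi>: "\<And>k::nat. \<phi> k \<in> test_functions D" "(\<lambda>k. Lp_norm q D (\<lambda>x. \<phi> k x - \<psi> x)) \<longlonglongrightarrow> 0"
      "(\<lambda>k. Lp_norm q D (\<lambda>x. grad (\<phi> k) x - weak_grad D \<psi> x)) \<longlonglongrightarrow> 0"
      "\<psi> \<in> Lp q D" "weak_grad D \<psi> \<in> Lp q D"
      using W10_approx[OF q _ D, of \<psi>] \<psi> by blast
    let ?a = "\<lambda>k. Lp_norm q D (\<lambda>x. \<phi> k x - \<psi> x)" and ?b = "\<lambda>k. Lp_norm q D (\<lambda>x. grad (\<phi> k) x - weak_grad D \<psi> x)"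
    \<comment> \<open>The gradient norm of \<open>\<phi> k\<close> may exceed 1, but by at most
      \<open>?b k\<close>; the excess disappears in the limit.\<close>
    have "\<bar>T \<psi>\<bar> \<le> C * (?b k + 1) + B * (?a k + ?b k)" for k
    proof -
      have "Lp_norm q D (grad (\<phi> k)) \<le> ?b k + Lp_norm q D (weak_grad D \<psi>)"
        using Lp_norm_triangle[OF q Lp_diff[OF q0 grad_Lp[OF q0 \<phi>(1) l] \<phi>(5)] \<phi>(5), of k] by simp
      then have "Lp_norm q D (grad (\<phi> k)) \<le> ?b k + 1" using \<psi> by simp
      then have "\<bar>T (\<phi> k)\<bar> \<le> C * (?b k + 1)"
        using C(2)[OF \<phi>(1)[of k]] mult_left_mono[OF _ C(1)] by fastforce
      then show ?thesis using cont[OF \<phi>(1)[of k] \<phi>(4,5)] by linarith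
    qed
    moreover have "(\<lambda>k. C * (?b k + 1) + B * (?a k + ?b k)) \<longlonglongrightarrow> C * (0 + 1) + B * (0 + 0)"
      by (intro tendsto_intros \<phi>(2,3))
    ultimately have "\<bar>T \<psi>\<bar> \<le> C * (0 + 1) + B * (0 + 0)" by (intro LIMSEQ_le_const) auto
    then show ?thesis by simp
  qed
  have partial0: "Lp_norm q D (weak_grad D (\<lambda>x. 0 :: real^'m)) \<le> 1"
  proof -
    have "Lp_norm q D (weak_grad D (\<lambda>x. 0 :: real^'m)) = Lp_norm q D (grad (\<lambda>x. 0 :: real^'m))"
      by (rule weak_grad_test(2)[OF test_functions_zero D])
    then show ?thesis by (simp add: Lp_norm_zero grad_zero)
  qed
  have "(\<lambda>x. 0 :: real^'m) \<in> W10 q D" by (rule test_functions_W10[OF q0 test_functions_zero D])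
  then have ne: "(\<lambda>x. 0) \<in> ?S" using partial0 by simp
  \<comment> \<open>The dual norm is a supremum of reals, so boundedness has to be known before
    anything can be inferred from it; this is the role of the crude bound \<open>C0\<close>.\<close>
  have bdd: "bdd_above ((\<lambda>\<psi>. \<bar>T \<psi>\<bar>) ` ?S)" using up[OF C0 bd0] by (intro bdd_aboveI[of _ C0]) auto
  show nn: "0 \<le> dual_norm q D T"
    unfolding dual_norm_def by (rule cSUP_upper2[OF bdd ne]) simp
  show "dual_norm q D T \<le> C" if "0 \<le> C" "\<And>\<phi>. \<phi> \<in> test_functions D \<Longrightarrow> \<bar>T \<phi>\<bar> \<le> C * Lp_norm q D (grad \<phi>)" for C
    unfolding dual_norm_def by (rule cSUP_least) (use ne up[OF that] in blast)+
  show "\<bar>T \<phi>\<bar> \<le> dual_norm q D T * Lp_norm q D (grad \<phi>)" if t: "\<phi> \<in> test_functions D" for \<phi>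
  proof (cases "Lp_norm q D (grad \<phi>) = 0")
    case True
    then show ?thesis using bd0[OF t] by simp
  next
    case False
    define s where "s = Lp_norm q D (grad \<phi>)"
    have s: "0 < s" using False Lp_norm_nonneg[of q D "grad \<phi>"] by (simp add: s_def)
    let ?\<psi> = "\<lambda>x. inverse s *\<^sub>R \<phi> x"
    have t': "?\<psi> \<in> test_functions D" by (rule test_functions_linear[OF t bounded_linear_scaleR_right])
    have "partial_deriv i ?\<psi> x = inverse s *\<^sub>R partial_deriv i \<phi> x" for i x
      by (rule partial_deriv_linear[OF bounded_linear_scaleR_right C_infinity_differentiable[OF test_functions_C_infinity[OF t]]])
    then have "grad ?\<psi> = (\<lambda>x. inverse s *\<^sub>R grad \<phi> x)" by (intro ext) (simp add: grad_def vec_eq_iff)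
    then have "Lp_norm q D (weak_grad D ?\<psi>) = 1"
      using weak_grad_test(2)[OF t' D, of q] s by (simp add: Lp_norm_scaleR[OF q0] s_def[symmetric])
    then have "?\<psi> \<in> ?S" using test_functions_W10[OF q0 t' D] by simp
    then have "\<bar>T ?\<psi>\<bar> \<le> dual_norm q D T" unfolding dual_norm_def by (rule cSUP_upper[OF _ bdd])
    moreover have "T \<phi> = s * T ?\<psi>" using hom[OF t, of "inverse s"] s by simp
    ultimately have "\<bar>T \<phi>\<bar> \<le> s * dual_norm q D T" using s by (simp add: abs_mult)
    then show ?thesis by (simp add: s_def mult.commute)
  qed
qed

section \<open>Estimates for the norm \<open>\<parallel>\<cdot>\<parallel>\<^sup>\<A>\<close>\<close>

lemma Lp_norm_support:
  assumes "D \<in> sets lebesgue" "\<And>x. x \<notin> D \<Longrightarrow> f x = 0"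
  shows "Lp_norm q D f = Lp_norm q UNIV f"
proof -
  have "(\<integral>x. norm (f x) powr q \<partial>lebesgue_on D) = (\<integral>x. norm (f x) powr q \<partial>lebesgue)"
    by (rule integral_lebesgue_on_support[OF assms(1)]) (simp add: assms(2))
  then show ?thesis by (simp add: Lp_norm_def lebesgue_on_UNIV_eq)
qed

lemma Poincare:
  fixes D :: "(real^'n) set"
  assumes q: "1 < q" and D: "D \<in> bounded_opens"
  obtains C where "0 \<le> C"
    "\<And>\<phi> :: real^'n \<Rightarrow> real^'m. \<phi> \<in> test_functions D \<Longrightarrow> Lp_norm q D \<phi> \<le> C * Lp_norm q D (grad \<phi>)"
proof -
  have q0: "0 < q" using q by simp
  have l: "D \<in> lmeasurable" by (rule bounded_opens_lmeasurable[OF D])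
  have s: "D \<in> sets lebesgue" by (rule bounded_opens_sets[OF D])
  obtain R where R: "0 < R" "\<And>x. x \<in> D \<Longrightarrow> norm x \<le> R"
    using D bounded_pos unfolding bounded_opens_def by blast
  show ?thesis
  proof
    show "0 \<le> 2 * q * R" using q R by simp
    fix \<phi> :: "real^'n \<Rightarrow> real^'m" assume t: "\<phi> \<in> test_functions D"
    \<comment> \<open>\<open>undefined\<close> stands for some coordinate direction: a bound by a
      single partial derivative suffices, whichever it is.\<close>
    note t' = test_functions_partial_deriv[OF t, of undefined]
    have "Lp_norm q D \<phi> \<le> 2 * q * R * Lp_norm q D (partial_deriv undefined \<phi>)"
    proof (subst Lp_norm_le_iff[OF q0])
      have "(\<integral>x. norm (\<phi> x) powr q \<partial>lebesgue_on D) = (\<integral>x. norm (\<phi> x) powr q \<partial>lebesgue)"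
        by (rule integral_lebesgue_on_support[OF s]) (simp add: test_functions_zero_outside[OF t])
      also have "\<dots> \<le> (2 * q * R) powr q * (\<integral>x. norm (partial_deriv undefined \<phi> x) powr q \<partial>lebesgue)"
        by (rule Poincare_partial_deriv[OF q R t])
      also have "(\<integral>x. norm (partial_deriv undefined \<phi> x) powr q \<partial>lebesgue) = (\<integral>x. norm (partial_deriv undefined \<phi> x) powr q \<partial>lebesgue_on D)"
        by (rule integral_lebesgue_on_support[OF s, symmetric]) (simp add: test_functions_zero_outside[OF t'])
      finally show "(\<integral>x. norm (\<phi> x) powr q \<partial>lebesgue_on D) \<le> (2 * q * R * Lp_norm q D (partial_deriv undefined \<phi>)) powr q"
        using q R by (simp add: powr_mult Lp_norm_powr Lp_norm_nonneg)
    qed (use q R in \<open>auto intro!: mult_nonneg_nonneg Lp_norm_nonneg\<close>)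
    also have "\<dots> \<le> 2 * q * R * (1 * Lp_norm q D (grad \<phi>))"
      using q R norm_partial_deriv_le[of undefined \<phi>]
      by (intro mult_left_mono Lp_bound(2)[OF q0 grad_Lp[OF q0 t l] Lp_measurable[OF test_functions_Lp[OF q0 t' l]]]) auto
    finally show "Lp_norm q D \<phi> \<le> 2 * q * R * Lp_norm q D (grad \<phi>)" by simp
  qed
qed

lemma partial_deriv_scaleR:
  assumes "f differentiable at x" "g differentiable at x"
  shows "partial_deriv i (\<lambda>x. f x *\<^sub>R g x) x = f x *\<^sub>R partial_deriv i g x + partial_deriv i f x *\<^sub>R g x"
  by (rule partial_deriv_bilinear[OF bounded_bilinear_scaleR assms])

locale dual_exponents =
  fixes p q :: real
  assumes p: "1 < p" and q: "1 < q" and pq: "1 / p + 1 / q = 1"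
begin

lemma p0: "0 < p" and q0: "0 < q" using p q by auto

lemma Poincare_Holder:
  fixes D :: "(real^'n) set"
  assumes D: "D \<in> bounded_opens"
  obtains C where "0 \<le> C" "\<And>(u :: real^'n \<Rightarrow> real^'m) \<phi>. u \<in> Lp p D \<Longrightarrow> \<phi> \<in> test_functions D \<Longrightarrow>
    \<bar>\<integral>x. u x \<bullet> \<phi> x \<partial>lebesgue_on D\<bar> \<le> C * Lp_norm p D u * Lp_norm q D (grad \<phi>)"
proof -
  obtain C where C: "0 \<le> C" "\<And>\<phi> :: real^'n \<Rightarrow> real^'m. \<phi> \<in> test_functions D \<Longrightarrow> Lp_norm q D \<phi> \<le> C * Lp_norm q D (grad \<phi>)"
    using Poincare[OF q D] by blast
  have "\<bar>\<integral>x. u x \<bullet> \<phi> x \<partial>lebesgue_on D\<bar> \<le> C * Lp_norm p D u * Lp_norm q D (grad \<phi>)"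
    if "u \<in> Lp p D" "\<phi> \<in> test_functions D" for u \<phi> :: "real^'n \<Rightarrow> real^'m"
  proof -
    have "\<bar>\<integral>x. u x \<bullet> \<phi> x \<partial>lebesgue_on D\<bar> \<le> Lp_norm p D u * Lp_norm q D \<phi>"
      by (rule Holder(2)[OF p q pq that(1) test_functions_Lp[OF q0 that(2) bounded_opens_lmeasurable[OF D]]])
    also have "\<dots> \<le> Lp_norm p D u * (C * Lp_norm q D (grad \<phi>))"
      using C(2)[OF that(2)] by (intro mult_left_mono) (auto simp: Lp_norm_nonneg)
    finally show ?thesis by (simp add: ac_simps)
  qed
  then show ?thesis using that C(1) by blast
qed

text \<open>These rules, with their analogues for \<open>A_op\<close>, are how later estimates use
  the dual norm: a bound on each pairing, a criterion for upper bounds that looks at test functions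
  only, and nonnegativity.\<close>

lemma of_Lp_dual:
  fixes u :: "real^'n \<Rightarrow> real^'m"
  assumes D: "D \<in> bounded_opens" and u: "u \<in> Lp p D"
  shows "\<And>\<phi>. \<phi> \<in> test_functions D \<Longrightarrow>
      \<bar>\<integral>x. u x \<bullet> \<phi> x \<partial>lebesgue_on D\<bar> \<le> dual_norm q D (of_Lp D u) * Lp_norm q D (grad \<phi>)"
    "\<And>C. 0 \<le> C \<Longrightarrow> (\<And>\<phi>. \<phi> \<in> test_functions D \<Longrightarrow> \<bar>\<integral>x. u x \<bullet> \<phi> x \<partial>lebesgue_on D\<bar> \<le> C * Lp_norm q D (grad \<phi>))
      \<Longrightarrow> dual_norm q D (of_Lp D u) \<le> C"
    "0 \<le> dual_norm q D (of_Lp D u)"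
proof -
  note l = bounded_opens_lmeasurable[OF D]
  obtain C where C: "0 \<le> C" "\<And>(u :: real^'n \<Rightarrow> real^'m) \<phi>. u \<in> Lp p D \<Longrightarrow> \<phi> \<in> test_functions D \<Longrightarrow>
    \<bar>\<integral>x. u x \<bullet> \<phi> x \<partial>lebesgue_on D\<bar> \<le> C * Lp_norm p D u * Lp_norm q D (grad \<phi>)"
    by (rule Poincare_Holder[OF D]) (rule that)
  have cont0: "\<bar>of_Lp D u \<phi> - of_Lp D u \<psi>\<bar> \<le> Lp_norm p D u * (Lp_norm q D (\<lambda>x. \<phi> x - \<psi> x) + Lp_norm q D (\<lambda>x. grad \<phi> x - weak_grad D \<psi> x))"
    if "\<phi> \<in> test_functions D" "\<psi> \<in> Lp q D" for \<phi> \<psi>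
  proof -
    have t: "\<phi> \<in> Lp q D" by (rule test_functions_Lp[OF q0 that(1) l])
    have "of_Lp D u \<phi> - of_Lp D u \<psi> = (\<integral>x. u x \<bullet> (\<phi> x - \<psi> x) \<partial>lebesgue_on D)"
      using Holder(1)[OF p q pq u t] Holder(1)[OF p q pq u that(2)] by (simp add: of_Lp_def inner_diff_right)
    also have "\<bar>\<dots>\<bar> \<le> Lp_norm p D u * Lp_norm q D (\<lambda>x. \<phi> x - \<psi> x)"
      by (rule Holder(2)[OF p q pq u Lp_diff[OF q0 t that(2)]])
    finally show ?thesis using Lp_norm_nonneg[of p D u] Lp_norm_nonneg[of q D "\<lambda>x. grad \<phi> x - weak_grad D \<psi> x"]
      by (simp add: distrib_left add_increasing2)
  qed
  have bd0: "\<bar>of_Lp D u \<phi>\<bar> \<le> C * Lp_norm p D u * Lp_norm q D (grad \<phi>)" if "\<phi> \<in> test_functions D" for \<phi>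
    using C(2)[OF u that] by (simp add: of_Lp_def)
  have hom0: "of_Lp D u (\<lambda>x. c *\<^sub>R \<phi> x) = c * of_Lp D u \<phi>" for \<phi> c by (simp add: of_Lp_def)
  have C0: "0 \<le> C * Lp_norm p D u" using C(1) by (simp add: Lp_norm_nonneg)
  have cont: "\<forall>\<phi>\<in>test_functions D. \<forall>\<psi>\<in>Lp q D. weak_grad D \<psi> \<in> Lp q D \<longrightarrow>
       \<bar>of_Lp D u \<phi> - of_Lp D u \<psi>\<bar> \<le> Lp_norm p D u * (Lp_norm q D (\<lambda>x. \<phi> x - \<psi> x) + Lp_norm q D (\<lambda>x. grad \<phi> x - weak_grad D \<psi> x))"
    using cont0 by simp
  have bd: "\<forall>\<phi>\<in>test_functions D. \<bar>of_Lp D u \<phi>\<bar> \<le> C * Lp_norm p D u * Lp_norm q D (grad \<phi>)"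
    using bd0 by simp
  have hom: "\<forall>\<phi>\<in>test_functions D. \<forall>c. of_Lp D u (\<lambda>x. c *\<^sub>R \<phi> x) = c * of_Lp D u \<phi>"
    using hom0 by simp
  note R = dual_norm_test_functions[OF q D Lp_norm_nonneg[of p D u] C0 cont bd hom]
  show "\<bar>\<integral>x. u x \<bullet> \<phi> x \<partial>lebesgue_on D\<bar> \<le> dual_norm q D (of_Lp D u) * Lp_norm q D (grad \<phi>)"
    if "\<phi> \<in> test_functions D" for \<phi> using R(1)[OF that] by (simp add: of_Lp_def[of D u \<phi>])
  show "dual_norm q D (of_Lp D u) \<le> C"
    if "0 \<le> C" "\<And>\<phi>. \<phi> \<in> test_functions D \<Longrightarrow> \<bar>\<integral>x. u x \<bullet> \<phi> x \<partial>lebesgue_on D\<bar> \<le> C * Lp_norm q D (grad \<phi>)" for C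
    by (rule R(2)) (use that in \<open>auto simp: of_Lp_def\<close>)
  show "0 \<le> dual_norm q D (of_Lp D u)" by (rule R(3))
qed

text \<open>The negative of \<open>A_op\<close> on test functions, with classical derivatives in
  place of the chosen weak gradient. The change of sign is harmless since the estimates are for
  absolute values.\<close>

definition A_test :: "('n::finite \<Rightarrow> real^'d^'l) \<Rightarrow> (real^'n) set \<Rightarrow> (real^'n \<Rightarrow> real^'d) \<Rightarrow> (real^'n \<Rightarrow> real^'l) \<Rightarrow> real" where
  "A_test A D u \<phi> = (\<Sum>i\<in>UNIV. \<integral>x. (A i *v u x) \<bullet> partial_deriv i \<phi> x \<partial>lebesgue_on D)"

lemma matrix_vector_Lp: "u \<in> Lp p D \<Longrightarrow> (\<lambda>x. (B :: real^'d^'l) *v u x) \<in> Lp p D"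
  "u \<in> Lp p D \<Longrightarrow> Lp_norm p D (\<lambda>x. B *v u x) \<le> onorm ((*v) B) * Lp_norm p D u"
  using Lp_linear[OF p0 _ matrix_vector_mul_bounded_linear] by blast+

lemma column_Lp:
  fixes G :: "real^'n \<Rightarrow> real^'n^'m"
  assumes "G \<in> Lp q D"
  shows "(\<lambda>x. column i (G x)) \<in> Lp q D" "Lp_norm q D (\<lambda>x. column i (G x)) \<le> Lp_norm q D G"
proof -
  have "linear (column i :: real^'n^'m \<Rightarrow> real^'m)"
    by (auto intro!: linearI simp: column_def vec_eq_iff)
  then have bl: "bounded_linear (column i :: real^'n^'m \<Rightarrow> real^'m)" by (simp add: linear_conv_bounded_linear)
  show L: "(\<lambda>x. column i (G x)) \<in> Lp q D" by (rule Lp_linear(1)[OF q0 assms bl])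
  show "Lp_norm q D (\<lambda>x. column i (G x)) \<le> Lp_norm q D G"
    using Lp_bound(2)[OF q0 assms Lp_measurable[OF L], of 1] norm_column_le by auto
qed

lemma A_test_bound:
  fixes u :: "real^'n \<Rightarrow> real^'d" and A :: "'n::finite \<Rightarrow> real^'d^'l"
  assumes "D \<in> bounded_opens" "u \<in> Lp p D" "\<phi> \<in> test_functions D"
  shows "\<bar>A_test A D u \<phi>\<bar> \<le> (\<Sum>i\<in>UNIV. onorm ((*v) (A i))) * Lp_norm p D u * Lp_norm q D (grad \<phi>)"
proof -
  note G = grad_Lp[OF q0 assms(3) bounded_opens_lmeasurable[OF assms(1)]]
  have "\<bar>A_test A D u \<phi>\<bar> \<le> (\<Sum>i\<in>UNIV. \<bar>\<integral>x. (A i *v u x) \<bullet> partial_deriv i \<phi> x \<partial>lebesgue_on D\<bar>)"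
    unfolding A_test_def by (rule sum_abs)
  also have "\<dots> \<le> (\<Sum>i\<in>UNIV. (onorm ((*v) (A i)) * Lp_norm p D u) * Lp_norm q D (grad \<phi>))"
  proof (rule sum_mono)
    fix i
    have "\<bar>\<integral>x. (A i *v u x) \<bullet> partial_deriv i \<phi> x \<partial>lebesgue_on D\<bar> \<le> Lp_norm p D (\<lambda>x. A i *v u x) * Lp_norm q D (\<lambda>x. column i (grad \<phi> x))"
      using Holder(2)[OF p q pq matrix_vector_Lp(1)[OF assms(2)] column_Lp(1)[OF G, of i], of "A i"] by (simp add: column_grad)
    also have "\<dots> \<le> (onorm ((*v) (A i)) * Lp_norm p D u) * Lp_norm q D (grad \<phi>)"
      using matrix_vector_Lp(2)[OF assms(2), of "A i"] column_Lp(2)[OF G, of i]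
      by (intro mult_mono) (auto simp: Lp_norm_nonneg onorm_pos_le matrix_vector_mul_bounded_linear)
    finally show "\<bar>\<integral>x. (A i *v u x) \<bullet> partial_deriv i \<phi> x \<partial>lebesgue_on D\<bar> \<le> (onorm ((*v) (A i)) * Lp_norm p D u) * Lp_norm q D (grad \<phi>)" .
  qed
  finally show ?thesis by (simp add: sum_distrib_right)
qed

lemma A_op_test:
  fixes u :: "real^'n \<Rightarrow> real^'d" and A :: "'n::finite \<Rightarrow> real^'d^'l"
  assumes "D \<in> bounded_opens" "u \<in> Lp p D" "\<phi> \<in> test_functions D"
  shows "A_op A D u \<phi> = - A_test A D u \<phi>"
proof -
  note G = grad_Lp[OF q0 assms(3) bounded_opens_lmeasurable[OF assms(1)]]
  have W: "weak_grad D \<phi> \<in> Lp q D"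
    by (rule Lp_AE[OF G _ bounded_opens_sets[OF assms(1)]]) (use weak_grad_test(1)[OF assms(3,1)] in \<open>auto elim: eventually_mono\<close>)
  have "(\<integral>x. (A i *v u x) \<bullet> column i (weak_grad D \<phi> x) \<partial>lebesgue_on D) = (\<integral>x. (A i *v u x) \<bullet> partial_deriv i \<phi> x \<partial>lebesgue_on D)" for i
  proof (rule integral_cong_AE)
    show "(\<lambda>x. (A i *v u x) \<bullet> column i (weak_grad D \<phi> x)) \<in> borel_measurable (lebesgue_on D)"
      using Lp_measurable[OF matrix_vector_Lp(1)[OF assms(2), of "A i"]] Lp_measurable[OF column_Lp(1)[OF W, of i]] by simp
    show "(\<lambda>x. (A i *v u x) \<bullet> partial_deriv i \<phi> x) \<in> borel_measurable (lebesgue_on D)"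
      using Lp_measurable[OF matrix_vector_Lp(1)[OF assms(2), of "A i"]] Lp_measurable[OF column_Lp(1)[OF G, of i]] by (simp add: column_grad)
    show "AE x in lebesgue_on D. (A i *v u x) \<bullet> column i (weak_grad D \<phi> x) = (A i *v u x) \<bullet> partial_deriv i \<phi> x"
      using weak_grad_test(1)[OF assms(3,1)] by eventually_elim (simp add: column_grad)
  qed
  then show ?thesis by (simp add: A_op_def A_test_def)
qed

lemma A_op_dual:
  fixes u :: "real^'n \<Rightarrow> real^'d" and A :: "'n::finite \<Rightarrow> real^'d^'l"
  assumes D: "D \<in> bounded_opens" and u: "u \<in> Lp p D"
  shows "\<And>\<phi>. \<phi> \<in> test_functions D \<Longrightarrow>
      \<bar>A_test A D u \<phi>\<bar> \<le> dual_norm q D (A_op A D u) * Lp_norm q D (grad \<phi>)"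
    "\<And>C. 0 \<le> C \<Longrightarrow> (\<And>\<phi>. \<phi> \<in> test_functions D \<Longrightarrow> \<bar>A_test A D u \<phi>\<bar> \<le> C * Lp_norm q D (grad \<phi>))
      \<Longrightarrow> dual_norm q D (A_op A D u) \<le> C"
    "0 \<le> dual_norm q D (A_op A D u)"
proof -
  note l = bounded_opens_lmeasurable[OF D]
  define B where "B = (\<Sum>i\<in>UNIV. Lp_norm p D (\<lambda>x. A i *v u x))"
  have B: "0 \<le> B" by (simp add: B_def sum_nonneg Lp_norm_nonneg)
  have cont0: "\<bar>A_op A D u \<phi> - A_op A D u \<psi>\<bar> \<le> B * (Lp_norm q D (\<lambda>x. \<phi> x - \<psi> x) + Lp_norm q D (\<lambda>x. grad \<phi> x - weak_grad D \<psi> x))"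
    if t: "\<phi> \<in> test_functions D" and W: "weak_grad D \<psi> \<in> Lp q D" for \<phi> \<psi>
  proof -
    note G = grad_Lp[OF q0 t l]
    note i1 = Holder(1)[OF p q pq matrix_vector_Lp(1)[OF u] column_Lp(1)[OF G]]
    note i2 = Holder(1)[OF p q pq matrix_vector_Lp(1)[OF u] column_Lp(1)[OF W]]
    note GW = Lp_diff[OF q0 G W]
    have cd: "column i (X - Y) = column i X - column i Y" for i and X Y :: "real^'n^'l" by (simp add: column_def vec_eq_iff)
    have "A_op A D u \<phi> - A_op A D u \<psi> = - (\<Sum>i\<in>UNIV. \<integral>x. (A i *v u x) \<bullet> column i (grad \<phi> x - weak_grad D \<psi> x) \<partial>lebesgue_on D)"
      using i1 i2 unfolding A_op_test[OF D u t]
      by (simp add: A_test_def A_op_def cd inner_diff_right column_grad[symmetric] sum_subtractf)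
    then have "\<bar>A_op A D u \<phi> - A_op A D u \<psi>\<bar> \<le> (\<Sum>i\<in>UNIV. \<bar>\<integral>x. (A i *v u x) \<bullet> column i (grad \<phi> x - weak_grad D \<psi> x) \<partial>lebesgue_on D\<bar>)"
      by simp
    also have "\<dots> \<le> (\<Sum>i\<in>UNIV. Lp_norm p D (\<lambda>x. A i *v u x) * Lp_norm q D (\<lambda>x. grad \<phi> x - weak_grad D \<psi> x))"
    proof (rule sum_mono)
      fix i
      have "\<bar>\<integral>x. (A i *v u x) \<bullet> column i (grad \<phi> x - weak_grad D \<psi> x) \<partial>lebesgue_on D\<bar> \<le> Lp_norm p D (\<lambda>x. A i *v u x) * Lp_norm q D (\<lambda>x. column i (grad \<phi> x - weak_grad D \<psi> x))"
        by (rule Holder(2)[OF p q pq matrix_vector_Lp(1)[OF u] column_Lp(1)[OF GW]])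
      also have "\<dots> \<le> Lp_norm p D (\<lambda>x. A i *v u x) * Lp_norm q D (\<lambda>x. grad \<phi> x - weak_grad D \<psi> x)"
        using column_Lp(2)[OF GW] by (intro mult_left_mono) (auto simp: Lp_norm_nonneg)
      finally show "\<bar>\<integral>x. (A i *v u x) \<bullet> column i (grad \<phi> x - weak_grad D \<psi> x) \<partial>lebesgue_on D\<bar> \<le> Lp_norm p D (\<lambda>x. A i *v u x) * Lp_norm q D (\<lambda>x. grad \<phi> x - weak_grad D \<psi> x)" .
    qed
    also have "\<dots> = B * Lp_norm q D (\<lambda>x. grad \<phi> x - weak_grad D \<psi> x)" by (simp add: B_def sum_distrib_right)
    finally show ?thesis using B Lp_norm_nonneg[of q D "\<lambda>x. \<phi> x - \<psi> x"]
      by (simp add: distrib_left add_increasing)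
  qed
  have bd0: "\<bar>A_op A D u \<phi>\<bar> \<le> (\<Sum>i\<in>UNIV. onorm ((*v) (A i))) * Lp_norm p D u * Lp_norm q D (grad \<phi>)" if "\<phi> \<in> test_functions D" for \<phi>
    using A_test_bound[OF D u that, of A] by (simp add: A_op_test[OF D u that])
  have C0: "0 \<le> (\<Sum>i\<in>UNIV. onorm ((*v) (A i))) * Lp_norm p D u"
    by (intro mult_nonneg_nonneg sum_nonneg onorm_pos_le Lp_norm_nonneg matrix_vector_mul_bounded_linear)
  have hom0: "A_op A D u (\<lambda>x. c *\<^sub>R \<phi> x) = c * A_op A D u \<phi>" if t: "\<phi> \<in> test_functions D" for \<phi> c
  proof -
    have "partial_deriv i (\<lambda>x. c *\<^sub>R \<phi> x) x = c *\<^sub>R partial_deriv i \<phi> x" for i x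
      by (rule partial_deriv_linear[OF bounded_linear_scaleR_right C_infinity_differentiable[OF test_functions_C_infinity[OF t]]])
    then show ?thesis
      unfolding A_op_test[OF D u t] A_op_test[OF D u test_functions_linear[OF t bounded_linear_scaleR_right]]
      by (simp add: A_test_def sum_distrib_left)
  qed
  have cont: "\<forall>\<phi>\<in>test_functions D. \<forall>\<psi>\<in>Lp q D. weak_grad D \<psi> \<in> Lp q D \<longrightarrow>
       \<bar>A_op A D u \<phi> - A_op A D u \<psi>\<bar> \<le> B * (Lp_norm q D (\<lambda>x. \<phi> x - \<psi> x) + Lp_norm q D (\<lambda>x. grad \<phi> x - weak_grad D \<psi> x))"
    using cont0 by simp
  have bd: "\<forall>\<phi>\<in>test_functions D. \<bar>A_op A D u \<phi>\<bar> \<le> (\<Sum>i\<in>UNIV. onorm ((*v) (A i))) * Lp_norm p D u * Lp_norm q D (grad \<phi>)"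
    using bd0 by simp
  have hom: "\<forall>\<phi>\<in>test_functions D. \<forall>c. A_op A D u (\<lambda>x. c *\<^sub>R \<phi> x) = c * A_op A D u \<phi>"
    using hom0 by simp
  note R = dual_norm_test_functions[OF q D B C0 cont bd hom]
  show "\<bar>A_test A D u \<phi>\<bar> \<le> dual_norm q D (A_op A D u) * Lp_norm q D (grad \<phi>)"
    if "\<phi> \<in> test_functions D" for \<phi> using R(1)[OF that] by (simp add: A_op_test[OF D u that])
  show "dual_norm q D (A_op A D u) \<le> C"
    if "0 \<le> C" "\<And>\<phi>. \<phi> \<in> test_functions D \<Longrightarrow> \<bar>A_test A D u \<phi>\<bar> \<le> C * Lp_norm q D (grad \<phi>)" for C
    by (rule R(2)) (use that in \<open>auto simp: A_op_test[OF D u]\<close>)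
  show "0 \<le> dual_norm q D (A_op A D u)" by (rule R(3))
qed

lemma A_norm_nonneg: "D \<in> bounded_opens \<Longrightarrow> u \<in> Lp p D \<Longrightarrow> 0 \<le> A_norm A q D u"
  unfolding A_norm_def by (intro add_nonneg_nonneg of_Lp_dual A_op_dual)

lemma A_test_integrable:
  fixes u :: "real^'n \<Rightarrow> real^'d" and B :: "real^'d^'l"
  assumes "D \<in> bounded_opens" "u \<in> Lp p D" "\<phi> \<in> test_functions D"
  shows "integrable (lebesgue_on D) (\<lambda>x. (B *v u x) \<bullet> partial_deriv i \<phi> x)"
  using Holder(1)[OF p q pq matrix_vector_Lp(1)[OF assms(2)] test_functions_Lp[OF q0 test_functions_partial_deriv[OF assms(3)] bounded_opens_lmeasurable[OF assms(1)]]] .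

lemma A_norm_triangle:
  fixes u v :: "real^'n \<Rightarrow> real^'d" and A :: "'n::finite \<Rightarrow> real^'d^'l"
  assumes D: "D \<in> bounded_opens" and u: "u \<in> Lp p D" and v: "v \<in> Lp p D"
  shows "A_norm A q D (\<lambda>x. u x + v x) \<le> A_norm A q D u + A_norm A q D v"
proof -
  note l = bounded_opens_lmeasurable[OF D]
  note uv = Lp_add[OF p0 u v]
  have "dual_norm q D (of_Lp D (\<lambda>x. u x + v x)) \<le> dual_norm q D (of_Lp D u) + dual_norm q D (of_Lp D v)"
  proof (rule of_Lp_dual(2)[OF D uv])
    show "0 \<le> dual_norm q D (of_Lp D u) + dual_norm q D (of_Lp D v)"
      by (intro add_nonneg_nonneg of_Lp_dual(3)[OF D] u v)
    fix \<phi> :: "real^'n \<Rightarrow> real^'d" assume t: "\<phi> \<in> test_functions D"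
    note tL = test_functions_Lp[OF q0 t l]
    have "(\<integral>x. (u x + v x) \<bullet> \<phi> x \<partial>lebesgue_on D) = (\<integral>x. u x \<bullet> \<phi> x \<partial>lebesgue_on D) + (\<integral>x. v x \<bullet> \<phi> x \<partial>lebesgue_on D)"
      using Holder(1)[OF p q pq u tL] Holder(1)[OF p q pq v tL] by (simp add: inner_add_left)
    then show "\<bar>\<integral>x. (u x + v x) \<bullet> \<phi> x \<partial>lebesgue_on D\<bar> \<le> (dual_norm q D (of_Lp D u) + dual_norm q D (of_Lp D v)) * Lp_norm q D (grad \<phi>)"
      using of_Lp_dual(1)[OF D u t] of_Lp_dual(1)[OF D v t] by (simp add: distrib_right)
  qed
  moreover have "dual_norm q D (A_op A D (\<lambda>x. u x + v x)) \<le> dual_norm q D (A_op A D u) + dual_norm q D (A_op A D v)"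
  proof (rule A_op_dual(2)[OF D uv])
    show "0 \<le> dual_norm q D (A_op A D u) + dual_norm q D (A_op A D v)"
      by (intro add_nonneg_nonneg A_op_dual(3)[OF D] u v)
    fix \<phi> :: "real^'n \<Rightarrow> real^'l" assume t: "\<phi> \<in> test_functions D"
    have "A_test A D (\<lambda>x. u x + v x) \<phi> = A_test A D u \<phi> + A_test A D v \<phi>"
      using A_test_integrable[OF D u t] A_test_integrable[OF D v t]
      by (simp add: A_test_def inner_add_left matrix_vector_right_distrib sum.distrib)
    then show "\<bar>A_test A D (\<lambda>x. u x + v x) \<phi>\<bar> \<le> (dual_norm q D (A_op A D u) + dual_norm q D (A_op A D v)) * Lp_norm q D (grad \<phi>)"
      using A_op_dual(1)[OF D u t, of A] A_op_dual(1)[OF D v t, of A] by (simp add: distrib_right)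
  qed
  ultimately show ?thesis by (simp add: A_norm_def)
qed

lemma A_norm_triangle_diff:
  assumes D: "D \<in> bounded_opens" and "u \<in> Lp p D" "v \<in> Lp p D" "w \<in> Lp p D"
  shows "A_norm A q D (\<lambda>x. u x - w x) \<le> A_norm A q D (\<lambda>x. u x - v x) + A_norm A q D (\<lambda>x. v x - w x)"
  using A_norm_triangle[OF D Lp_diff[OF p0 assms(2,3)] Lp_diff[OF p0 assms(3,4)], of A] by simp

text \<open>Hence a set that is dense for the \<open>L^p\<close> norm is dense for the weaker
  topology too, so separability carries over.\<close>

lemma A_norm_le_Lp_norm:
  fixes A :: "'n::finite \<Rightarrow> real^'d^'l"
  assumes D: "D \<in> bounded_opens"
  obtains C where "0 \<le> C" "\<And>u :: real^'n \<Rightarrow> real^'d. u \<in> Lp p D \<Longrightarrow> A_norm A q D u \<le> C * Lp_norm p D u"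
proof -
  obtain C where C: "0 \<le> C" "\<And>(u :: real^'n \<Rightarrow> real^'d) \<phi>. u \<in> Lp p D \<Longrightarrow> \<phi> \<in> test_functions D \<Longrightarrow>
    \<bar>\<integral>x. u x \<bullet> \<phi> x \<partial>lebesgue_on D\<bar> \<le> C * Lp_norm p D u * Lp_norm q D (grad \<phi>)"
    by (rule Poincare_Holder[OF D]) (rule that)
  let ?B = "\<Sum>i\<in>UNIV. onorm ((*v) (A i))"
  have B: "0 \<le> ?B" by (intro sum_nonneg onorm_pos_le matrix_vector_mul_bounded_linear)
  have "A_norm A q D u \<le> (C + ?B) * Lp_norm p D u" if u: "u \<in> Lp p D" for u
  proof -
    have "dual_norm q D (of_Lp D u) \<le> C * Lp_norm p D u"
      using C u by (intro of_Lp_dual(2)[OF D u]) (auto simp: Lp_norm_nonneg)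
    moreover have "dual_norm q D (A_op A D u) \<le> ?B * Lp_norm p D u"
      using B A_test_bound[OF D u, of _ A] by (intro A_op_dual(2)[OF D u]) (auto simp: Lp_norm_nonneg)
    ultimately show ?thesis by (simp add: A_norm_def distrib_right)
  qed
  then show ?thesis using that[of "C + ?B"] B C(1) by simp
qed

lemma A_norm_zero:
  assumes "D \<in> bounded_opens" "u \<in> Lp p D" "AE x in lebesgue_on D. u x = 0"
  shows "A_norm A q D u = 0"
proof -
  obtain C where C: "0 \<le> C" "A_norm A q D u \<le> C * Lp_norm p D u"
    using A_norm_le_Lp_norm[OF assms(1), of A] assms(2) by metis
  moreover have "Lp_norm p D u = Lp_norm p D (\<lambda>x. 0 :: real^'b)"
    by (rule Lp_norm_cong_AE[OF Lp_measurable[OF assms(2)] _ assms(3)]) simp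
  ultimately show ?thesis using A_norm_nonneg[OF assms(1,2), of A] by (simp add: Lp_norm_zero)
qed

text \<open>The product rule gives \<open>\<zeta> grad \<phi>\<close> and a term with
  \<open>\<phi>\<close> undifferentiated. The Poincare inequality on \<open>D\<close> turns the
  latter into a gradient term, so that multiplication by \<open>\<zeta>\<close> is bounded for the
  gradient norm alone.\<close>

lemma grad_cutoff_bound:
  fixes \<zeta> :: "real^'n \<Rightarrow> real"
  assumes D: "D \<in> bounded_opens" and D': "D' \<in> bounded_opens"
    and \<zeta>: "\<zeta> \<in> C_infinity" "\<And>x. \<bar>\<zeta> x\<bar> \<le> B" "\<And>i x. \<bar>partial_deriv i \<zeta> x\<bar> \<le> B"
    and S: "closed S" "\<And>x. x \<notin> S \<Longrightarrow> \<zeta> x = 0" "S \<inter> D \<subseteq> D'"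
  obtains C where "0 \<le> C" "\<And>\<phi> :: real^'n \<Rightarrow> real^'m. \<phi> \<in> test_functions D \<Longrightarrow>
    Lp_norm q D' (grad (\<lambda>x. \<zeta> x *\<^sub>R \<phi> x)) \<le> C * Lp_norm q D (grad \<phi>)"
proof -
  note l = bounded_opens_lmeasurable[OF D]
  have B: "0 \<le> B" using \<zeta>(2)[of undefined] by linarith
  let ?n = "real CARD('n)"
  obtain P where P: "0 \<le> P" "\<And>\<phi> :: real^'n \<Rightarrow> real^'m. \<phi> \<in> test_functions D \<Longrightarrow> Lp_norm q D \<phi> \<le> P * Lp_norm q D (grad \<phi>)"
    using Poincare[OF q D] by blast
  have "Lp_norm q D' (grad (\<lambda>x. \<zeta> x *\<^sub>R \<phi> x)) \<le> (?n * B + ?n * B * P) * Lp_norm q D (grad \<phi>)"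
    if t: "\<phi> \<in> test_functions D" for \<phi> :: "real^'n \<Rightarrow> real^'m"
  proof -
    have t1: "(\<lambda>x. \<zeta> x *\<^sub>R \<phi> x) \<in> test_functions D'" by (rule test_functions_scaleR[OF \<zeta>(1) t S])
    have t2: "(\<lambda>x. \<zeta> x *\<^sub>R \<phi> x) \<in> test_functions D"
      by (rule test_functions_scaleR[OF \<zeta>(1) t, of UNIV]) auto
    note G = grad_Lp[OF q0 t l] note P' = test_functions_Lp[OF q0 t l]
    let ?f = "\<lambda>x. norm (grad \<phi> x) + norm (\<phi> x)"
    have nL: "(\<lambda>x. norm (f x)) \<in> Lp q D" if "f \<in> Lp q D" for f :: "real^'n \<Rightarrow> 'c::euclidean_space"
      using that by (auto simp: Lp_def)
    have nN: "Lp_norm q D (\<lambda>x. norm (f x)) = Lp_norm q D f" for f :: "real^'n \<Rightarrow> 'c::euclidean_space"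
      by (simp add: Lp_norm_def)
    have fL: "?f \<in> Lp q D" by (rule Lp_add[OF q0 nL[OF G] nL[OF P']])
    have le: "norm (grad (\<lambda>x. \<zeta> x *\<^sub>R \<phi> x) x) \<le> ?n * B * norm (?f x)" for x
    proof -
      have "norm (grad (\<lambda>x. \<zeta> x *\<^sub>R \<phi> x) x) \<le> (\<Sum>i\<in>UNIV. norm (partial_deriv i (\<lambda>x. \<zeta> x *\<^sub>R \<phi> x) x))"
        using norm_matrix_le_sum[of "grad (\<lambda>x. \<zeta> x *\<^sub>R \<phi> x) x"] by (simp add: column_grad)
      also have "\<dots> \<le> (\<Sum>i\<in>(UNIV :: 'n set). B * norm (grad \<phi> x) + B * norm (\<phi> x))"
      proof (rule sum_mono)
        fix i
        have "partial_deriv i (\<lambda>x. \<zeta> x *\<^sub>R \<phi> x) x = \<zeta> x *\<^sub>R partial_deriv i \<phi> x + partial_deriv i \<zeta> x *\<^sub>R \<phi> x"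
          by (rule partial_deriv_scaleR[OF C_infinity_differentiable[OF \<zeta>(1)] C_infinity_differentiable[OF test_functions_C_infinity[OF t]]])
        then have "norm (partial_deriv i (\<lambda>x. \<zeta> x *\<^sub>R \<phi> x) x) \<le> \<bar>\<zeta> x\<bar> * norm (partial_deriv i \<phi> x) + \<bar>partial_deriv i \<zeta> x\<bar> * norm (\<phi> x)"
          by (metis norm_scaleR norm_triangle_ineq)
        also have "\<dots> \<le> B * norm (grad \<phi> x) + B * norm (\<phi> x)"
          by (intro add_mono mult_mono \<zeta> norm_partial_deriv_le B) auto
        finally show "norm (partial_deriv i (\<lambda>x. \<zeta> x *\<^sub>R \<phi> x) x) \<le> B * norm (grad \<phi> x) + B * norm (\<phi> x)" .
      qed
      finally show ?thesis by (simp add: algebra_simps)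
    qed
    \<comment> \<open>The product is a test function on \<open>D\<close> and on \<open>D'\<close>.
      Its gradient norm can therefore be computed on the whole space and then on \<open>D\<close>,
      where the bounds for \<open>\<phi>\<close> are available.\<close>
    have "Lp_norm q D' (grad (\<lambda>x. \<zeta> x *\<^sub>R \<phi> x)) = Lp_norm q UNIV (grad (\<lambda>x. \<zeta> x *\<^sub>R \<phi> x))"
      by (rule Lp_norm_support[OF bounded_opens_sets[OF D'] grad_test_functions_zero[OF t1]])
    also have "\<dots> = Lp_norm q D (grad (\<lambda>x. \<zeta> x *\<^sub>R \<phi> x))"
      by (rule Lp_norm_support[OF bounded_opens_sets[OF D] grad_test_functions_zero[OF t2], symmetric])
    also have "\<dots> \<le> ?n * B * Lp_norm q D ?f"
      by (rule Lp_bound(2)[OF q0 fL Lp_measurable[OF grad_Lp[OF q0 t2 l]] _ le]) (use B in simp)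
    also have "\<dots> \<le> ?n * B * (Lp_norm q D (grad \<phi>) + Lp_norm q D \<phi>)"
      using Lp_norm_triangle[OF q nL[OF G] nL[OF P']] B by (intro mult_left_mono) (auto simp: nN)
    also have "\<dots> \<le> ?n * B * (Lp_norm q D (grad \<phi>) + P * Lp_norm q D (grad \<phi>))"
      using B P(2)[OF t] by (intro mult_left_mono add_left_mono) auto
    finally show ?thesis by (simp add: algebra_simps)
  qed
  moreover have "0 \<le> ?n * B + ?n * B * P" using B P(1) by simp
  ultimately show ?thesis using that by blast
qed

text \<open>The proof uses \<open>\<A>(\<zeta>u) = \<zeta> \<A>u + \<Sum>\<^sub>i \<partial>\<^sub>i\<zeta> A\<^sup>i u\<close>; the choice \<open>\<zeta> = 1\<close> gives monotonicity in the domain.\<close>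

lemma A_norm_cutoff:
  fixes \<zeta> :: "real^'n \<Rightarrow> real" and A :: "'n::finite \<Rightarrow> real^'d^'l"
  assumes D: "D \<in> bounded_opens" and D': "D' \<in> bounded_opens"
    and \<zeta>: "\<zeta> \<in> C_infinity" "\<And>x. \<bar>\<zeta> x\<bar> \<le> B" "\<And>i x. \<bar>partial_deriv i \<zeta> x\<bar> \<le> B"
       "\<And>i j x. \<bar>partial_deriv i (partial_deriv j \<zeta>) x\<bar> \<le> B"
    and S: "closed S" "\<And>x. x \<notin> S \<Longrightarrow> \<zeta> x = 0" "S \<inter> D \<subseteq> D'"
  obtains C where "0 \<le> C" "\<And>w :: real^'n \<Rightarrow> real^'d. w \<in> Lp p D' \<Longrightarrow> (\<lambda>x. \<zeta> x *\<^sub>R w x) \<in> Lp p D \<Longrightarrow>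
    A_norm A q D (\<lambda>x. \<zeta> x *\<^sub>R w x) \<le> C * A_norm A q D' w"
proof -
  note l' = bounded_opens_lmeasurable[OF D']
  note s = bounded_opens_sets[OF D] note s' = bounded_opens_sets[OF D']
  have S': "partial_deriv i \<zeta> x = 0" if "x \<notin> S" for i x
    by (rule partial_deriv_outside_support[OF S(1,2) that])
  \<comment> \<open>Such integrands vanish off \<open>S \<inter> D\<close>, which is contained in
    \<open>D'\<close> as well, so the domain of integration can be exchanged.\<close>
  have swap: "(\<integral>x. f x \<partial>lebesgue_on D) = (\<integral>x. f x \<partial>lebesgue_on D')"
    if "\<And>x. x \<notin> D \<Longrightarrow> f x = 0" "\<And>x. x \<notin> S \<Longrightarrow> f x = 0" for f :: "real^'n \<Rightarrow> real"
  proof -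
    have "f x = 0" if "x \<notin> D'" for x using that S(3) \<open>\<And>x. x \<notin> D \<Longrightarrow> f x = 0\<close> \<open>\<And>x. x \<notin> S \<Longrightarrow> f x = 0\<close> by blast
    then show ?thesis using that(1) integral_lebesgue_on_support[OF s, of f] integral_lebesgue_on_support[OF s', of f] by simp
  qed
  obtain C1 where C1: "0 \<le> C1" "\<And>\<phi> :: real^'n \<Rightarrow> real^'d. \<phi> \<in> test_functions D \<Longrightarrow>
    Lp_norm q D' (grad (\<lambda>x. \<zeta> x *\<^sub>R \<phi> x)) \<le> C1 * Lp_norm q D (grad \<phi>)"
    using grad_cutoff_bound[OF D D' \<zeta>(1,2,3) S] by blast
  obtain C2 where C2: "0 \<le> C2" "\<And>\<phi> :: real^'n \<Rightarrow> real^'l. \<phi> \<in> test_functions D \<Longrightarrow>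
    Lp_norm q D' (grad (\<lambda>x. \<zeta> x *\<^sub>R \<phi> x)) \<le> C2 * Lp_norm q D (grad \<phi>)"
    using grad_cutoff_bound[OF D D' \<zeta>(1,2,3) S] by blast
  \<comment> \<open>Here \<open>partial_deriv i \<zeta>\<close> plays the part of the cutoff; this
    is where the bound on the second derivatives of \<open>\<zeta>\<close> enters.\<close>
  have "\<exists>C3\<ge>0. \<forall>\<phi> :: real^'n \<Rightarrow> real^'l. \<phi> \<in> test_functions D \<longrightarrow>
    Lp_norm q D' (grad (\<lambda>x. partial_deriv i \<zeta> x *\<^sub>R \<phi> x)) \<le> C3 * Lp_norm q D (grad \<phi>)" for i
    using grad_cutoff_bound[OF D D' C_infinity_partial_deriv[OF \<zeta>(1)] \<zeta>(3,4) S(1) S' S(3)] by metis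
  then obtain C3 where C3: "\<And>i. 0 \<le> C3 i" "\<And>i (\<phi> :: real^'n \<Rightarrow> real^'l). \<phi> \<in> test_functions D \<Longrightarrow>
    Lp_norm q D' (grad (\<lambda>x. partial_deriv i \<zeta> x *\<^sub>R \<phi> x)) \<le> C3 i * Lp_norm q D (grad \<phi>)"
    by metis
  define a where "a i = onorm ((*v) (transpose (A i))) * real CARD('n)" for i
  have a0: "0 \<le> a i" for i by (simp add: a_def onorm_pos_le matrix_vector_mul_bounded_linear)
  have tr: "(\<lambda>x. transpose (A i) *v \<phi> x) \<in> test_functions E" "Lp_norm q E (grad (\<lambda>x. transpose (A i) *v \<phi> x)) \<le> a i * Lp_norm q E (grad \<phi>)"
    if t: "\<phi> \<in> test_functions E" and E: "E \<in> bounded_opens" for \<phi> :: "real^'n \<Rightarrow> real^'l" and E i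
  proof -
    let ?h = "(*v) (transpose (A i))"
    show t': "(\<lambda>x. ?h (\<phi> x)) \<in> test_functions E"
      by (rule test_functions_linear[OF t matrix_vector_mul_bounded_linear])
    note lE = bounded_opens_lmeasurable[OF E]
    have "norm (grad (\<lambda>x. ?h (\<phi> x)) x) \<le> a i * norm (grad \<phi> x)" for x
    proof -
      have "norm (grad (\<lambda>x. ?h (\<phi> x)) x) \<le> (\<Sum>j\<in>UNIV. norm (partial_deriv j (\<lambda>x. ?h (\<phi> x)) x))"
        using norm_matrix_le_sum[of "grad (\<lambda>x. ?h (\<phi> x)) x"] by (simp add: column_grad)
      also have "\<dots> \<le> (\<Sum>j\<in>(UNIV :: 'n set). onorm ?h * norm (grad \<phi> x))"
      proof (rule sum_mono)
        fix j
        have "partial_deriv j (\<lambda>x. ?h (\<phi> x)) x = ?h (partial_deriv j \<phi> x)"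
          by (rule partial_deriv_linear[OF matrix_vector_mul_bounded_linear C_infinity_differentiable[OF test_functions_C_infinity[OF t]]])
        then have "norm (partial_deriv j (\<lambda>x. ?h (\<phi> x)) x) \<le> onorm ?h * norm (partial_deriv j \<phi> x)"
          using onorm[OF matrix_vector_mul_bounded_linear[of "transpose (A i)"]] by simp
        also have "\<dots> \<le> onorm ?h * norm (grad \<phi> x)"
          by (intro mult_left_mono norm_partial_deriv_le onorm_pos_le matrix_vector_mul_bounded_linear)
        finally show "norm (partial_deriv j (\<lambda>x. ?h (\<phi> x)) x) \<le> onorm ?h * norm (grad \<phi> x)" .
      qed
      finally show ?thesis by (simp add: a_def mult_ac)
    qed
    then show "Lp_norm q E (grad (\<lambda>x. ?h (\<phi> x))) \<le> a i * Lp_norm q E (grad \<phi>)"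
      using Lp_bound(2)[OF q0 grad_Lp[OF q0 t lE] Lp_measurable[OF grad_Lp[OF q0 t' lE]] a0] by blast
  qed
  have "A_norm A q D (\<lambda>x. \<zeta> x *\<^sub>R w x) \<le> (C1 + C2 + (\<Sum>i\<in>UNIV. a i * C3 i)) * A_norm A q D' w"
    if w: "w \<in> Lp p D'" and zw: "(\<lambda>x. \<zeta> x *\<^sub>R w x) \<in> Lp p D" for w :: "real^'n \<Rightarrow> real^'d"
  proof -
    define N1 N2 where "N1 = dual_norm q D' (of_Lp D' w)" and "N2 = dual_norm q D' (A_op A D' w)"
    have N: "0 \<le> N1" "0 \<le> N2" using of_Lp_dual(3)[OF D' w] A_op_dual(3)[OF D' w] by (auto simp: N1_def N2_def)
    have "dual_norm q D (of_Lp D (\<lambda>x. \<zeta> x *\<^sub>R w x)) \<le> C1 * N1"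
    proof (rule of_Lp_dual(2)[OF D zw])
      fix \<phi> :: "real^'n \<Rightarrow> real^'d" assume t: "\<phi> \<in> test_functions D"
      have t1: "(\<lambda>x. \<zeta> x *\<^sub>R \<phi> x) \<in> test_functions D'" by (rule test_functions_scaleR[OF \<zeta>(1) t S])
      have "(\<integral>x. (\<zeta> x *\<^sub>R w x) \<bullet> \<phi> x \<partial>lebesgue_on D) = (\<integral>x. w x \<bullet> (\<zeta> x *\<^sub>R \<phi> x) \<partial>lebesgue_on D')"
        using swap[of "\<lambda>x. w x \<bullet> (\<zeta> x *\<^sub>R \<phi> x)"] test_functions_zero_outside[OF t] S(2) by simp
      also have "\<bar>\<dots>\<bar> \<le> N1 * Lp_norm q D' (grad (\<lambda>x. \<zeta> x *\<^sub>R \<phi> x))"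
        unfolding N1_def by (rule of_Lp_dual(1)[OF D' w t1])
      also have "\<dots> \<le> N1 * (C1 * Lp_norm q D (grad \<phi>))"
        by (intro mult_left_mono C1(2)[OF t] N)
      finally show "\<bar>\<integral>x. (\<zeta> x *\<^sub>R w x) \<bullet> \<phi> x \<partial>lebesgue_on D\<bar> \<le> C1 * N1 * Lp_norm q D (grad \<phi>)" by (simp add: mult_ac)
    qed (use C1 N in simp)
    moreover have "dual_norm q D (A_op A D (\<lambda>x. \<zeta> x *\<^sub>R w x)) \<le> C2 * N2 + (\<Sum>i\<in>UNIV. a i * C3 i) * N1"
    proof (rule A_op_dual(2)[OF D zw])
      fix \<phi> :: "real^'n \<Rightarrow> real^'l" assume t: "\<phi> \<in> test_functions D"
      have t1: "(\<lambda>x. \<zeta> x *\<^sub>R \<phi> x) \<in> test_functions D'" by (rule test_functions_scaleR[OF \<zeta>(1) t S])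
      have t3: "(\<lambda>x. partial_deriv i \<zeta> x *\<^sub>R \<phi> x) \<in> test_functions D'" for i
        by (rule test_functions_scaleR[OF C_infinity_partial_deriv[OF \<zeta>(1)] t S(1) S' S(3)])
      have t4: "(\<lambda>x. transpose (A i) *v (partial_deriv i \<zeta> x *\<^sub>R \<phi> x)) \<in> test_functions D'" for i
        by (rule tr(1)[OF t3 D'])
      \<comment> \<open>The product rule for \<open>\<zeta> \<phi>\<close> splits off a term in
        which \<open>\<phi>\<close> is not differentiated. The transpose moves \<open>A i\<close> to
        the test function, so this term is a pairing of \<open>w\<close> itself and is bounded by
        the dual norm of \<open>of_Lp D' w\<close>.\<close>
      have eq: "(\<integral>x. (A i *v (\<zeta> x *\<^sub>R w x)) \<bullet> partial_deriv i \<phi> x \<partial>lebesgue_on D)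
          = (\<integral>x. (A i *v w x) \<bullet> partial_deriv i (\<lambda>x. \<zeta> x *\<^sub>R \<phi> x) x \<partial>lebesgue_on D')
           - (\<integral>x. w x \<bullet> (transpose (A i) *v (partial_deriv i \<zeta> x *\<^sub>R \<phi> x)) \<partial>lebesgue_on D')" for i
      proof -
        have pd: "partial_deriv i (\<lambda>x. \<zeta> x *\<^sub>R \<phi> x) x = \<zeta> x *\<^sub>R partial_deriv i \<phi> x + partial_deriv i \<zeta> x *\<^sub>R \<phi> x" for x
          by (rule partial_deriv_scaleR[OF C_infinity_differentiable[OF \<zeta>(1)] C_infinity_differentiable[OF test_functions_C_infinity[OF t]]])
        have "(\<integral>x. (A i *v (\<zeta> x *\<^sub>R w x)) \<bullet> partial_deriv i \<phi> x \<partial>lebesgue_on D)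
          = (\<integral>x. (A i *v (\<zeta> x *\<^sub>R w x)) \<bullet> partial_deriv i \<phi> x \<partial>lebesgue_on D')"
          by (rule swap) (use S(2) test_functions_zero_outside[OF test_functions_partial_deriv[OF t]] in \<open>auto\<close>)
        also have "\<dots> = (\<integral>x. (A i *v w x) \<bullet> partial_deriv i (\<lambda>x. \<zeta> x *\<^sub>R \<phi> x) x
             - w x \<bullet> (transpose (A i) *v (partial_deriv i \<zeta> x *\<^sub>R \<phi> x)) \<partial>lebesgue_on D')"
        proof (rule Bochner_Integration.integral_cong[OF refl])
          fix x
          have "w x \<bullet> (transpose (A i) *v (partial_deriv i \<zeta> x *\<^sub>R \<phi> x)) = (A i *v w x) \<bullet> (partial_deriv i \<zeta> x *\<^sub>R \<phi> x)"
            by (metis dot_lmul_matrix inner_commute transpose_matrix_vector)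
          then show "(A i *v (\<zeta> x *\<^sub>R w x)) \<bullet> partial_deriv i \<phi> x = (A i *v w x) \<bullet> partial_deriv i (\<lambda>x. \<zeta> x *\<^sub>R \<phi> x) x
             - w x \<bullet> (transpose (A i) *v (partial_deriv i \<zeta> x *\<^sub>R \<phi> x))"
            by (auto simp: pd inner_add_right matrix_vector_mult_scaleR)
        qed
        also have "\<dots> = (\<integral>x. (A i *v w x) \<bullet> partial_deriv i (\<lambda>x. \<zeta> x *\<^sub>R \<phi> x) x \<partial>lebesgue_on D')
           - (\<integral>x. w x \<bullet> (transpose (A i) *v (partial_deriv i \<zeta> x *\<^sub>R \<phi> x)) \<partial>lebesgue_on D')"
          by (rule Bochner_Integration.integral_diff[OF A_test_integrable[OF D' w t1] Holder(1)[OF p q pq w test_functions_Lp[OF q0 t4 l']]])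
        finally show ?thesis .
      qed
      have "A_test A D (\<lambda>x. \<zeta> x *\<^sub>R w x) \<phi> = A_test A D' w (\<lambda>x. \<zeta> x *\<^sub>R \<phi> x)
          - (\<Sum>i\<in>UNIV. \<integral>x. w x \<bullet> (transpose (A i) *v (partial_deriv i \<zeta> x *\<^sub>R \<phi> x)) \<partial>lebesgue_on D')"
        by (simp add: A_test_def eq sum_subtractf)
      moreover have "\<bar>A_test A D' w (\<lambda>x. \<zeta> x *\<^sub>R \<phi> x)\<bar> \<le> N2 * (C2 * Lp_norm q D (grad \<phi>))"
        using A_op_dual(1)[OF D' w t1, of A] mult_left_mono[OF C2(2)[OF t] N(2)] by (simp add: N2_def)
      moreover have "\<bar>\<Sum>i\<in>UNIV. \<integral>x. w x \<bullet> (transpose (A i) *v (partial_deriv i \<zeta> x *\<^sub>R \<phi> x)) \<partial>lebesgue_on D'\<bar>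
          \<le> (\<Sum>i\<in>UNIV. a i * C3 i * N1 * Lp_norm q D (grad \<phi>))"
      proof (rule order_trans[OF sum_abs sum_mono])
        fix i
        have "\<bar>\<integral>x. w x \<bullet> (transpose (A i) *v (partial_deriv i \<zeta> x *\<^sub>R \<phi> x)) \<partial>lebesgue_on D'\<bar>
            \<le> N1 * Lp_norm q D' (grad (\<lambda>x. transpose (A i) *v (partial_deriv i \<zeta> x *\<^sub>R \<phi> x)))"
          unfolding N1_def by (rule of_Lp_dual(1)[OF D' w t4])
        also have "\<dots> \<le> N1 * (a i * (C3 i * Lp_norm q D (grad \<phi>)))"
          using order_trans[OF tr(2)[OF t3 D'] mult_left_mono[OF C3(2)[OF t] a0]] N by (intro mult_left_mono) auto
        finally show "\<bar>\<integral>x. w x \<bullet> (transpose (A i) *v (partial_deriv i \<zeta> x *\<^sub>R \<phi> x)) \<partial>lebesgue_on D'\<bar>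
            \<le> a i * C3 i * N1 * Lp_norm q D (grad \<phi>)" by (simp add: mult_ac)
      qed
      ultimately have *: "\<bar>A_test A D (\<lambda>x. \<zeta> x *\<^sub>R w x) \<phi>\<bar> \<le> N2 * (C2 * Lp_norm q D (grad \<phi>)) +
          (\<Sum>i\<in>UNIV. a i * C3 i * N1 * Lp_norm q D (grad \<phi>))"
        by linarith
      show "\<bar>A_test A D (\<lambda>x. \<zeta> x *\<^sub>R w x) \<phi>\<bar> \<le> (C2 * N2 + (\<Sum>i\<in>UNIV. a i * C3 i) * N1) * Lp_norm q D (grad \<phi>)"
      proof -
        have "(\<Sum>i\<in>UNIV. a i * C3 i * N1 * Lp_norm q D (grad \<phi>)) = (\<Sum>i\<in>UNIV. a i * C3 i) * N1 * Lp_norm q D (grad \<phi>)"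
          by (simp add: sum_distrib_right)
        moreover have "(C2 * N2 + (\<Sum>i\<in>UNIV. a i * C3 i) * N1) * Lp_norm q D (grad \<phi>)
            = N2 * (C2 * Lp_norm q D (grad \<phi>)) + (\<Sum>i\<in>UNIV. a i * C3 i) * N1 * Lp_norm q D (grad \<phi>)"
          by (simp add: algebra_simps)
        ultimately show ?thesis using * by linarith
      qed
    qed (use C2 C3 N a0 in \<open>simp add: sum_nonneg\<close>)
    ultimately have "A_norm A q D (\<lambda>x. \<zeta> x *\<^sub>R w x) \<le> C1 * N1 + (C2 * N2 + (\<Sum>i\<in>UNIV. a i * C3 i) * N1)"
      by (simp add: A_norm_def)
    also have "\<dots> \<le> (C1 + C2 + (\<Sum>i\<in>UNIV. a i * C3 i)) * (N1 + N2)"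
      using mult_nonneg_nonneg[OF C1(1) N(2)] mult_nonneg_nonneg[OF C2(1) N(1)]
        mult_nonneg_nonneg[OF sum_nonneg[of UNIV "\<lambda>i. a i * C3 i"] N(2)] a0 C3(1)
      by (simp add: algebra_simps)
    finally show ?thesis by (simp add: A_norm_def N1_def N2_def)
  qed
  moreover have "0 \<le> C1 + C2 + (\<Sum>i\<in>UNIV. a i * C3 i)"
    using C1(1) C2(1) C3(1) a0 by (intro add_nonneg_nonneg sum_nonneg mult_nonneg_nonneg) auto
  ultimately show ?thesis using that by blast
qed

lemma A_norm_mono:
  fixes A :: "'n::finite \<Rightarrow> real^'d^'l"
  assumes D: "D \<in> bounded_opens" and D': "D' \<in> bounded_opens" and "D \<subseteq> D'"
  obtains C where "0 \<le> C" "\<And>w :: real^'n \<Rightarrow> real^'d. w \<in> Lp p D' \<Longrightarrow> A_norm A q D w \<le> C * A_norm A q D' w"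
proof -
  have 1: "partial_deriv i (\<lambda>x::real^'n. 1 :: real) x = 0" for i x by (rule partial_deriv_const)
  have 2: "partial_deriv i (partial_deriv j (\<lambda>x::real^'n. 1 :: real)) x = 0" for i j x
  proof -
    have "partial_deriv j (\<lambda>x::real^'n. 1 :: real) = (\<lambda>x. 0)" using 1 by auto
    then show ?thesis by (simp add: partial_deriv_const)
  qed
  obtain C where C: "0 \<le> C" "\<And>w :: real^'n \<Rightarrow> real^'d. w \<in> Lp p D' \<Longrightarrow> (\<lambda>x. 1 *\<^sub>R w x) \<in> Lp p D \<Longrightarrow>
    A_norm A q D (\<lambda>x. 1 *\<^sub>R w x) \<le> C * A_norm A q D' w"
    by (rule A_norm_cutoff[OF D D' C_infinity_const[of 1], of 1 UNIV A]) (use 1 2 assms(3) in auto)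
  have "A_norm A q D w \<le> C * A_norm A q D' w" if "w \<in> Lp p D'" for w :: "real^'n \<Rightarrow> real^'d"
    using C(2)[OF that] Lp_subset(1)[OF assms(3) bounded_opens_sets[OF D'] bounded_opens_sets[OF D] that] by simp
  then show ?thesis using that C(1) by blast
qed

end

section \<open>Semicontinuity, separability and Gamma-limits\<close>

context dual_exponents
begin

text \<open>Uses the duality \<open>\<bar>v\<bar>\<^sup>p \<ge> p \<phi> \<bullet> v - (p - 1) \<bar>\<phi>\<bar>\<^sup>q\<close> with a
  test function \<open>\<phi>\<close> close to \<open>\<bar>u\<bar>\<^sup>p\<^sup>-\<^sup>2 u\<close>.\<close>

lemma Lp_norm_lower_semicontinuous:
  fixes u :: "real^'n \<Rightarrow> real^'d" and A :: "'n::finite \<Rightarrow> real^'d^'l"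
  assumes D: "D \<in> bounded_opens" and u: "u \<in> Lp p D" and e: "0 < \<epsilon>"
  obtains \<delta> where "0 < \<delta>" "\<And>v. v \<in> Lp p D \<Longrightarrow> A_norm A q D (\<lambda>x. v x - u x) < \<delta> \<Longrightarrow>
    (\<integral>x. norm (u x) powr p \<partial>lebesgue_on D) - \<epsilon> \<le> (\<integral>x. norm (v x) powr p \<partial>lebesgue_on D)"
proof -
  note l = bounded_opens_lmeasurable[OF D]
  have pq1: "(p - 1) * q = p" and pq2: "p / q = p - 1" using p q pq by (auto simp: field_simps)
  \<comment> \<open>The equality case of Young's inequality:
    \<open>u \<bullet> \<eta> = |u|^p = |\<eta>|^q\<close>. It lies in \<open>L^q\<close> without
    any control on its gradient, whereas closeness of \<open>v\<close> to \<open>u\<close> can only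
    be tested against functions with a gradient; hence the passage to a nearby test
    function.\<close>
  define \<eta> where "\<eta> x = power_dual p (u x)" for x
  have m: "\<eta> \<in> borel_measurable (lebesgue_on D)" unfolding \<eta>_def
    by (rule borel_measurable_continuous_on[OF continuous_power_dual[OF p] Lp_measurable[OF u]])
  have ne: "norm (\<eta> x) powr q = norm (u x) powr p" for x by (simp add: \<eta>_def norm_power_dual powr_powr pq1)
  have \<eta>: "\<eta> \<in> Lp q D" using m Lp_integrable[OF u] by (simp add: Lp_def ne)
  define I N U where "I = (\<integral>x. norm (u x) powr p \<partial>lebesgue_on D)" and "N = Lp_norm q D \<eta>" and "U = Lp_norm p D u"
  have NI: "N powr q = I" using q0 by (simp add: N_def I_def Lp_norm_powr ne)
  have \<eta>u: "(\<integral>x. u x \<bullet> \<eta> x \<partial>lebesgue_on D) = I"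
    unfolding I_def \<eta>_def by (subst inner_commute) (simp add: inner_power_dual)
  define \<tau> where "\<tau> n = inverse (real (Suc n))" for n
  \<comment> \<open>\<open>\<tau> n\<close> is the accuracy with which \<open>\<eta>\<close> is
    approximated. The expression is the lower bound that this leaves for \<open>p\<close> times the
    integral of \<open>u \<bullet> \<phi>\<close> minus \<open>p - 1\<close> times that of
    \<open>|\<phi>|^q\<close>; its limit is \<open>p I - (p - 1) I = I\<close>.\<close>
  have "(\<lambda>n. p * (I - \<tau> n * U) - (p - 1) * (N + \<tau> n) powr q) \<longlonglongrightarrow> p * (I - 0 * U) - (p - 1) * (N + 0) powr q"
  proof -
    have t: "\<tau> \<longlonglongrightarrow> 0" unfolding \<tau>_def by (rule LIMSEQ_inverse_real_of_nat)
    have "0 \<le> N + \<tau> n" for n by (simp add: N_def \<tau>_def Lp_norm_nonneg add_nonneg_nonneg)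
    then have "(\<lambda>n. (N + \<tau> n) powr q) \<longlonglongrightarrow> (N + 0) powr q"
      using q0 by (intro tendsto_powr' tendsto_add tendsto_const t) auto
    then show ?thesis by (intro tendsto_diff tendsto_mult tendsto_const t)
  qed
  then have "(\<lambda>n. p * (I - \<tau> n * U) - (p - 1) * (N + \<tau> n) powr q) \<longlonglongrightarrow> I"
    by (simp add: NI algebra_simps)
  from order_tendstoD(1)[OF this, of "I - \<epsilon> / 2"] e
  have "\<forall>\<^sub>F n in sequentially. I - \<epsilon> / 2 < p * (I - \<tau> n * U) - (p - 1) * (N + \<tau> n) powr q" by simp
  then obtain n where n: "I - \<epsilon> / 2 < p * (I - \<tau> n * U) - (p - 1) * (N + \<tau> n) powr q"
    by (meson eventually_happens trivial_limit_sequentially)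
  have t0: "0 < \<tau> n" by (simp add: \<tau>_def)
  obtain \<phi> where \<phi>: "\<phi> \<in> test_functions D" "Lp_norm q D (\<lambda>x. \<eta> x - \<phi> x) < \<tau> n"
    using test_functions_dense[OF q D \<eta> t0] by blast
  note \<phi>L = test_functions_Lp[OF q0 \<phi>(1) l]
  have lower: "p * (I - \<tau> n * U) - (p - 1) * (N + \<tau> n) powr q
      \<le> p * (\<integral>x. u x \<bullet> \<phi> x \<partial>lebesgue_on D) - (p - 1) * (\<integral>x. norm (\<phi> x) powr q \<partial>lebesgue_on D)"
  proof -
    have "(\<integral>x. u x \<bullet> (\<eta> x - \<phi> x) \<partial>lebesgue_on D) = I - (\<integral>x. u x \<bullet> \<phi> x \<partial>lebesgue_on D)"
      using Holder(1)[OF p q pq u \<eta>] Holder(1)[OF p q pq u \<phi>L] by (simp add: inner_diff_right \<eta>u)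
    moreover have "\<bar>\<integral>x. u x \<bullet> (\<eta> x - \<phi> x) \<partial>lebesgue_on D\<bar> \<le> U * Lp_norm q D (\<lambda>x. \<eta> x - \<phi> x)"
      unfolding U_def by (rule Holder(2)[OF p q pq u Lp_diff[OF q0 \<eta> \<phi>L]])
    moreover have "U * Lp_norm q D (\<lambda>x. \<eta> x - \<phi> x) \<le> U * \<tau> n"
      using \<phi>(2) by (intro mult_left_mono) (auto simp: U_def Lp_norm_nonneg)
    ultimately have 1: "I - \<tau> n * U \<le> (\<integral>x. u x \<bullet> \<phi> x \<partial>lebesgue_on D)" by (simp add: mult.commute)
    have "Lp_norm q D \<phi> \<le> Lp_norm q D \<eta> + Lp_norm q D (\<lambda>x. \<phi> x - \<eta> x)"
      using Lp_norm_triangle[OF q \<eta> Lp_diff[OF q0 \<phi>L \<eta>]] by simp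
    then have "Lp_norm q D \<phi> \<le> N + \<tau> n" using \<phi>(2) Lp_norm_minus_commute[of q D \<phi> \<eta>] by (simp add: N_def)
    then have 2: "(\<integral>x. norm (\<phi> x) powr q \<partial>lebesgue_on D) \<le> (N + \<tau> n) powr q"
      using Lp_norm_nonneg[of q D \<eta>] t0 q0 by (subst (asm) Lp_norm_le_iff) (auto simp: N_def)
    from 1 2 p show ?thesis by (intro diff_mono mult_left_mono) auto
  qed
  \<comment> \<open>Half of \<open>\<epsilon>\<close> was spent on replacing \<open>\<eta>\<close>
    by \<open>\<phi>\<close>; with this radius the pairing of \<open>v - u\<close> with
    \<open>\<phi>\<close>, multiplied by \<open>p\<close>, costs at most the other half. The summand
    1 keeps the denominator positive.\<close>
  define \<delta> where "\<delta> = \<epsilon> / (2 * p * (Lp_norm q D (grad \<phi>) + 1))"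
  have g0: "0 < Lp_norm q D (grad \<phi>) + 1" using Lp_norm_nonneg[of q D "grad \<phi>"] by linarith
  show ?thesis
  proof
    show "0 < \<delta>" using e p0 g0 by (simp add: \<delta>_def)
    fix v assume v: "v \<in> Lp p D" and d: "A_norm A q D (\<lambda>x. v x - u x) < \<delta>"
    have vu: "(\<lambda>x. v x - u x) \<in> Lp p D" by (rule Lp_diff[OF p0 v u])
    have "\<bar>\<integral>x. (v x - u x) \<bullet> \<phi> x \<partial>lebesgue_on D\<bar> \<le> A_norm A q D (\<lambda>x. v x - u x) * Lp_norm q D (grad \<phi>)"
      using of_Lp_dual(1)[OF D vu \<phi>(1)] A_op_dual(3)[OF D vu, of A] Lp_norm_nonneg[of q D "grad \<phi>"]
      by (auto simp: A_norm_def distrib_right intro: order_trans)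
    also have "\<dots> \<le> \<delta> * (Lp_norm q D (grad \<phi>) + 1)"
      using d A_norm_nonneg[OF D vu, of A] by (intro mult_mono) (auto simp: Lp_norm_nonneg)
    also have "\<dots> = \<epsilon> / 2 / p" using g0 p0 unfolding \<delta>_def by (auto simp: divide_simps)
    finally have "p * \<bar>\<integral>x. (v x - u x) \<bullet> \<phi> x \<partial>lebesgue_on D\<bar> \<le> \<epsilon> / 2"
      using p0 by (simp add: field_simps)
    then have "- (\<epsilon> / 2) \<le> p * (\<integral>x. (v x - u x) \<bullet> \<phi> x \<partial>lebesgue_on D)"
      using abs_ge_minus_self[of "p * (\<integral>x. (v x - u x) \<bullet> \<phi> x \<partial>lebesgue_on D)"] p0 by (simp add: abs_mult)
    moreover have "(\<integral>x. (v x - u x) \<bullet> \<phi> x \<partial>lebesgue_on D) = (\<integral>x. v x \<bullet> \<phi> x \<partial>lebesgue_on D) - (\<integral>x. u x \<bullet> \<phi> x \<partial>lebesgue_on D)"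
      using Holder(1)[OF p q pq u \<phi>L] Holder(1)[OF p q pq v \<phi>L] by (simp add: inner_diff_left)
    ultimately have 1: "p * (\<integral>x. u x \<bullet> \<phi> x \<partial>lebesgue_on D) - \<epsilon> / 2 \<le> p * (\<integral>x. v x \<bullet> \<phi> x \<partial>lebesgue_on D)"
      by (simp only: right_diff_distrib)
    have "(\<integral>x. p * (v x \<bullet> \<phi> x) - (p - 1) * norm (\<phi> x) powr q \<partial>lebesgue_on D) \<le> (\<integral>x. norm (v x) powr p \<partial>lebesgue_on D)"
    proof (rule integral_mono)
      show "p * (v x \<bullet> \<phi> x) - (p - 1) * norm (\<phi> x) powr q \<le> norm (v x) powr p" for x
      proof -
        have "v x \<bullet> \<phi> x \<le> norm (v x) * norm (\<phi> x)" by (rule norm_cauchy_schwarz)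
        also have "\<dots> \<le> norm (v x) powr p / p + norm (\<phi> x) powr q / q"
          by (rule Youngs_inequality[OF p q pq]) auto
        finally have "p * (v x \<bullet> \<phi> x) \<le> p * (norm (v x) powr p / p + norm (\<phi> x) powr q / q)"
          using p0 by (intro mult_left_mono) auto
        also have "\<dots> = norm (v x) powr p + (p / q) * norm (\<phi> x) powr q" using p0 by (simp add: algebra_simps)
        finally show ?thesis by (simp add: pq2)
      qed
    qed (use Holder(1)[OF p q pq v \<phi>L] Lp_integrable[OF \<phi>L] Lp_integrable[OF v] in auto)
    then have "p * (\<integral>x. v x \<bullet> \<phi> x \<partial>lebesgue_on D) - (p - 1) * (\<integral>x. norm (\<phi> x) powr q \<partial>lebesgue_on D) \<le> (\<integral>x. norm (v x) powr p \<partial>lebesgue_on D)"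
      using Holder(1)[OF p q pq v \<phi>L] Lp_integrable[OF \<phi>L] by simp
    then show "(\<integral>x. norm (u x) powr p \<partial>lebesgue_on D) - \<epsilon> \<le> (\<integral>x. norm (v x) powr p \<partial>lebesgue_on D)"
      using 1 n lower unfolding I_def by linarith
  qed
qed

section \<open>Balls and a countable base of the topology\<close>

definition A_ball :: "('n::finite \<Rightarrow> real^'d^'l) \<Rightarrow> (real^'n) set \<Rightarrow> (real^'n \<Rightarrow> real^'d) \<Rightarrow> real \<Rightarrow> (real^'n \<Rightarrow> real^'d) set" where
  "A_ball A D u r = {v \<in> Lp p D. A_norm A q D (\<lambda>x. v x - u x) < r}"

lemma A_norm_minus:
  fixes A :: "'n::finite \<Rightarrow> real^'d^'l"
  shows "A_norm A q D (\<lambda>x. u x - v x) = A_norm A q D (\<lambda>x. v x - u x)"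
proof -
  have "of_Lp D (\<lambda>x. u x - v x) \<psi> = - of_Lp D (\<lambda>x. v x - u x) \<psi>" for \<psi>
    unfolding of_Lp_def by (subst Bochner_Integration.integral_minus[symmetric]) (simp add: inner_diff_left)
  moreover have "A_op A D (\<lambda>x. u x - v x) \<psi> = - A_op A D (\<lambda>x. v x - u x) \<psi>" for \<psi>
  proof -
    have "(A i *v (u x - v x)) \<bullet> c = - ((A i *v (v x - u x)) \<bullet> c)" for i x c
      by (simp add: matrix_vector_mult_diff_distrib inner_diff_left)
    then show ?thesis by (simp add: A_op_def sum_negf)
  qed
  ultimately show ?thesis by (simp add: A_norm_def dual_norm_def)
qed

lemma openin_A_ball:
  assumes D: "D \<in> bounded_opens" and u: "u \<in> Lp p D"
  shows "openin (A_topology A p q D) (A_ball A D u r)"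
  unfolding openin_A_topology
proof (intro conjI ballI)
  show "A_ball A D u r \<subseteq> Lp p D" by (auto simp: A_ball_def)
  fix v assume v: "v \<in> A_ball A D u r"
  show "\<exists>\<epsilon>>0. \<forall>w\<in>Lp p D. A_norm A q D (\<lambda>x. w x - v x) < \<epsilon> \<longrightarrow> w \<in> A_ball A D u r"
  proof (intro exI conjI ballI impI)
    show "0 < r - A_norm A q D (\<lambda>x. v x - u x)" using v by (simp add: A_ball_def)
    fix w assume w: "w \<in> Lp p D" "A_norm A q D (\<lambda>x. w x - v x) < r - A_norm A q D (\<lambda>x. v x - u x)"
    then show "w \<in> A_ball A D u r"
      using A_norm_triangle_diff[OF D w(1) _ u, of v A] v by (simp add: A_ball_def)
  qed
qed

lemma centre_in_A_ball:
  assumes "D \<in> bounded_opens" "u \<in> Lp p D" "0 < r"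
  shows "u \<in> A_ball A D u r"
  using A_norm_zero[OF assms(1) Lp_zero, of A] assms by (simp add: A_ball_def)

lemma openin_A_topology_ball:
  assumes "openin (A_topology A p q D) U" "u \<in> U"
  obtains r where "0 < r" "A_ball A D u r \<subseteq> U"
proof -
  obtain r where "0 < r" "\<forall>v\<in>Lp p D. A_norm A q D (\<lambda>x. v x - u x) < r \<longrightarrow> v \<in> U"
    using assms unfolding openin_A_topology by blast
  then show ?thesis by (intro that[of r]) (auto simp: A_ball_def)
qed

text \<open>Balls of radius \<open>1/(n + 1)\<close> about a countable \<open>L^p\<close>-dense set.
  A countable base is what allows a single subsequence to serve all functions on a domain at
  once.\<close>

lemma A_topology_countable_base:
  fixes A :: "'n::finite \<Rightarrow> real^'d^'l"
  assumes D: "D \<in> bounded_opens"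
  obtains \<B> where "countable \<B>" "\<And>B. B \<in> \<B> \<Longrightarrow> openin (A_topology A p q D) B"
    "\<And>U u. openin (A_topology A p q D) U \<Longrightarrow> u \<in> U \<Longrightarrow> \<exists>B\<in>\<B>. u \<in> B \<and> B \<subseteq> U"
proof -
  obtain S :: "(real^'n \<Rightarrow> real^'d) set" where S: "countable S" "S \<subseteq> Lp p D"
    "\<And>u \<epsilon>. u \<in> Lp p D \<Longrightarrow> 0 < \<epsilon> \<Longrightarrow> \<exists>s\<in>S. Lp_norm p D (\<lambda>x. u x - s x) < \<epsilon>"
    by (rule Lp_separable[OF p D]) (rule that)
  obtain C where C: "0 \<le> C" "\<And>u :: real^'n \<Rightarrow> real^'d. u \<in> Lp p D \<Longrightarrow> A_norm A q D u \<le> C * Lp_norm p D u"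
    by (rule A_norm_le_Lp_norm[OF D]) (rule that)
  define \<B> where "\<B> = (\<lambda>(s, n). A_ball A D s (inverse (real (Suc n)))) ` (S \<times> UNIV)"
  show ?thesis
  proof
    show "countable \<B>" unfolding \<B>_def using S(1) by (intro countable_image countable_SIGMA) auto
    show "openin (A_topology A p q D) B" if "B \<in> \<B>" for B
      using that openin_A_ball[OF D] S(2) unfolding \<B>_def by auto
    fix U u assume U: "openin (A_topology A p q D) U" "u \<in> U"
    obtain r where r: "0 < r" "A_ball A D u r \<subseteq> U" using openin_A_topology_ball[OF U] by blast
    have u: "u \<in> Lp p D" using U openin_subset by (fastforce simp: topspace_A_topology)
    \<comment> \<open>A centre \<open>s\<close> within \<open>1/(n + 1)\<close> of \<open>u\<close>
      gives a ball that contains \<open>u\<close> and, by the triangle inequality, lies in the ball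
      of radius \<open>r\<close> about \<open>u\<close>.\<close>
    obtain n where n: "inverse (real (Suc n)) < r / 2" using reals_Archimedean[of "r / 2"] r by auto
    have "0 < inverse (real (Suc n)) / (C + 1)" using C(1) by simp
    then obtain s where s: "s \<in> S" "Lp_norm p D (\<lambda>x. u x - s x) < inverse (real (Suc n)) / (C + 1)"
      using S(3)[OF u] by blast
    have sL: "s \<in> Lp p D" using s S(2) by blast
    have "A_norm A q D (\<lambda>x. u x - s x) \<le> C * Lp_norm p D (\<lambda>x. u x - s x)" by (rule C(2)[OF Lp_diff[OF p0 u sL]])
    also have "\<dots> \<le> (C + 1) * Lp_norm p D (\<lambda>x. u x - s x)" by (intro mult_right_mono) (auto simp: Lp_norm_nonneg)
    also have "\<dots> < inverse (real (Suc n))" using s(2) C(1) by (simp add: pos_less_divide_eq mult.commute del: of_nat_Suc)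
    finally have us: "A_norm A q D (\<lambda>x. u x - s x) < inverse (real (Suc n))" .
    have "A_ball A D s (inverse (real (Suc n))) \<subseteq> A_ball A D u r"
    proof
      fix v assume "v \<in> A_ball A D s (inverse (real (Suc n)))"
      then have v: "v \<in> Lp p D" "A_norm A q D (\<lambda>x. v x - s x) < inverse (real (Suc n))" by (auto simp: A_ball_def)
      then show "v \<in> A_ball A D u r"
        using A_norm_triangle_diff[OF D v(1) sL u, of A] us n A_norm_minus[of A D s u] by (simp add: A_ball_def)
    qed
    then show "\<exists>B\<in>\<B>. u \<in> B \<and> B \<subseteq> U"
      using r(2) us u s(1) unfolding \<B>_def
      by (intro bexI[of _ "A_ball A D s (inverse (real (Suc n)))"]) (auto simp: A_ball_def)
  qed
qed

section \<open>Gamma-limits in terms of balls\<close>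

lemma Gamma_limsup_lessD:
  assumes "D \<in> bounded_opens" "u \<in> Lp p D" "Gamma_limsup (A_topology A p q D) f u < c" "0 < r"
  shows "\<forall>\<^sub>F k in sequentially. \<exists>v\<in>A_ball A D u r. f k v < c"
proof -
  have "limsup (\<lambda>k. INF v\<in>A_ball A D u r. f k v) \<le> Gamma_limsup (A_topology A p q D) f u"
    unfolding Gamma_limsup_def
    by (rule SUP_upper) (simp add: openin_A_ball[OF assms(1,2)] centre_in_A_ball[OF assms(1,2,4)])
  then have "limsup (\<lambda>k. INF v\<in>A_ball A D u r. f k v) < c" using assms(3) by simp
  from Limsup_lessD[OF this] show ?thesis by (simp add: INF_less_iff)
qed

lemma Gamma_limsup_leI:
  assumes "\<And>r. 0 < r \<Longrightarrow> \<forall>\<^sub>F k in sequentially. \<exists>v\<in>A_ball A D u r. f k v \<le> c"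
  shows "Gamma_limsup (A_topology A p q D) f u \<le> c"
  unfolding Gamma_limsup_def
proof (rule SUP_least)
  fix U assume "U \<in> {U. openin (A_topology A p q D) U \<and> u \<in> U}"
  then obtain r where r: "0 < r" "A_ball A D u r \<subseteq> U" using openin_A_topology_ball by blast
  show "limsup (\<lambda>k. INF v\<in>U. f k v) \<le> c"
  proof (rule Limsup_bounded, rule eventually_mono[OF assms[OF r(1)]])
    fix k assume "\<exists>v\<in>A_ball A D u r. f k v \<le> c"
    then obtain v where "v \<in> U" "f k v \<le> c" using r(2) by blast
    then show "(INF v\<in>U. f k v) \<le> c" by (intro INF_lower2[of v])
  qed
qed

lemma less_Gamma_liminfD:
  assumes "c < Gamma_liminf (A_topology A p q D) f u"
  obtains r where "0 < r" "\<forall>\<^sub>F k in sequentially. \<forall>v\<in>A_ball A D u r. c < f k v"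
proof -
  obtain U where U: "openin (A_topology A p q D) U" "u \<in> U" "c < liminf (\<lambda>k. INF v\<in>U. f k v)"
    using assms unfolding Gamma_liminf_def less_SUP_iff by blast
  obtain r where r: "0 < r" "A_ball A D u r \<subseteq> U" using openin_A_topology_ball[OF U(1,2)] by blast
  have "\<forall>\<^sub>F k in sequentially. \<forall>v\<in>A_ball A D u r. c < f k v"
    by (rule eventually_mono[OF less_LiminfD[OF U(3)]]) (use r(2) in \<open>auto intro: less_le_trans INF_lower\<close>)
  then show ?thesis using that r(1) by blast
qed

lemma Gamma_liminf_geI:
  assumes "D \<in> bounded_opens" "u \<in> Lp p D" "0 < r" "\<forall>\<^sub>F k in sequentially. \<forall>v\<in>A_ball A D u r. c \<le> f k v"
  shows "c \<le> Gamma_liminf (A_topology A p q D) f u"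
  unfolding Gamma_liminf_def
proof (rule SUP_upper2)
  show "A_ball A D u r \<in> {U. openin (A_topology A p q D) U \<and> u \<in> U}"
    by (simp add: openin_A_ball[OF assms(1,2)] centre_in_A_ball[OF assms(1,2,3)])
  show "c \<le> liminf (\<lambda>k. INF v\<in>A_ball A D u r. f k v)"
    by (rule Liminf_bounded, rule eventually_mono[OF assms(4)]) (auto intro: INF_greatest)
qed

end

lemma Gamma_liminf_le_limsup: "Gamma_liminf T f u \<le> Gamma_limsup T f u"
  unfolding Gamma_liminf_def Gamma_limsup_def by (intro SUP_mono' Liminf_le_Limsup) simp

text \<open>An open set witnessing \<open>c < Gamma_liminf T f u\<close> is a neighbourhood of each
  of its points, so it witnesses the inequality at all of them. This is lower semicontinuity of the
  limit, whatever the sequence.\<close>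

lemma openin_less_Gamma_liminf: "openin T {u \<in> topspace T. c < Gamma_liminf T f u}"
proof (subst openin_subopen, intro ballI)
  fix u assume "u \<in> {u \<in> topspace T. c < Gamma_liminf T f u}"
  then obtain U where U: "openin T U" "u \<in> U" "c < liminf (\<lambda>k. INF v\<in>U. f k v)"
    unfolding Gamma_liminf_def by (auto simp: less_SUP_iff)
  have "c < Gamma_liminf T f v" if "v \<in> U" for v
    unfolding Gamma_liminf_def using U that by (intro less_le_trans[OF U(3)] SUP_upper) auto
  then show "\<exists>U. openin T U \<and> u \<in> U \<and> U \<subseteq> {u \<in> topspace T. c < Gamma_liminf T f u}"
    using U(1,2) openin_subset by blast
qed

text \<open>Every neighbourhood contains a base set about the point, and on base sets the lower and
  upper limits of the infima coincide.\<close>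

lemma Gamma_liminf_eq_limsup:
  assumes "\<And>B. B \<in> \<B> \<Longrightarrow> openin T B" "\<And>U. openin T U \<Longrightarrow> u \<in> U \<Longrightarrow> \<exists>B\<in>\<B>. u \<in> B \<and> B \<subseteq> U"
    and "\<And>B. B \<in> \<B> \<Longrightarrow> convergent (\<lambda>k. INF v\<in>B. f k v)"
  shows "Gamma_liminf T f u = Gamma_limsup T f u"
proof (rule antisym[OF Gamma_liminf_le_limsup])
  show "Gamma_limsup T f u \<le> Gamma_liminf T f u"
    unfolding Gamma_limsup_def
  proof (rule SUP_least)
    fix U assume "U \<in> {U. openin T U \<and> u \<in> U}"
    then obtain B where B: "B \<in> \<B>" "u \<in> B" "B \<subseteq> U" using assms(2) by blast
    have "limsup (\<lambda>k. INF v\<in>U. f k v) \<le> limsup (\<lambda>k. INF v\<in>B. f k v)"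
      by (intro Limsup_mono always_eventually allI INF_superset_mono B) auto
    also have "\<dots> = liminf (\<lambda>k. INF v\<in>B. f k v)"
      using convergent_limsup_cl[OF assms(3)[OF B(1)]] convergent_liminf_cl[OF assms(3)[OF B(1)]] by simp
    also have "\<dots> \<le> Gamma_liminf T f u"
      unfolding Gamma_liminf_def using B(2) assms(1)[OF B(1)] by (intro SUP_upper) auto
    finally show "limsup (\<lambda>k. INF v\<in>U. f k v) \<le> Gamma_liminf T f u" .
  qed
qed

text \<open>The extended reals are compact, so each sequence has a convergent subsequence without
  any bound; a diagonal sequence settles all indices.\<close>

lemma countable_diagonal_convergent:
  fixes x :: "'i \<Rightarrow> nat \<Rightarrow> ereal"
  assumes "countable I"
  obtains s :: "nat \<Rightarrow> nat" where "strict_mono s" "\<And>i. i \<in> I \<Longrightarrow> convergent (\<lambda>k. x i (s k))"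
proof (cases "I = {}")
  case True
  then show ?thesis using that[of id] by (auto simp: strict_mono_def)
next
  case False
  interpret subseqs "\<lambda>n s. convergent (\<lambda>k. x (from_nat_into I n) (s k))"
  proof
    fix n and s :: "nat \<Rightarrow> nat"
    obtain l r where "strict_mono r" "((\<lambda>k. x (from_nat_into I n) (s k)) \<circ> r) \<longlonglongrightarrow> l"
      using compact_complete_linorder by blast
    then show "\<exists>r. strict_mono r \<and> convergent (\<lambda>k. x (from_nat_into I n) ((s \<circ> r) k))"
      by (auto simp: convergent_def o_def)
  qed
  show ?thesis
  proof (rule that[OF subseq_diagseq])
    fix i assume "i \<in> I"
    then obtain n where n: "i = from_nat_into I n" using from_nat_into_surj[OF assms] by metis
    \<comment> \<open>From position \<open>Suc n\<close> on, the diagonal sequence is a subsequence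
      of one along which index \<open>n\<close> converges; the shift does not affect
      convergence.\<close>
    have "convergent (\<lambda>k. x (from_nat_into I n) ((diagseq \<circ> ((+) (Suc n))) k))"
    proof (rule diagseq_holds)
      fix r s :: "nat \<Rightarrow> nat" and n assume "strict_mono r" "convergent (\<lambda>k. x (from_nat_into I n) (s k))"
      then show "convergent (\<lambda>k. x (from_nat_into I n) ((s \<circ> r) k))"
        using LIMSEQ_subseq_LIMSEQ[of "\<lambda>k. x (from_nat_into I n) (s k)" _ r] unfolding convergent_def o_def by blast
    qed
    then have "convergent (\<lambda>k. x i (diagseq (k + Suc n)))" by (simp add: n add.commute)
    then show "convergent (\<lambda>k. x i (diagseq k))"
      using LIMSEQ_offset[of "\<lambda>k. x i (diagseq k)" "Suc n"] unfolding convergent_def by blast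
  qed
qed

section \<open>The fundamental estimate\<close>

lemma bounded_opens_Un: "D \<in> bounded_opens \<Longrightarrow> B \<in> bounded_opens \<Longrightarrow> D \<union> B \<in> bounded_opens"
  unfolding bounded_opens_def by auto

lemma Lp_UNIV_subset: "u \<in> Lp p UNIV \<Longrightarrow> D \<in> sets lebesgue \<Longrightarrow> u \<in> Lp p D"
  by (rule Lp_subset(1)[of D UNIV]) auto

text \<open>Functions given on different domains are combined on the whole space; extension by 0
  brings them there.\<close>

lemma Lp_extend:
  assumes "u \<in> Lp p D" "D \<in> sets lebesgue"
  shows "(\<lambda>x. if x \<in> D then u x else 0) \<in> Lp p UNIV"
proof -
  have "(\<lambda>x. if x \<in> D then u x else 0) \<in> borel_measurable lebesgue"
    using Lp_measurable[OF assms(1)] assms(2) by (simp add: borel_measurable_if)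
  moreover have "(\<lambda>x. norm (if x \<in> D then u x else 0) powr p) = (\<lambda>x. indicator D x *\<^sub>R (norm (u x) powr p))"
    by (auto simp: indicator_def)
  ultimately show ?thesis
    using Lp_integrable[OF assms(1)] assms(2) by (simp add: Lp_def lebesgue_on_UNIV_eq integrable_restrict_space)
qed

section \<open>Functionals of class I: bounds, locality and additivity\<close>

lemmas class_ID = class_I_def[THEN eq_refl, THEN subsetD, unfolded mem_Collect_eq, THEN bspec, THEN bspec]

lemma class_I_cong_AE:
  assumes "F \<in> class_I p c0" "D \<in> bounded_opens" "u \<in> Lp p D" "v \<in> Lp p D" "AE x in lebesgue_on D. u x = v x"
  shows "F u D = F v D"
  using class_ID[OF assms(1-3)] assms(4,5) by simp

lemma class_I_cong:
  assumes "F \<in> class_I p c0" "D \<in> bounded_opens" "u \<in> Lp p D" "\<And>x. x \<in> D \<Longrightarrow> u x = v x"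
  shows "F u D = F v D"
  using assms by (intro class_I_cong_AE[OF assms(1-3) Lp_cong[OF assms(4,3)]]) auto

lemma class_I_nonneg: "F \<in> class_I p c0 \<Longrightarrow> D \<in> bounded_opens \<Longrightarrow> u \<in> Lp p D \<Longrightarrow> 0 \<le> F u D"
  using class_ID by blast

lemma class_I_lower:
  assumes "F \<in> class_I p c0" "D \<in> bounded_opens" "u \<in> Lp p D" "0 < p"
  shows "(1 / c0) * (\<integral>x. norm (u x) powr p \<partial>lebesgue_on D) - c0 * measure lebesgue D \<le> F u D"
  using class_ID[OF assms(1-3)] unfolding Lp_norm_powr[OF assms(4)] by simp

lemma class_I_upper:
  assumes "F \<in> class_I p c0" "D \<in> bounded_opens" "u \<in> Lp p D" "0 < p"
  shows "F u D \<le> c0 * (measure lebesgue D + (\<integral>x. norm (u x) powr p \<partial>lebesgue_on D))"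
  using class_ID[OF assms(1-3)] unfolding Lp_norm_powr[OF assms(4)] by simp

text \<open>Monotonicity, subadditivity and additivity below consult the measure on open sets only,
  where its values are prescribed. As \<open>ennreal\<close> sends negative reals to 0,
  nonnegativity is invoked on each return to the reals.\<close>

lemma class_I_measure:
  assumes "F \<in> class_I p c0" "D \<in> bounded_opens" "u \<in> Lp p D"
  obtains \<mu> where "\<And>B. open B \<Longrightarrow> B \<subseteq> D \<Longrightarrow> B \<in> sets \<mu> \<and> emeasure \<mu> B = ennreal (F u B)"
proof -
  obtain \<mu> where \<mu>: "sets \<mu> = sets (restrict_space borel D)" "\<And>B. open B \<Longrightarrow> B \<subseteq> D \<Longrightarrow> emeasure \<mu> B = ennreal (F u B)"
    using class_ID[OF assms] by blast
  have "B \<in> sets \<mu>" if "open B" "B \<subseteq> D" for B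
    using that assms(2) by (auto simp: \<mu>(1) sets_restrict_space_iff bounded_opens_def)
  then show ?thesis using that \<mu>(2) by blast
qed

lemma class_I_mono:
  assumes "F \<in> class_I p c0" "D \<in> bounded_opens" "u \<in> Lp p D" "open B" "B \<subseteq> D"
  shows "F u B \<le> F u D"
proof -
  obtain \<mu> where \<mu>: "\<And>B. open B \<Longrightarrow> B \<subseteq> D \<Longrightarrow> B \<in> sets \<mu> \<and> emeasure \<mu> B = ennreal (F u B)"
    using class_I_measure[OF assms(1-3)] by blast
  have "open D" using assms(2) by (simp add: bounded_opens_def)
  then have "ennreal (F u B) \<le> ennreal (F u D)"
    using \<mu>[OF assms(4,5)] \<mu>[of D] emeasure_mono[OF assms(5), of \<mu>] by simp
  then show ?thesis using class_I_nonneg[OF assms(1-3)] by (simp add: ennreal_le_iff)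
qed

lemma class_I_subadditive:
  assumes "F \<in> class_I p c0" "D \<in> bounded_opens" "u \<in> Lp p D" "open E1" "open E2" "D = E1 \<union> E2"
  shows "F u D \<le> F u E1 + F u E2"
proof -
  obtain \<mu> where \<mu>: "\<And>B. open B \<Longrightarrow> B \<subseteq> D \<Longrightarrow> B \<in> sets \<mu> \<and> emeasure \<mu> B = ennreal (F u B)"
    using class_I_measure[OF assms(1-3)] by blast
  have E: "E1 \<in> bounded_opens" "E2 \<in> bounded_opens"
    using bounded_opens_subset[OF assms(2,4)] bounded_opens_subset[OF assms(2,5)] assms(6) by auto
  have nn: "0 \<le> F u E1" "0 \<le> F u E2"
    using class_I_nonneg[OF assms(1) E(1) Lp_subset(1)[OF _ bounded_opens_sets[OF assms(2)] bounded_opens_sets[OF E(1)] assms(3)]]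
      class_I_nonneg[OF assms(1) E(2) Lp_subset(1)[OF _ bounded_opens_sets[OF assms(2)] bounded_opens_sets[OF E(2)] assms(3)]]
      assms(6) by auto
  have "open D" using assms(2) by (simp add: bounded_opens_def)
  then have "ennreal (F u D) \<le> ennreal (F u E1) + ennreal (F u E2)"
    using \<mu>[OF assms(4)] \<mu>[OF assms(5)] \<mu>[of D] assms(6) emeasure_subadditive[of E1 \<mu> E2] by simp
  then show ?thesis using nn by (simp add: ennreal_plus[symmetric] ennreal_le_iff del: ennreal_plus)
qed

lemma class_I_additive:
  assumes "F \<in> class_I p c0" "D \<in> bounded_opens" "u \<in> Lp p D" "open E1" "open E2" "D = E1 \<union> E2" "E1 \<inter> E2 = {}"
  shows "F u D = F u E1 + F u E2"
proof -
  obtain \<mu> where \<mu>: "\<And>B. open B \<Longrightarrow> B \<subseteq> D \<Longrightarrow> B \<in> sets \<mu> \<and> emeasure \<mu> B = ennreal (F u B)"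
    using class_I_measure[OF assms(1-3)] by blast
  have E: "E1 \<in> bounded_opens" "E2 \<in> bounded_opens"
    using bounded_opens_subset[OF assms(2,4)] bounded_opens_subset[OF assms(2,5)] assms(6) by auto
  have nn: "0 \<le> F u E1" "0 \<le> F u E2"
    using class_I_nonneg[OF assms(1) E(1) Lp_subset(1)[OF _ bounded_opens_sets[OF assms(2)] bounded_opens_sets[OF E(1)] assms(3)]]
      class_I_nonneg[OF assms(1) E(2) Lp_subset(1)[OF _ bounded_opens_sets[OF assms(2)] bounded_opens_sets[OF E(2)] assms(3)]]
      assms(6) by auto
  have "open D" using assms(2) by (simp add: bounded_opens_def)
  then have "ennreal (F u D) = ennreal (F u E1) + ennreal (F u E2)"
    using \<mu>[OF assms(4)] \<mu>[OF assms(5)] \<mu>[of D] assms(6,7) plus_emeasure[of E1 \<mu> E2] by simp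
  then show ?thesis using nn class_I_nonneg[OF assms(1-3)]
    by (simp add: ennreal_plus[symmetric] del: ennreal_plus)
qed

text \<open>Equals 0 where \<open>M \<phi> \<le> i + 1/3\<close> and 1 where
  \<open>M \<phi> \<ge> i + 2/3\<close>.\<close>

definition layer_cutoff :: "nat \<Rightarrow> nat \<Rightarrow> (real^'n \<Rightarrow> real) \<Rightarrow> real^'n \<Rightarrow> real" where
  "layer_cutoff M i \<phi> x = smooth_step (real M * \<phi> x - real i)"

lemma layer_cutoff_C_infinity: "\<phi> \<in> C_infinity \<Longrightarrow> layer_cutoff M i \<phi> \<in> C_infinity"
  unfolding layer_cutoff_def[abs_def]
  by (intro C_infinity_smooth_step C_infinity_diff C_infinity_mult C_infinity_const)

lemma layer_cutoff_test_functions: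
  assumes "\<phi> \<in> test_functions D"
  shows "layer_cutoff M i \<phi> \<in> test_functions D"
proof -
  obtain K where K: "compact K" "K \<subseteq> D" "\<And>x. x \<notin> K \<Longrightarrow> \<phi> x = 0"
    using test_functionsE[OF assms] by blast
  show ?thesis
    by (rule test_functionsI[OF layer_cutoff_C_infinity[OF test_functions_C_infinity[OF assms]] K(1,2)])
       (simp add: layer_cutoff_def K(3) smooth_step_0)
qed

lemma layer_cutoff_bounds: "0 \<le> layer_cutoff M i \<phi> x" "layer_cutoff M i \<phi> x \<le> 1"
  by (simp_all add: layer_cutoff_def smooth_step_bounds)

text \<open>A convex combination is no longer than the longer of its two vectors; passing through
  the maximum gives the constant 1.\<close>

lemma norm_convex_combination_powr:
  fixes a b :: "'a::real_normed_vector"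
  assumes "0 \<le> t" "t \<le> 1" "0 < p"
  shows "norm (t *\<^sub>R a + (1 - t) *\<^sub>R b) powr p \<le> norm a powr p + norm b powr p"
proof -
  have "norm (t *\<^sub>R a + (1 - t) *\<^sub>R b) \<le> t * norm a + (1 - t) * norm b"
    using norm_triangle_ineq[of "t *\<^sub>R a" "(1 - t) *\<^sub>R b"] assms by simp
  also have "\<dots> \<le> max (norm a) (norm b)"
    using assms by (intro convex_bound_le) auto
  finally have "norm (t *\<^sub>R a + (1 - t) *\<^sub>R b) powr p \<le> max (norm a) (norm b) powr p"
    using assms by (intro powr_mono2) auto
  also have "\<dots> \<le> norm a powr p + norm b powr p" by (simp add: max_def)
  finally show ?thesis .
qed

lemma layer_combination_Lp:
  fixes v1 v2 :: "real^'n \<Rightarrow> real^'d"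
  assumes "0 < p" "\<phi> \<in> C_infinity" "v1 \<in> Lp p UNIV" "v2 \<in> Lp p UNIV"
  shows "(\<lambda>x. layer_cutoff M i \<phi> x *\<^sub>R v1 x + (1 - layer_cutoff M i \<phi> x) *\<^sub>R v2 x) \<in> Lp p UNIV"
proof -
  let ?w = "\<lambda>x. layer_cutoff M i \<phi> x *\<^sub>R v1 x + (1 - layer_cutoff M i \<phi> x) *\<^sub>R v2 x"
  have m: "?w \<in> borel_measurable (lebesgue_on UNIV)"
    using C_infinity_measurable[OF layer_cutoff_C_infinity[OF assms(2)], of M i UNIV] Lp_measurable[OF assms(3)] Lp_measurable[OF assms(4)]
    by (intro borel_measurable_add borel_measurable_scaleR borel_measurable_diff) auto
  have "integrable (lebesgue_on UNIV) (\<lambda>x. norm (?w x) powr p)"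
  proof (rule Bochner_Integration.integrable_bound)
    show "integrable (lebesgue_on UNIV) (\<lambda>x. norm (v1 x) powr p + norm (v2 x) powr p)"
      using Lp_integrable[OF assms(3)] Lp_integrable[OF assms(4)] by simp
    show "AE x in lebesgue_on UNIV. norm (norm (?w x) powr p) \<le> norm (norm (v1 x) powr p + norm (v2 x) powr p)"
      by (intro AE_I2) (simp add: norm_convex_combination_powr[OF layer_cutoff_bounds assms(1)])
  qed (use m in auto)
  then show ?thesis using m by (simp add: Lp_def)
qed

lemma integral_one_plus_powers:
  fixes v1 v2 :: "real^'n \<Rightarrow> 'b::euclidean_space"
  assumes E: "E \<in> bounded_opens" and v: "v1 \<in> Lp p UNIV" "v2 \<in> Lp p UNIV"
  shows "integrable lebesgue (\<lambda>x. indicator E x *\<^sub>R (1 + norm (v1 x) powr p + norm (v2 x) powr p))"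
    "(\<integral>x. indicator E x *\<^sub>R (1 + norm (v1 x) powr p + norm (v2 x) powr p) \<partial>lebesgue)
      = measure lebesgue E + (\<integral>x. norm (v1 x) powr p \<partial>lebesgue_on E) + (\<integral>x. norm (v2 x) powr p \<partial>lebesgue_on E)"
proof -
  note Es = bounded_opens_sets[OF E]
  have "emeasure lebesgue E < \<infinity>" using bounded_opens_lmeasurable[OF E] unfolding fmeasurable_def by blast
  then have 1: "integrable lebesgue (\<lambda>x. indicator E x :: real)" using Es by (intro integrable_real_indicator)
  have 2: "integrable lebesgue (\<lambda>x. indicator E x *\<^sub>R norm (v1 x) powr p)" "integrable lebesgue (\<lambda>x. indicator E x *\<^sub>R norm (v2 x) powr p)"
    using Lp_integrable[OF Lp_UNIV_subset[OF v(1) Es]] Lp_integrable[OF Lp_UNIV_subset[OF v(2) Es]] Es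
    by (simp_all add: integrable_restrict_space)
  have eq: "(\<lambda>x. indicator E x *\<^sub>R (1 + norm (v1 x) powr p + norm (v2 x) powr p)) =
    (\<lambda>x. indicator E x + indicator E x *\<^sub>R norm (v1 x) powr p + indicator E x *\<^sub>R norm (v2 x) powr p)"
    by (simp add: algebra_simps)
  show "integrable lebesgue (\<lambda>x. indicator E x *\<^sub>R (1 + norm (v1 x) powr p + norm (v2 x) powr p))"
    unfolding eq using 1 2 by simp
  show "(\<integral>x. indicator E x *\<^sub>R (1 + norm (v1 x) powr p + norm (v2 x) powr p) \<partial>lebesgue)
    = measure lebesgue E + (\<integral>x. norm (v1 x) powr p \<partial>lebesgue_on E) + (\<integral>x. norm (v2 x) powr p \<partial>lebesgue_on E)"
    unfolding eq using 1 2 Es by (simp add: integral_restrict_space)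
qed

text \<open>The gluing errors live on the disjoint layers \<open>{i < M \<phi> < i + 1}\<close>, so one of the \<open>M\<close> cutoffs has an
  error of at most \<open>1 / M\<close> of the total.\<close>

lemma class_I_join:
  fixes v1 v2 :: "real^'n \<Rightarrow> real^'d" and F :: "('n::finite, 'd::finite) functional"
  assumes p: "0 < p" and c0: "0 \<le> c0" and F: "F \<in> class_I p c0" and D1: "D1 \<in> bounded_opens" and B: "B \<in> bounded_opens"
    and A': "open A'" "A' \<subseteq> D1" and \<phi>: "\<phi> \<in> test_functions D1" "\<And>x. x \<in> A' \<Longrightarrow> \<phi> x = 1"
    and v: "v1 \<in> Lp p UNIV" "v2 \<in> Lp p UNIV" and M: "1 \<le> M"
  obtains i where "i < M" "F (\<lambda>x. layer_cutoff M i \<phi> x *\<^sub>R v1 x + (1 - layer_cutoff M i \<phi> x) *\<^sub>R v2 x) (A' \<union> B)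
      \<le> F v1 D1 + F v2 B + c0 / real M * (measure lebesgue B + (\<integral>x. norm (v1 x) powr p \<partial>lebesgue_on B) + (\<integral>x. norm (v2 x) powr p \<partial>lebesgue_on B))"
proof -
  define w where "w i = (\<lambda>x. layer_cutoff M i \<phi> x *\<^sub>R v1 x + (1 - layer_cutoff M i \<phi> x) *\<^sub>R v2 x)" for i
  have wL: "w i \<in> Lp p UNIV" for i
    unfolding w_def by (rule layer_combination_Lp[OF p test_functions_C_infinity[OF \<phi>(1)] v])
  have oB: "open B" using B by (simp add: bounded_opens_def)
  define t where "t i x = real M * \<phi> x - real i" for i x
  have ct: "continuous_on UNIV (t i)" for i
    unfolding t_def by (intro continuous_intros C_infinity_continuous test_functions_C_infinity[OF \<phi>(1)])
  define T where "T i = {x. 0 < t i x} \<inter> {x. t i x < 1}" for i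
  have oT: "open (T i)" for i unfolding T_def
    by (intro open_Int open_Collect_less continuous_intros ct)
  have Ts: "T i \<in> sets lebesgue" for i by (rule open_sets_lebesgue[OF oT])
  \<comment> \<open>Integrated over a layer and multiplied by \<open>c0\<close>, this bounds the
    energy that the glued function has there.\<close>
  define h where "h x = indicator B x *\<^sub>R (1 + norm (v1 x) powr p + norm (v2 x) powr p)" for x
  note split = integral_one_plus_powers[OF _ v]
  have hi: "integrable lebesgue h" unfolding h_def by (rule split(1)[OF B])
  have h0: "0 \<le> h x" for x by (simp add: h_def)
  define a where "a i = (\<integral>x. indicator (T i) x *\<^sub>R h x \<partial>lebesgue)" for i
  have ai: "integrable lebesgue (\<lambda>x. indicator (T i) x *\<^sub>R h x)" for i
    by (rule integrable_mult_indicator[OF Ts hi])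
  have "(\<Sum>i<M. a i) = (\<integral>x. (\<Sum>i<M. indicator (T i) x *\<^sub>R h x) \<partial>lebesgue)"
    unfolding a_def by (rule Bochner_Integration.integral_sum[symmetric]) (rule ai)
  also have "\<dots> \<le> (\<integral>x. h x \<partial>lebesgue)"
  proof (rule integral_mono)
    show "(\<Sum>i<M. indicator (T i) x *\<^sub>R h x) \<le> h x" for x
    proof (cases "\<exists>j<M. x \<in> T j")
      case True
      then obtain j where j: "j < M" "x \<in> T j" by blast
      have eq: "i = j" if "x \<in> T i" for i using that j(2) by (auto simp: T_def t_def)
      have "(\<Sum>i<M. indicator (T i) x *\<^sub>R h x) = (\<Sum>i<M. if i = j then h x else 0)"
      proof (rule sum.cong[OF refl])
        show "indicator (T i) x *\<^sub>R h x = (if i = j then h x else 0)" for i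
          using eq[of i] j(2) by (cases "x \<in> T i") auto
      qed
      also have "\<dots> = h x" using j(1) by simp
      finally show ?thesis by (rule eq_refl)
    next
      case False
      then show ?thesis using h0[of x] by (simp add: indicator_def)
    qed
  qed (rule Bochner_Integration.integrable_sum ai hi)+
  finally have sum_le: "(\<Sum>i<M. a i) \<le> integral\<^sup>L lebesgue h" by simp
  have "\<exists>i<M. a i \<le> integral\<^sup>L lebesgue h / M"
  proof (rule ccontr)
    assume "\<not> ?thesis"
    then have "(\<Sum>i<M. integral\<^sup>L lebesgue h / M) < (\<Sum>i<M. a i)"
      using M by (intro sum_strict_mono) (auto simp: not_le lessThan_empty_iff)
    then show False using sum_le M by simp
  qed
  then obtain i where i: "i < M" "a i \<le> integral\<^sup>L lebesgue h / M" by blast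
  have D: "A' \<union> B \<in> bounded_opens" by (rule bounded_opens_Un[OF bounded_opens_subset[OF D1 A'] B])
  \<comment> \<open>On \<open>E1\<close> the glued function is \<open>v1\<close>, on
    \<open>E2\<close> it is \<open>v2\<close>, and \<open>E3\<close> carries the transition. All
    three are open, as the measure property gives subadditivity for open sets, and \<open>E3\<close>
    reaches into both plateaus so that no point is missed.\<close>
  define E1 E2 E3 where "E1 = (A' \<union> B) \<inter> {x. 2/3 < t i x}" and "E2 = (A' \<union> B) \<inter> {x. t i x < 1/3}" and "E3 = B \<inter> T i"
  have oE: "open E1" "open E2" "open E3" unfolding E1_def E2_def E3_def using A'(1) oB oT
    by (intro open_Int open_Un open_Collect_less continuous_intros ct; simp)+
  \<comment> \<open>On \<open>A'\<close> one has \<open>\<phi> = 1\<close>, and \<open>i < M\<close>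
    makes \<open>M - i\<close> at least 1. So \<open>A'\<close> lies in the plateau of
    \<open>v1\<close>, and whatever involves \<open>v2\<close> takes place in
    \<open>B\<close>.\<close>
  have tA': "1 \<le> t i x" if "x \<in> A'" for x using \<phi>(2)[OF that] i(1) by (simp add: t_def)
  have cover: "A' \<union> B = (E1 \<union> E3) \<union> E2"
    using tA' unfolding E1_def E2_def E3_def T_def by force
  have sub: "E1 \<subseteq> D1" "E2 \<subseteq> B"
  proof -
    show "E1 \<subseteq> D1"
    proof
      fix x assume x: "x \<in> E1"
      show "x \<in> D1"
        using x test_functions_zero_outside[OF \<phi>(1), of x] by (cases "x \<in> D1") (auto simp: E1_def t_def)
    qed
    show "E2 \<subseteq> B" using tA' by (force simp: E2_def)
  qed
  have bE: "E1 \<in> bounded_opens" "E2 \<in> bounded_opens" "E3 \<in> bounded_opens" "E1 \<union> E3 \<in> bounded_opens"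
    using bounded_opens_subset[OF D] oE cover by blast+
  have L: "w i \<in> Lp p E" "v1 \<in> Lp p E" "v2 \<in> Lp p E" if "E \<in> bounded_opens" for E
    using Lp_UNIV_subset[OF _ bounded_opens_sets[OF that]] wL v by blast+
  have "F (w i) (A' \<union> B) \<le> F (w i) (E1 \<union> E3) + F (w i) E2"
    by (rule class_I_subadditive[OF F D L(1)[OF D] _ oE(2) cover]) (use oE in blast)
  also have "F (w i) (E1 \<union> E3) \<le> F (w i) E1 + F (w i) E3"
    by (rule class_I_subadditive[OF F bE(4) L(1)[OF bE(4)] oE(1,3) refl])
  also have "F (w i) E1 = F v1 E1"
    by (rule class_I_cong[OF F bE(1) L(1)[OF bE(1)]]) (simp add: E1_def w_def layer_cutoff_def t_def smooth_step_1)
  also have "F (w i) E2 = F v2 E2"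
    by (rule class_I_cong[OF F bE(2) L(1)[OF bE(2)]]) (simp add: E2_def w_def layer_cutoff_def t_def smooth_step_0)
  also have "F v1 E1 \<le> F v1 D1" by (rule class_I_mono[OF F D1 L(2)[OF D1] oE(1) sub(1)])
  also have "F v2 E2 \<le> F v2 B" by (rule class_I_mono[OF F B L(3)[OF B] oE(2) sub(2)])
  also have "F (w i) E3 \<le> c0 * a i"
  proof -
    have "F (w i) E3 \<le> c0 * (measure lebesgue E3 + (\<integral>x. norm (w i x) powr p \<partial>lebesgue_on E3))"
      by (rule class_I_upper[OF F bE(3) L(1)[OF bE(3)] p])
    also have "(\<integral>x. norm (w i x) powr p \<partial>lebesgue_on E3) \<le> (\<integral>x. norm (v1 x) powr p + norm (v2 x) powr p \<partial>lebesgue_on E3)"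
      using Lp_integrable[OF L(1)[OF bE(3)]] Lp_integrable[OF L(2)[OF bE(3)]] Lp_integrable[OF L(3)[OF bE(3)]]
      by (intro integral_mono) (auto simp: w_def intro!: norm_convex_combination_powr layer_cutoff_bounds p)
    also have "\<dots> = (\<integral>x. norm (v1 x) powr p \<partial>lebesgue_on E3) + (\<integral>x. norm (v2 x) powr p \<partial>lebesgue_on E3)"
      using Lp_integrable[OF L(2)[OF bE(3)]] Lp_integrable[OF L(3)[OF bE(3)]] by simp
    also have "measure lebesgue E3 + ((\<integral>x. norm (v1 x) powr p \<partial>lebesgue_on E3) + (\<integral>x. norm (v2 x) powr p \<partial>lebesgue_on E3)) = a i"
    proof -
      have "indicator (T i) x *\<^sub>R h x = indicator E3 x *\<^sub>R (1 + norm (v1 x) powr p + norm (v2 x) powr p)" for x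
        by (simp add: h_def E3_def indicator_inter_arith)
      then show ?thesis using split(2)[OF bE(3)] by (simp add: a_def)
    qed
    finally show ?thesis using c0 by (simp add: mult_left_mono)
  qed
  also have "c0 * a i \<le> c0 * (integral\<^sup>L lebesgue h / M)" by (rule mult_left_mono[OF i(2) c0])
  also have "integral\<^sup>L lebesgue h = measure lebesgue B + (\<integral>x. norm (v1 x) powr p \<partial>lebesgue_on B) + (\<integral>x. norm (v2 x) powr p \<partial>lebesgue_on B)"
    using split(2)[OF B] by (simp add: h_def[abs_def])
  finally have "F (w i) (A' \<union> B) \<le> F v1 D1 + F v2 B + c0 / real M * (measure lebesgue B + (\<integral>x. norm (v1 x) powr p \<partial>lebesgue_on B) + (\<integral>x. norm (v2 x) powr p \<partial>lebesgue_on B))"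
    by simp
  then show ?thesis using that[OF i(1)] by (simp add: w_def)
qed

lemma test_function_derivatives_bounded:
  fixes \<zeta> :: "real^'n \<Rightarrow> real"
  assumes t: "\<zeta> \<in> test_functions D"
  obtains b where "0 \<le> b" "\<And>x. \<bar>\<zeta> x\<bar> \<le> b" "\<And>i x. \<bar>partial_deriv i \<zeta> x\<bar> \<le> b"
    "\<And>i j x. \<bar>partial_deriv i (partial_deriv j \<zeta>) x\<bar> \<le> b"
proof -
  have bd: "\<exists>b\<ge>0. \<forall>x. \<bar>f x\<bar> \<le> b" if "f \<in> test_functions D" for f :: "real^'n \<Rightarrow> real"
    using test_functions_bounded[OF that] by (metis real_norm_def)
  obtain b0 where b0: "b0 \<ge> 0" "\<And>x. \<bar>\<zeta> x\<bar> \<le> b0" using bd[OF t] by blast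
  obtain b1 where b1: "\<And>i. b1 i \<ge> 0" "\<And>i x. \<bar>partial_deriv i \<zeta> x\<bar> \<le> b1 i"
    using bd[OF test_functions_partial_deriv[OF t]] by metis
  obtain b2 where b2: "\<And>i j. b2 i j \<ge> 0" "\<And>i j x. \<bar>partial_deriv i (partial_deriv j \<zeta>) x\<bar> \<le> b2 i j"
    using bd[OF test_functions_partial_deriv[OF test_functions_partial_deriv[OF t]]] by metis
  define b where "b = b0 + (\<Sum>i\<in>UNIV. b1 i) + (\<Sum>i\<in>UNIV. \<Sum>j\<in>UNIV. b2 i j)"
  have 1: "b1 i \<le> (\<Sum>i\<in>UNIV. b1 i)" for i by (rule member_le_sum) (auto simp: b1)
  have 2: "b2 i j \<le> (\<Sum>i\<in>UNIV. \<Sum>j\<in>UNIV. b2 i j)" for i j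
  proof -
    have "b2 i j \<le> (\<Sum>j\<in>UNIV. b2 i j)" by (rule member_le_sum) (auto simp: b2)
    also have "\<dots> \<le> (\<Sum>i\<in>UNIV. \<Sum>j\<in>UNIV. b2 i j)" by (rule member_le_sum) (auto simp: b2 intro: sum_nonneg)
    finally show ?thesis .
  qed
  have nn: "0 \<le> (\<Sum>i\<in>UNIV. b1 i)" "0 \<le> (\<Sum>i\<in>UNIV. \<Sum>j\<in>UNIV. b2 i j)" by (auto intro!: sum_nonneg simp: b1 b2)
  show ?thesis
  proof (rule that[of b])
    show "\<bar>\<zeta> x\<bar> \<le> b" for x using b0(2)[of x] nn by (simp add: b_def)
    show "\<bar>partial_deriv i \<zeta> x\<bar> \<le> b" for i x using b1(2)[of i x] 1[of i] b0(1) nn by (simp add: b_def)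
    show "\<bar>partial_deriv i (partial_deriv j \<zeta>) x\<bar> \<le> b" for i j x using b2(2)[of i j x] 2[of i j] b0(1) nn by (simp add: b_def)
  qed (use b0(1) nn in \<open>simp add: b_def\<close>)
qed

context dual_exponents
begin

lemma A_norm_cong:
  assumes "\<And>x. x \<in> D \<Longrightarrow> u x = v x"
  shows "A_norm A q D u = A_norm A q D v"
proof -
  have "of_Lp D u \<psi> = of_Lp D v \<psi>" for \<psi>
    unfolding of_Lp_def by (intro Bochner_Integration.integral_cong) (auto simp: assms)
  moreover have "A_op A D u \<psi> = A_op A D v \<psi>" for \<psi>
    unfolding A_op_def by (intro arg_cong[where f=uminus] sum.cong Bochner_Integration.integral_cong) (auto simp: assms)
  ultimately show ?thesis by (simp add: A_norm_def dual_norm_def)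
qed

text \<open>The difference from \<open>u\<close> is
  \<open>\<zeta> (v1 - u) + (1 - \<zeta>) (v2 - u)\<close>. The first factor vanishes outside
  \<open>D1\<close>, the second one on \<open>A'\<close>, hence off \<open>B\<close> within the
  union, so the cutoff estimate applies to each summand. \<open>C\<close> depends on the cutoff but
  not on the three functions.\<close>

lemma A_norm_layer_combination:
  fixes A :: "'n::finite \<Rightarrow> real^'d^'l"
  assumes D1: "D1 \<in> bounded_opens" and B: "B \<in> bounded_opens" and A': "open A'" "A' \<subseteq> D1"
    and \<phi>: "\<phi> \<in> test_functions D1" "\<And>x. x \<in> A' \<Longrightarrow> \<phi> x = 1" and i: "i < M"
  obtains C where "0 \<le> C" "\<And>v1 v2 u :: real^'n \<Rightarrow> real^'d. v1 \<in> Lp p UNIV \<Longrightarrow> v2 \<in> Lp p UNIV \<Longrightarrow> u \<in> Lp p UNIV \<Longrightarrow>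
     A_norm A q (A' \<union> B) (\<lambda>x. (layer_cutoff M i \<phi> x *\<^sub>R v1 x + (1 - layer_cutoff M i \<phi> x) *\<^sub>R v2 x) - u x)
     \<le> C * (A_norm A q D1 (\<lambda>x. v1 x - u x) + A_norm A q B (\<lambda>x. v2 x - u x))"
proof -
  define \<zeta> where "\<zeta> = layer_cutoff M i \<phi>"
  have D: "A' \<union> B \<in> bounded_opens" by (rule bounded_opens_Un[OF bounded_opens_subset[OF D1 A'] B])
  have \<phi>C: "\<phi> \<in> C_infinity" by (rule test_functions_C_infinity[OF \<phi>(1)])
  have \<zeta>t: "\<zeta> \<in> test_functions D1" unfolding \<zeta>_def by (rule layer_cutoff_test_functions[OF \<phi>(1)])
  have \<zeta>C: "\<zeta> \<in> C_infinity" by (rule test_functions_C_infinity[OF \<zeta>t])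
  define t where "t x = real M * \<phi> x - real i" for x
  have ct: "continuous_on UNIV t"
    unfolding t_def by (intro continuous_intros C_infinity_continuous \<phi>C)
  obtain b where b: "0 \<le> b" "\<And>x. \<bar>\<zeta> x\<bar> \<le> b" "\<And>i x. \<bar>partial_deriv i \<zeta> x\<bar> \<le> b"
    "\<And>i j x. \<bar>partial_deriv i (partial_deriv j \<zeta>) x\<bar> \<le> b"
    using test_function_derivatives_bounded[OF \<zeta>t] by blast
  obtain C1 where C1: "0 \<le> C1" "\<And>w :: real^'n \<Rightarrow> real^'d. w \<in> Lp p D1 \<Longrightarrow> (\<lambda>x. \<zeta> x *\<^sub>R w x) \<in> Lp p (A' \<union> B) \<Longrightarrow>
    A_norm A q (A' \<union> B) (\<lambda>x. \<zeta> x *\<^sub>R w x) \<le> C1 * A_norm A q D1 w"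
  proof (rule A_norm_cutoff[OF D D1 \<zeta>C b(2,3,4), of "{x. 1/3 \<le> t x}" A])
    show "closed {x. 1/3 \<le> t x}" by (intro closed_Collect_le continuous_intros ct)
    show "\<zeta> x = 0" if "x \<notin> {x. 1/3 \<le> t x}" for x
      using that by (simp add: \<zeta>_def layer_cutoff_def t_def smooth_step_0)
    show "{x. 1/3 \<le> t x} \<inter> (A' \<union> B) \<subseteq> D1"
    proof
      fix x assume "x \<in> {x. 1/3 \<le> t x} \<inter> (A' \<union> B)"
      then show "x \<in> D1" using test_functions_zero_outside[OF \<phi>(1), of x] by (cases "x \<in> D1") (auto simp: t_def)
    qed
  qed (rule that)
  have pd1: "partial_deriv i (\<lambda>x. 1 - \<zeta> x) = (\<lambda>x. - partial_deriv i \<zeta> x)" for i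
  proof
    fix x
    have "(\<zeta> has_derivative frechet_derivative \<zeta> (at x)) (at x)"
      using C_infinity_differentiable[OF \<zeta>C] by (simp add: frechet_derivative_works)
    then have "((\<lambda>x. 1 - \<zeta> x) has_derivative (\<lambda>v. 0 - frechet_derivative \<zeta> (at x) v)) (at x)"
      by (intro has_derivative_diff has_derivative_const)
    from partial_deriv_eq[OF this] show "partial_deriv i (\<lambda>x. 1 - \<zeta> x) x = - partial_deriv i \<zeta> x"
      by (simp add: partial_deriv_def)
  qed
  have pd2: "partial_deriv i (partial_deriv j (\<lambda>x. 1 - \<zeta> x)) x = - partial_deriv i (partial_deriv j \<zeta>) x" for i j x
    unfolding pd1 by (rule partial_deriv_linear[OF bounded_linear_minus[OF bounded_linear_ident] C_infinity_differentiable[OF C_infinity_partial_deriv[OF \<zeta>C]]])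
  obtain C2 where C2: "0 \<le> C2" "\<And>w :: real^'n \<Rightarrow> real^'d. w \<in> Lp p B \<Longrightarrow> (\<lambda>x. (1 - \<zeta> x) *\<^sub>R w x) \<in> Lp p (A' \<union> B) \<Longrightarrow>
    A_norm A q (A' \<union> B) (\<lambda>x. (1 - \<zeta> x) *\<^sub>R w x) \<le> C2 * A_norm A q B w"
  \<comment> \<open>The constant \<open>1 + b\<close> bounds both \<open>1 - \<zeta>\<close> and its
    derivatives. The supporting set is unbounded; closedness and its intersection with the domain
    are what count.\<close>
  proof (rule A_norm_cutoff[OF D B C_infinity_diff[OF C_infinity_const[of 1] \<zeta>C], of "1 + b" "{x. t x \<le> 2/3}" A])
    show "closed {x. t x \<le> 2/3}" by (intro closed_Collect_le continuous_intros ct)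
    show "1 - \<zeta> x = 0" if "x \<notin> {x. t x \<le> 2/3}" for x
      using that by (simp add: \<zeta>_def layer_cutoff_def t_def smooth_step_1)
    show "{x. t x \<le> 2/3} \<inter> (A' \<union> B) \<subseteq> B"
    proof
      fix x assume "x \<in> {x. t x \<le> 2/3} \<inter> (A' \<union> B)"
      then show "x \<in> B" using \<phi>(2)[of x] i by (cases "x \<in> A'") (auto simp: t_def)
    qed
    show "\<bar>1 - \<zeta> x\<bar> \<le> 1 + b" for x using b(2)[of x] by linarith
    show "\<bar>partial_deriv i (\<lambda>x. 1 - \<zeta> x) x\<bar> \<le> 1 + b" for i x using b(3)[of i x] by (simp add: pd1)
    show "\<bar>partial_deriv i (partial_deriv j (\<lambda>x. 1 - \<zeta> x)) x\<bar> \<le> 1 + b" for i j x using b(4)[of i j x] by (simp add: pd2)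
  qed (rule that)
  note s = bounded_opens_sets
  show ?thesis
  proof (rule that[of "C1 + C2"])
    show "0 \<le> C1 + C2" using C1(1) C2(1) by simp
    fix v1 v2 u :: "real^'n \<Rightarrow> real^'d"
    assume v1: "v1 \<in> Lp p UNIV" and v2: "v2 \<in> Lp p UNIV" and u: "u \<in> Lp p UNIV"
    let ?a = "\<lambda>x. v1 x - u x" and ?b = "\<lambda>x. v2 x - u x"
    have a: "?a \<in> Lp p UNIV" and b: "?b \<in> Lp p UNIV" using Lp_diff[OF p0] v1 v2 u by blast+
    have za: "(\<lambda>x. \<zeta> x *\<^sub>R ?a x) \<in> Lp p UNIV"
      using layer_combination_Lp[OF p0 \<phi>C a Lp_zero, of M i] by (simp add: \<zeta>_def)
    have zb: "(\<lambda>x. (1 - \<zeta> x) *\<^sub>R ?b x) \<in> Lp p UNIV"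
      using layer_combination_Lp[OF p0 \<phi>C Lp_zero b, of M i] by (simp add: \<zeta>_def)
    have "(\<lambda>x. (layer_cutoff M i \<phi> x *\<^sub>R v1 x + (1 - layer_cutoff M i \<phi> x) *\<^sub>R v2 x) - u x)
        = (\<lambda>x. \<zeta> x *\<^sub>R ?a x + (1 - \<zeta> x) *\<^sub>R ?b x)"
      by (rule ext) (simp add: \<zeta>_def algebra_simps)
    then have "A_norm A q (A' \<union> B) (\<lambda>x. (layer_cutoff M i \<phi> x *\<^sub>R v1 x + (1 - layer_cutoff M i \<phi> x) *\<^sub>R v2 x) - u x)
        \<le> A_norm A q (A' \<union> B) (\<lambda>x. \<zeta> x *\<^sub>R ?a x) + A_norm A q (A' \<union> B) (\<lambda>x. (1 - \<zeta> x) *\<^sub>R ?b x)"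
      using A_norm_triangle[OF D Lp_UNIV_subset[OF za s[OF D]] Lp_UNIV_subset[OF zb s[OF D]], of A] by simp
    also have "\<dots> \<le> C1 * A_norm A q D1 ?a + C2 * A_norm A q B ?b"
      by (intro add_mono C1(2) C2(2) Lp_UNIV_subset[OF a] Lp_UNIV_subset[OF b] Lp_UNIV_subset[OF za] Lp_UNIV_subset[OF zb] s D D1 B)
    also have "\<dots> \<le> (C1 + C2) * (A_norm A q D1 ?a + A_norm A q B ?b)"
      using mult_nonneg_nonneg[OF C1(1) A_norm_nonneg[OF B Lp_UNIV_subset[OF b s[OF B]], of A]]
        mult_nonneg_nonneg[OF C2(1) A_norm_nonneg[OF D1 Lp_UNIV_subset[OF a s[OF D1]], of A]]
      by (simp add: algebra_simps)
    finally show "A_norm A q (A' \<union> B) (\<lambda>x. (layer_cutoff M i \<phi> x *\<^sub>R v1 x + (1 - layer_cutoff M i \<phi> x) *\<^sub>R v2 x) - u x)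
        \<le> (C1 + C2) * (A_norm A q D1 ?a + A_norm A q B ?b)" .
  qed
qed

text \<open>The layer argument gives the energy bound and the cutoff estimate keeps \<open>w\<close>
  near \<open>u\<close>. The radius \<open>\<delta>\<close> may depend on \<open>M\<close>,
  \<open>e\<close>, \<open>u\<close> and the sets but is uniform in the functional, so it serves all
  members of a sequence. The compact set \<open>K\<close> leaves room for a cutoff that is 1 on
  \<open>A'\<close> and supported in \<open>D1\<close>.\<close>

lemma fundamental_estimate:
  fixes A :: "'n::finite \<Rightarrow> real^'d^'l" and u :: "real^'n \<Rightarrow> real^'d" and M :: nat
  assumes c0: "0 \<le> c0" and D1: "D1 \<in> bounded_opens" and B: "B \<in> bounded_opens" and A': "open A'" "A' \<subseteq> K" "compact K" "K \<subseteq> D1"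
    and u: "u \<in> Lp p UNIV" and M: "1 \<le> M" and e: "0 < e"
  obtains \<delta> where "0 < \<delta>" "\<And>F v1 v2. F \<in> class_I p c0 \<Longrightarrow> v1 \<in> A_ball A D1 u \<delta> \<Longrightarrow> v2 \<in> A_ball A B u \<delta> \<Longrightarrow>
     \<exists>w\<in>A_ball A (A' \<union> B) u e. F w (A' \<union> B) \<le> F v1 D1 + F v2 B + c0 / real M * (measure lebesgue B
        + (\<integral>x. norm (v1 x) powr p \<partial>lebesgue_on D1) + (\<integral>x. norm (v2 x) powr p \<partial>lebesgue_on B))"
proof -
  have AD1: "A' \<subseteq> D1" using A' by blast
  have oD1: "open D1" using D1 by (simp add: bounded_opens_def)
  have D: "A' \<union> B \<in> bounded_opens" by (rule bounded_opens_Un[OF bounded_opens_subset[OF D1 A'(1) AD1] B])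
  obtain \<phi> V where \<phi>0: "\<phi> \<in> test_functions D1" "K \<subseteq> V" "\<And>x. x \<in> V \<Longrightarrow> \<phi> x = (1::real)"
    using smooth_Urysohn[OF A'(3) oD1 A'(4)] by metis
  have \<phi>: "\<phi> \<in> test_functions D1" "\<And>x. x \<in> A' \<Longrightarrow> \<phi> x = 1" using \<phi>0 A'(2) by auto
  let ?w = "\<lambda>i v1 v2 x. layer_cutoff M i \<phi> x *\<^sub>R v1 x + (1 - layer_cutoff M i \<phi> x) *\<^sub>R v2 x"
  \<comment> \<open>The guard \<open>i < M\<close> stands inside the existential so that one
    function \<open>C\<close> of all indices can be chosen.\<close>
  have "\<exists>C\<ge>0. i < M \<longrightarrow> (\<forall>v1\<in>Lp p UNIV. \<forall>v2\<in>Lp p UNIV.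
     A_norm A q (A' \<union> B) (\<lambda>x. ?w i v1 v2 x - u x)
     \<le> C * (A_norm A q D1 (\<lambda>x. v1 x - u x) + A_norm A q B (\<lambda>x. v2 x - u x)))" for i
  proof (cases "i < M")
    case True
    obtain C where "0 \<le> C" "\<And>v1 v2 u :: real^'n \<Rightarrow> real^'d. v1 \<in> Lp p UNIV \<Longrightarrow> v2 \<in> Lp p UNIV \<Longrightarrow> u \<in> Lp p UNIV \<Longrightarrow>
     A_norm A q (A' \<union> B) (\<lambda>x. ?w i v1 v2 x - u x)
     \<le> C * (A_norm A q D1 (\<lambda>x. v1 x - u x) + A_norm A q B (\<lambda>x. v2 x - u x))"
    proof (rule A_norm_layer_combination[OF D1 B A'(1) AD1 \<phi>(1) _ True, where A=A])
      show "\<phi> x = 1" if "x \<in> A'" for x by (rule \<phi>(2)[OF that])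
    qed (rule that)
    then show ?thesis using u by (intro exI[of _ C]) blast
  qed (auto intro: exI[of _ 0])
  then have "\<forall>i. \<exists>C. 0 \<le> C \<and> (i < M \<longrightarrow> (\<forall>v1\<in>Lp p UNIV. \<forall>v2\<in>Lp p UNIV.
     A_norm A q (A' \<union> B) (\<lambda>x. ?w i v1 v2 x - u x)
     \<le> C * (A_norm A q D1 (\<lambda>x. v1 x - u x) + A_norm A q B (\<lambda>x. v2 x - u x))))" by blast
  from choice[OF this] obtain C where C0: "\<forall>i. 0 \<le> C i \<and> (i < M \<longrightarrow> (\<forall>v1\<in>Lp p UNIV. \<forall>v2\<in>Lp p UNIV.
     A_norm A q (A' \<union> B) (\<lambda>x. ?w i v1 v2 x - u x)
     \<le> C i * (A_norm A q D1 (\<lambda>x. v1 x - u x) + A_norm A q B (\<lambda>x. v2 x - u x))))" ..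
  have C: "0 \<le> C i" "i < M \<Longrightarrow> v1 \<in> Lp p UNIV \<Longrightarrow> v2 \<in> Lp p UNIV \<Longrightarrow>
     A_norm A q (A' \<union> B) (\<lambda>x. ?w i v1 v2 x - u x)
     \<le> C i * (A_norm A q D1 (\<lambda>x. v1 x - u x) + A_norm A q B (\<lambda>x. v2 x - u x))" for i v1 v2
    using C0 by blast+
  \<comment> \<open>The index selected by the layer argument varies with \<open>F\<close>,
    \<open>v1\<close> and \<open>v2\<close>; \<open>K0\<close> dominates the constants of all
    \<open>M\<close> cutoffs, and the summand 1 makes it positive.\<close>
  define K0 where "K0 = (\<Sum>i<M. C i) + 1"
  have K0: "0 < K0" "\<And>i. i < M \<Longrightarrow> C i \<le> K0"
  proof -
    have "0 \<le> (\<Sum>i<M. C i)" by (simp add: sum_nonneg C(1))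
    then show "0 < K0" by (simp add: K0_def)
    show "C i \<le> K0" if "i < M" for i
      using member_le_sum[of i "{..<M}" C] that C(1) by (simp add: K0_def)
  qed
  show ?thesis
  proof (rule that[of "e / (2 * K0)"])
    show \<delta>: "0 < e / (2 * K0)" using e K0(1) by simp
    fix F :: "('n, 'd) functional" and v1 v2
    assume F: "F \<in> class_I p c0" and v1: "v1 \<in> A_ball A D1 u (e / (2 * K0))" and v2: "v2 \<in> A_ball A B u (e / (2 * K0))"
    have L: "v1 \<in> Lp p D1" "v2 \<in> Lp p B" using v1 v2 by (auto simp: A_ball_def)
    define f1 f2 where "f1 x = (if x \<in> D1 then v1 x else 0)" and "f2 x = (if x \<in> B then v2 x else 0)" for x
    have f: "f1 \<in> Lp p UNIV" "f2 \<in> Lp p UNIV"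
      unfolding f1_def f2_def using Lp_extend[OF L(1) bounded_opens_sets[OF D1]] Lp_extend[OF L(2) bounded_opens_sets[OF B]] by auto
    obtain i where i: "i < M" "F (?w i f1 f2) (A' \<union> B) \<le> F f1 D1 + F f2 B + c0 / real M * (measure lebesgue B
        + (\<integral>x. norm (f1 x) powr p \<partial>lebesgue_on B) + (\<integral>x. norm (f2 x) powr p \<partial>lebesgue_on B))"
      using class_I_join[OF p0 c0 F D1 B A'(1) AD1 \<phi> f M] by blast
    have "A_norm A q (A' \<union> B) (\<lambda>x. ?w i f1 f2 x - u x)
      \<le> C i * (A_norm A q D1 (\<lambda>x. f1 x - u x) + A_norm A q B (\<lambda>x. f2 x - u x))" by (rule C(2)[OF i(1) f])
    also have "A_norm A q D1 (\<lambda>x. f1 x - u x) = A_norm A q D1 (\<lambda>x. v1 x - u x)" by (rule A_norm_cong) (simp add: f1_def)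
    also have "A_norm A q B (\<lambda>x. f2 x - u x) = A_norm A q B (\<lambda>x. v2 x - u x)" by (rule A_norm_cong) (simp add: f2_def)
    also have "C i * (A_norm A q D1 (\<lambda>x. v1 x - u x) + A_norm A q B (\<lambda>x. v2 x - u x))
        \<le> K0 * (A_norm A q D1 (\<lambda>x. v1 x - u x) + A_norm A q B (\<lambda>x. v2 x - u x))"
      using Lp_diff[OF p0 L(1) Lp_UNIV_subset[OF u bounded_opens_sets[OF D1]]] Lp_diff[OF p0 L(2) Lp_UNIV_subset[OF u bounded_opens_sets[OF B]]]
      by (intro mult_right_mono K0(2) i(1) add_nonneg_nonneg A_norm_nonneg D1 B)
    also have "\<dots> < K0 * (e / (2 * K0) + e / (2 * K0))"
      using v1 v2 K0(1) by (intro mult_strict_left_mono add_strict_mono) (auto simp: A_ball_def)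
    also have "\<dots> = e" using K0(1) by (simp add: field_simps)
    finally have "?w i f1 f2 \<in> A_ball A (A' \<union> B) u e"
      using Lp_UNIV_subset[OF layer_combination_Lp[OF p0 test_functions_C_infinity[OF \<phi>(1)] f] bounded_opens_sets[OF D]]
      by (simp add: A_ball_def)
    moreover have "F f1 D1 = F v1 D1"
      by (rule class_I_cong[OF F D1 Lp_UNIV_subset[OF f(1) bounded_opens_sets[OF D1]]]) (simp add: f1_def)
    moreover have "F f2 B = F v2 B"
      by (rule class_I_cong[OF F B Lp_UNIV_subset[OF f(2) bounded_opens_sets[OF B]]]) (simp add: f2_def)
    moreover have "(\<integral>x. norm (f2 x) powr p \<partial>lebesgue_on B) = (\<integral>x. norm (v2 x) powr p \<partial>lebesgue_on B)"
      by (rule Bochner_Integration.integral_cong) (auto simp: f2_def)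
    moreover have "(\<integral>x. norm (f1 x) powr p \<partial>lebesgue_on B) \<le> (\<integral>x. norm (v1 x) powr p \<partial>lebesgue_on D1)"
    proof -
      have "(\<integral>x. norm (f1 x) powr p \<partial>lebesgue_on B) \<le> (\<integral>x. norm (f1 x) powr p \<partial>lebesgue_on UNIV)"
        by (rule Lp_subset(2)[OF _ _ bounded_opens_sets[OF B] f(1)]) auto
      also have "\<dots> = (\<integral>x. norm (f1 x) powr p \<partial>lebesgue)" by (simp add: lebesgue_on_UNIV_eq)
      also have "\<dots> = (\<integral>x. norm (f1 x) powr p \<partial>lebesgue_on D1)"
        by (rule integral_lebesgue_on_support[OF bounded_opens_sets[OF D1], symmetric]) (simp add: f1_def)
      also have "\<dots> = (\<integral>x. norm (v1 x) powr p \<partial>lebesgue_on D1)"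
        by (rule Bochner_Integration.integral_cong) (auto simp: f1_def)
      finally show ?thesis .
    qed
    ultimately show "\<exists>w\<in>A_ball A (A' \<union> B) u e. F w (A' \<union> B) \<le> F v1 D1 + F v2 B + c0 / real M * (measure lebesgue B
        + (\<integral>x. norm (v1 x) powr p \<partial>lebesgue_on D1) + (\<integral>x. norm (v2 x) powr p \<partial>lebesgue_on B))"
      using i(2) c0 M
      by (intro bexI[of _ "?w i f1 f2"] order_trans[OF i(2)] add_mono mult_left_mono) auto
  qed
qed

end

section \<open>Gamma-limits as set functions\<close>

text \<open>Supplies a set \<open>W\<close> relatively compact in \<open>V\<close>, the room that
  the fundamental estimate requires.\<close>

lemma compact_between:
  fixes K V :: "'a::euclidean_space set"
  assumes "compact K" "open V" "K \<subseteq> V"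
  obtains W L where "open W" "compact L" "K \<subseteq> W" "W \<subseteq> L" "L \<subseteq> V"
proof -
  obtain C where C: "\<And>n. compact (C n)" "\<And>n. C n \<subseteq> V" "\<And>n. C n \<subseteq> interior (C (Suc n))"
     "\<Union>(range C) = V" "\<And>K. \<lbrakk>compact K; K \<subseteq> V\<rbrakk> \<Longrightarrow> \<exists>N. \<forall>n\<ge>N. K \<subseteq> C n"
    by (rule open_Union_compact_subsets[OF assms(2)]) (rule that)
  obtain n where "K \<subseteq> C n" using C(5)[OF assms(1,3)] by blast
  then show ?thesis
    by (intro that[of "interior (C (Suc n))" "C (Suc n)"] C) (use C(3)[of n] in \<open>auto simp: interior_subset\<close>)
qed

locale class_I_sequence = dual_exponents +
  fixes A :: "'n::finite \<Rightarrow> real^'d::finite^'l::finite" and c0 :: real and f :: "nat \<Rightarrow> ('n, 'd) functional"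
  assumes c0: "1 \<le> c0" and f: "\<And>k. f k \<in> class_I p c0"
begin

abbreviation power_integral :: "(real^'n) set \<Rightarrow> (real^'n \<Rightarrow> real^'d) \<Rightarrow> real" where
  "power_integral D u \<equiv> (\<integral>x. norm (u x) powr p \<partial>lebesgue_on D)"

definition Ginf :: "(real^'n \<Rightarrow> real^'d) \<Rightarrow> (real^'n) set \<Rightarrow> ereal" where
  "Ginf u D = Gamma_liminf (A_topology A p q D) (\<lambda>k v. ereal (f k v D)) u"

definition Gsup :: "(real^'n \<Rightarrow> real^'d) \<Rightarrow> (real^'n) set \<Rightarrow> ereal" where
  "Gsup u D = Gamma_limsup (A_topology A p q D) (\<lambda>k v. ereal (f k v D)) u"

text \<open>Real versions of the limits; no information is lost for bounded open \<open>D\<close>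
  and \<open>u\<close> in \<open>L^p(D)\<close>, where nonnegativity and growth confine both limits
  to finite values.\<close>

definition ginf where "ginf u D = real_of_ereal (Ginf u D)"
definition gsup where "gsup u D = real_of_ereal (Gsup u D)"

text \<open>The constant sequence \<open>u\<close> is a competitor in every ball about
  \<open>u\<close>.\<close>

lemma Gsup_upper:
  assumes "D \<in> bounded_opens" "u \<in> Lp p D"
  shows "Gsup u D \<le> ereal (c0 * (measure lebesgue D + power_integral D u))"
  unfolding Gsup_def
proof (rule Gamma_limsup_leI, intro always_eventually allI)
  fix r :: real and k assume "0 < r"
  show "\<exists>v\<in>A_ball A D u r. ereal (f k v D) \<le> ereal (c0 * (measure lebesgue D + power_integral D u))"
    using centre_in_A_ball[OF assms \<open>0 < r\<close>] class_I_upper[OF f assms p0] by auto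
qed

lemma Ginf_nonneg:
  assumes "D \<in> bounded_opens" "u \<in> Lp p D"
  shows "0 \<le> Ginf u D"
  unfolding Ginf_def
proof (rule Gamma_liminf_geI[OF assms zero_less_one], intro always_eventually allI ballI)
  fix k v assume "v \<in> A_ball A D u 1"
  then show "0 \<le> ereal (f k v D)" using class_I_nonneg[OF f assms(1)] by (simp add: A_ball_def)
qed

lemma Ginf_le_Gsup: "Ginf u D \<le> Gsup u D"
  unfolding Ginf_def Gsup_def by (rule Gamma_liminf_le_limsup)

lemma Gsup_ginf_real:
  assumes "D \<in> bounded_opens" "u \<in> Lp p D"
  shows "Gsup u D = ereal (gsup u D)" "Ginf u D = ereal (ginf u D)"
proof -
  have "Gsup u D < \<infinity>" using Gsup_upper[OF assms] by (rule le_less_trans) simp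
  moreover have "0 \<le> Gsup u D" using Ginf_nonneg[OF assms] Ginf_le_Gsup order_trans by blast
  moreover have "Ginf u D < \<infinity>" using Ginf_le_Gsup \<open>Gsup u D < \<infinity>\<close> by (rule le_less_trans)
  ultimately show "Gsup u D = ereal (gsup u D)" "Ginf u D = ereal (ginf u D)"
    using Ginf_nonneg[OF assms] unfolding gsup_def ginf_def by (auto simp: ereal_real')
qed

lemma gsup_upper:
  assumes "D \<in> bounded_opens" "u \<in> Lp p D"
  shows "gsup u D \<le> c0 * (measure lebesgue D + power_integral D u)"
  using Gsup_upper[OF assms] by (simp add: Gsup_ginf_real[OF assms])

lemma ginf_nonneg:
  assumes "D \<in> bounded_opens" "u \<in> Lp p D"
  shows "0 \<le> ginf u D"
  using Ginf_nonneg[OF assms] by (simp add: Gsup_ginf_real[OF assms])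

lemma ginf_le_gsup:
  assumes "D \<in> bounded_opens" "u \<in> Lp p D"
  shows "ginf u D \<le> gsup u D"
  using Ginf_le_Gsup[of u D] by (simp add: Gsup_ginf_real[OF assms])

lemma gsup_lessD:
  assumes "D \<in> bounded_opens" "u \<in> Lp p D" "gsup u D < c" "0 < r"
  shows "\<forall>\<^sub>F k in sequentially. \<exists>v\<in>A_ball A D u r. f k v D < c"
  using Gamma_limsup_lessD[OF assms(1,2), of A "\<lambda>k v. ereal (f k v D)" "ereal c" r] assms(3,4)
    Gsup_ginf_real(1)[OF assms(1,2)] by (simp add: Gsup_def)

lemma gsup_leI:
  assumes "D \<in> bounded_opens" "u \<in> Lp p D"
    "\<And>r. 0 < r \<Longrightarrow> \<forall>\<^sub>F k in sequentially. \<exists>v\<in>A_ball A D u r. f k v D \<le> c"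
  shows "gsup u D \<le> c"
proof -
  have "Gsup u D \<le> ereal c" unfolding Gsup_def by (rule Gamma_limsup_leI) (use assms(3) in simp)
  then show ?thesis by (simp add: Gsup_ginf_real[OF assms(1,2)])
qed

lemma less_ginfD:
  assumes "D \<in> bounded_opens" "u \<in> Lp p D" "c < ginf u D"
  obtains r where "0 < r" "\<forall>\<^sub>F k in sequentially. \<forall>v\<in>A_ball A D u r. c < f k v D"
proof -
  have "ereal c < Gamma_liminf (A_topology A p q D) (\<lambda>k v. ereal (f k v D)) u"
    using assms(3) Gsup_ginf_real(2)[OF assms(1,2)] by (simp add: Ginf_def)
  then obtain r where "0 < r" "\<forall>\<^sub>F k in sequentially. \<forall>v\<in>A_ball A D u r. ereal c < ereal (f k v D)"
    by (rule less_Gamma_liminfD)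
  then show ?thesis using that by simp
qed

lemma ginf_geI:
  assumes "D \<in> bounded_opens" "u \<in> Lp p D" "0 < r" "\<forall>\<^sub>F k in sequentially. \<forall>v\<in>A_ball A D u r. c \<le> f k v D"
  shows "c \<le> ginf u D"
proof -
  have "ereal c \<le> Ginf u D" unfolding Ginf_def
    by (rule Gamma_liminf_geI[OF assms(1,2,3)]) (use assms(4) in simp)
  then show ?thesis by (simp add: Gsup_ginf_real[OF assms(1,2)])
qed

text \<open>Almost everywhere equal functions are different points at distance 0, so an open set
  contains both or neither. For this reason the limits respect equality almost everywhere.\<close>

lemma Gamma_neighbourhoods_cong:
  assumes D: "D \<in> bounded_opens" and u: "u \<in> Lp p D" and v: "v \<in> Lp p D" and ae: "AE x in lebesgue_on D. u x = v x"
  shows "{U. openin (A_topology A p q D) U \<and> u \<in> U} = {U. openin (A_topology A p q D) U \<and> v \<in> U}"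
proof -
  have "y \<in> U" if U: "openin (A_topology A p q D) U" "x \<in> U" and y: "x \<in> Lp p D" "y \<in> Lp p D" "AE z in lebesgue_on D. y z = x z" for x y U
  proof -
    have "AE z in lebesgue_on D. y z - x z = 0" using y(3) by eventually_elim simp
    then have "A_norm A q D (\<lambda>z. y z - x z) = 0" by (rule A_norm_zero[OF D Lp_diff[OF p0 y(2,1)]])
    then show ?thesis using U y(2) unfolding openin_A_topology by (metis (no_types, lifting))
  qed
  from this[of _ u v] this[of _ v u] show ?thesis using u v ae by (auto simp: eq_commute)
qed

lemma ginf_cong_AE:
  assumes "D \<in> bounded_opens" "u \<in> Lp p D" "v \<in> Lp p D" "AE x in lebesgue_on D. u x = v x"
  shows "ginf u D = ginf v D" "gsup u D = gsup v D"
  using Gamma_neighbourhoods_cong[OF assms]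
  by (simp_all add: ginf_def gsup_def Ginf_def Gsup_def Gamma_liminf_def Gamma_limsup_def)

lemma ginf_cong:
  assumes "D \<in> bounded_opens" "u \<in> Lp p D" "\<And>x. x \<in> D \<Longrightarrow> u x = v x"
  shows "ginf u D = ginf v D" "gsup u D = gsup v D"
proof -
  have "AE x in lebesgue_on D. u x = v x" using assms(3) by (intro AE_I2) simp
  from ginf_cong_AE[OF assms(1,2) Lp_cong[OF assms(3,2)] this]
  show "ginf u D = ginf v D" "gsup u D = gsup v D" by auto
qed

lemma ginf_lower:
  assumes D: "D \<in> bounded_opens" and u: "u \<in> Lp p D"
  shows "(1 / c0) * power_integral D u - c0 * measure lebesgue D \<le> ginf u D"
proof (rule field_le_epsilon)
  fix e :: real assume e: "0 < e"
  obtain \<delta> where \<delta>: "0 < \<delta>" "\<And>v. v \<in> Lp p D \<Longrightarrow> A_norm A q D (\<lambda>x. v x - u x) < \<delta> \<Longrightarrow>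
    power_integral D u - e \<le> power_integral D v"
    by (rule Lp_norm_lower_semicontinuous[OF D u e, where A=A]) (rule that)
  have "(1 / c0) * power_integral D u - c0 * measure lebesgue D - e \<le> ginf u D"
  proof (rule ginf_geI[OF D u \<delta>(1)], intro always_eventually allI ballI)
    fix k v assume v: "v \<in> A_ball A D u \<delta>"
    then have L: "v \<in> Lp p D" by (simp add: A_ball_def)
    have "(1 / c0) * (power_integral D u - e) \<le> (1 / c0) * power_integral D v"
      using v \<delta>(2)[OF L] c0 by (intro mult_left_mono) (auto simp: A_ball_def)
    moreover have "(1 / c0) * e \<le> e" using c0 e by (simp add: field_simps)
    moreover have "(1 / c0) * (power_integral D u - e) = (1 / c0) * power_integral D u - (1 / c0) * e" by (rule right_diff_distrib)
    ultimately show "(1 / c0) * power_integral D u - c0 * measure lebesgue D - e \<le> f k v D"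
      using class_I_lower[OF f D L p0, of k] by linarith
  qed
  then show "(1 / c0) * power_integral D u - c0 * measure lebesgue D \<le> ginf u D + e" by simp
qed

text \<open>Restriction to a smaller domain is continuous for the two topologies; neighbourhoods on
  \<open>D\<close> thereby pull back to \<open>D'\<close>.\<close>

lemma A_ball_mono:
  assumes "D \<in> bounded_opens" "D' \<in> bounded_opens" "D \<subseteq> D'" "u \<in> Lp p D'" "0 < r"
  obtains r' where "0 < r'" "A_ball A D' u r' \<subseteq> A_ball A D u r"
proof -
  obtain C where C: "0 \<le> C" "\<And>w :: real^'n \<Rightarrow> real^'d. w \<in> Lp p D' \<Longrightarrow> A_norm A q D w \<le> C * A_norm A q D' w"
    by (rule A_norm_mono[OF assms(1-3), where A=A]) (rule that)
  have r': "0 < r / (C + 1)" using assms(5) C(1) by simp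
  moreover have "A_ball A D' u (r / (C + 1)) \<subseteq> A_ball A D u r"
  proof
    fix v assume v: "v \<in> A_ball A D' u (r / (C + 1))"
    then have L: "v \<in> Lp p D'" by (simp add: A_ball_def)
    note vu = Lp_diff[OF p0 L assms(4)]
    have "A_norm A q D (\<lambda>x. v x - u x) \<le> C * A_norm A q D' (\<lambda>x. v x - u x)" by (rule C(2)[OF vu])
    also have "\<dots> \<le> (C + 1) * A_norm A q D' (\<lambda>x. v x - u x)"
      using A_norm_nonneg[OF assms(2) vu, of A] by (intro mult_right_mono) auto
    also have "\<dots> < r" using v C(1) by (simp add: A_ball_def pos_less_divide_eq mult.commute)
    finally show "v \<in> A_ball A D u r"
      using Lp_subset(1)[OF assms(3) bounded_opens_sets[OF assms(2)] bounded_opens_sets[OF assms(1)] L] by (simp add: A_ball_def)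
  qed
  ultimately show ?thesis using that by blast
qed

text \<open>A small ball for \<open>D\<close> lies in prescribed balls for both parts. A single
  competitor on \<open>D\<close> is thus tested on \<open>E1\<close> and \<open>E2\<close>
  simultaneously, and each \<open>f k\<close> is additive on the disjoint parts and
  monotone.\<close>

lemma ginf_superadditive:
  assumes D: "D \<in> bounded_opens" and E: "open E1" "open E2" "E1 \<inter> E2 = {}" "E1 \<union> E2 \<subseteq> D" and u: "u \<in> Lp p D"
  shows "ginf u E1 + ginf u E2 \<le> ginf u D"
proof (rule field_le_epsilon)
  fix e :: real assume e: "0 < e"
  have b: "E1 \<in> bounded_opens" "E2 \<in> bounded_opens" "E1 \<union> E2 \<in> bounded_opens"
    using bounded_opens_subset[OF D] E by auto
  have L: "u \<in> Lp p E1" "u \<in> Lp p E2"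
    using Lp_subset(1)[OF _ bounded_opens_sets[OF D] _ u] bounded_opens_sets b E(4) by blast+
  obtain r1 where r1: "0 < r1" "\<forall>\<^sub>F k in sequentially. \<forall>v\<in>A_ball A E1 u r1. ginf u E1 - e / 2 < f k v E1"
    by (rule less_ginfD[OF b(1) L(1), of "ginf u E1 - e / 2"]) (use e in auto)
  obtain r2 where r2: "0 < r2" "\<forall>\<^sub>F k in sequentially. \<forall>v\<in>A_ball A E2 u r2. ginf u E2 - e / 2 < f k v E2"
    by (rule less_ginfD[OF b(2) L(2), of "ginf u E2 - e / 2"]) (use e in auto)
  obtain s1 where s1: "0 < s1" "A_ball A D u s1 \<subseteq> A_ball A E1 u r1"
    using A_ball_mono[OF b(1) D _ u r1(1)] E(4) by blast
  obtain s2 where s2: "0 < s2" "A_ball A D u s2 \<subseteq> A_ball A E2 u r2"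
    using A_ball_mono[OF b(2) D _ u r2(1)] E(4) by blast
  have "ginf u E1 + ginf u E2 - e \<le> ginf u D"
  proof (rule ginf_geI[OF D u])
    show "0 < min s1 s2" using s1 s2 by simp
    show "\<forall>\<^sub>F k in sequentially. \<forall>v\<in>A_ball A D u (min s1 s2). ginf u E1 + ginf u E2 - e \<le> f k v D"
      using r1(2) r2(2)
    proof eventually_elim
      case (elim k)
      show ?case
      proof
        fix v assume v: "v \<in> A_ball A D u (min s1 s2)"
        then have "v \<in> A_ball A D u s1" "v \<in> A_ball A D u s2" by (auto simp: A_ball_def)
        then have 1: "ginf u E1 - e / 2 < f k v E1" "ginf u E2 - e / 2 < f k v E2" using elim s1(2) s2(2) by blast+
        have vL: "v \<in> Lp p D" using v by (simp add: A_ball_def)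
        have vE: "v \<in> Lp p (E1 \<union> E2)" by (rule Lp_subset(1)[OF E(4) bounded_opens_sets[OF D] bounded_opens_sets[OF b(3)] vL])
        have "f k v (E1 \<union> E2) = f k v E1 + f k v E2" by (rule class_I_additive[OF f b(3) vE E(1,2) refl E(3)])
        moreover have "f k v (E1 \<union> E2) \<le> f k v D" by (rule class_I_mono[OF f D vL _ E(4)]) (use E in auto)
        ultimately show "ginf u E1 + ginf u E2 - e \<le> f k v D" using 1 by linarith
      qed
    qed
  qed
  then show "ginf u E1 + ginf u E2 \<le> ginf u D + e" by simp
qed

text \<open>Superadditivity with an empty second set, whose value is nonnegative.\<close>

lemma ginf_mono:
  assumes D: "D \<in> bounded_opens" and D': "D' \<in> bounded_opens" and "D \<subseteq> D'" and u: "u \<in> Lp p D'"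
  shows "ginf u D \<le> ginf u D'"
proof -
  have o: "open D" using D by (simp add: bounded_opens_def)
  have e: "{} \<in> bounded_opens" by (simp add: bounded_opens_def)
  have "ginf u D + ginf u {} \<le> ginf u D'"
    by (rule ginf_superadditive[OF D' o _ _ _ u]) (use assms(3) in auto)
  moreover have "0 \<le> ginf u {}"
    by (rule ginf_nonneg[OF e Lp_subset(1)[OF _ bounded_opens_sets[OF D'] _ u]]) auto
  ultimately show ?thesis by simp
qed

section \<open>Subadditivity and inner regularity of the upper limit\<close>

lemma class_I_power_integral_le:
  assumes "F \<in> class_I p c0" "D \<in> bounded_opens" "u \<in> Lp p D"
  shows "power_integral D u \<le> c0 * (F u D + c0 * measure lebesgue D)"
proof -
  have "power_integral D u / c0 \<le> F u D + c0 * measure lebesgue D"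
    using class_I_lower[OF assms p0] by simp
  then show ?thesis using c0 by (simp add: pos_divide_le_eq mult.commute)
qed

text \<open>The fundamental estimate is applied to almost optimal functions near \<open>u\<close> on
  \<open>D1\<close> and on \<open>B\<close>. Half of \<open>e\<close> pays for their deviation from
  the upper limits, the other half for the gluing error.\<close>

lemma gsup_subadditive_compact:
  assumes D1: "D1 \<in> bounded_opens" and B: "B \<in> bounded_opens" and A': "open A'" "A' \<subseteq> K" "compact K" "K \<subseteq> D1"
    and u: "u \<in> Lp p UNIV"
  shows "gsup u (A' \<union> B) \<le> gsup u D1 + gsup u B"
proof (rule field_le_epsilon)
  fix e :: real assume e: "0 < e"
  note L = Lp_UNIV_subset[OF u bounded_opens_sets]
  have D: "A' \<union> B \<in> bounded_opens" using A' by (intro bounded_opens_Un[OF bounded_opens_subset[OF D1 A'(1)] B]) auto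
  define \<eta> where "\<eta> = min 1 (e / 4)"
  have \<eta>: "0 < \<eta>" "\<eta> \<le> 1" "2 * \<eta> \<le> e / 2" using e by (auto simp: \<eta>_def)
  \<comment> \<open>Bounds the growth term in the gluing error: almost optimal functions have energy
    below \<open>gsup + 1\<close>, and coercivity converts this into a bound on their power
    integrals. It does not involve \<open>M\<close>.\<close>
  define H where "H = measure lebesgue B + c0 * (gsup u D1 + 1 + c0 * measure lebesgue D1) + c0 * (gsup u B + 1 + c0 * measure lebesgue B)"
  obtain M0 :: nat where M0: "2 * c0 * H / e < real M0" using reals_Archimedean2 by blast
  \<comment> \<open>The successor secures \<open>1 \<le> M\<close> without an argument about the
    sign of \<open>H\<close>.\<close>
  define M where "M = Suc M0"
  have M: "1 \<le> M" "c0 / real M * H \<le> e / 2"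
  proof -
    have "2 * c0 * H / e \<le> real M" using M0 by (simp add: M_def)
    then show "c0 / real M * H \<le> e / 2" using e by (simp add: M_def field_simps)
  qed (simp add: M_def)
  show "gsup u (A' \<union> B) \<le> gsup u D1 + gsup u B + e"
  proof (rule gsup_leI[OF D L[OF D]])
    fix r :: real assume r: "0 < r"
    obtain \<delta> where \<delta>: "0 < \<delta>" "\<And>F v1 v2. F \<in> class_I p c0 \<Longrightarrow> v1 \<in> A_ball A D1 u \<delta> \<Longrightarrow> v2 \<in> A_ball A B u \<delta> \<Longrightarrow>
     \<exists>w\<in>A_ball A (A' \<union> B) u r. F w (A' \<union> B) \<le> F v1 D1 + F v2 B + c0 / real M * (measure lebesgue B + power_integral D1 v1 + power_integral B v2)"
      by (rule fundamental_estimate[OF _ D1 B A' u M(1) r, where A=A and ?c0.0=c0]) (use c0 in simp, rule that)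
    have "\<forall>\<^sub>F k in sequentially. \<exists>v\<in>A_ball A D1 u \<delta>. f k v D1 < gsup u D1 + \<eta>"
      by (rule gsup_lessD[OF D1 L[OF D1] _ \<delta>(1)]) (use \<eta> in simp)
    moreover have "\<forall>\<^sub>F k in sequentially. \<exists>v\<in>A_ball A B u \<delta>. f k v B < gsup u B + \<eta>"
      by (rule gsup_lessD[OF B L[OF B] _ \<delta>(1)]) (use \<eta> in simp)
    ultimately show "\<forall>\<^sub>F k in sequentially. \<exists>v\<in>A_ball A (A' \<union> B) u r. f k v (A' \<union> B) \<le> gsup u D1 + gsup u B + e"
    proof eventually_elim
      case (elim k)
      then obtain v1 v2 where v: "v1 \<in> A_ball A D1 u \<delta>" "f k v1 D1 < gsup u D1 + \<eta>"
        "v2 \<in> A_ball A B u \<delta>" "f k v2 B < gsup u B + \<eta>" by blast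
      obtain w where w: "w \<in> A_ball A (A' \<union> B) u r" "f k w (A' \<union> B) \<le> f k v1 D1 + f k v2 B
          + c0 / real M * (measure lebesgue B + power_integral D1 v1 + power_integral B v2)"
        using \<delta>(2)[OF f v(1,3)] by blast
      have "power_integral D1 v1 \<le> c0 * (f k v1 D1 + c0 * measure lebesgue D1)"
        by (rule class_I_power_integral_le[OF f D1]) (use v(1) in \<open>simp add: A_ball_def\<close>)
      also have "\<dots> \<le> c0 * (gsup u D1 + 1 + c0 * measure lebesgue D1)"
        using v(2) \<eta>(2) c0 by (intro mult_left_mono) auto
      finally have 1: "power_integral D1 v1 \<le> c0 * (gsup u D1 + 1 + c0 * measure lebesgue D1)" .
      have "power_integral B v2 \<le> c0 * (f k v2 B + c0 * measure lebesgue B)"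
        by (rule class_I_power_integral_le[OF f B]) (use v(3) in \<open>simp add: A_ball_def\<close>)
      also have "\<dots> \<le> c0 * (gsup u B + 1 + c0 * measure lebesgue B)"
        using v(4) \<eta>(2) c0 by (intro mult_left_mono) auto
      finally have 2: "power_integral B v2 \<le> c0 * (gsup u B + 1 + c0 * measure lebesgue B)" .
      have "c0 / real M * (measure lebesgue B + power_integral D1 v1 + power_integral B v2) \<le> c0 / real M * H"
        using 1 2 c0 unfolding H_def by (intro mult_left_mono add_mono) auto
      then have "f k w (A' \<union> B) \<le> gsup u D1 + gsup u B + e" using w(2) v(2,4) \<eta>(3) M(2) by linarith
      then show ?case using w(1) by blast
    qed
  qed
qed

text \<open>Split \<open>D\<close> into a set relatively compact in \<open>V\<close> and the
  complement of a large compact set. The upper limit on this complement is at most \<open>c0\<close>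
  times the integral of \<open>1 + |u|^p\<close>, which dominated convergence makes small. The
  uniform form, for all open \<open>V\<close> between \<open>K\<close> and \<open>D\<close>, is the
  one demanded both by the countable family of domains and by the criterion for measures.\<close>

lemma gsup_inner_regular:
  assumes D: "D \<in> bounded_opens" and u: "u \<in> Lp p UNIV" and e: "0 < e"
  obtains K where "compact K" "K \<subseteq> D" "\<And>V. open V \<Longrightarrow> K \<subseteq> V \<Longrightarrow> V \<subseteq> D \<Longrightarrow> gsup u D \<le> gsup u V + e"
proof -
  have oD: "open D" using D by (simp add: bounded_opens_def)
  note L = Lp_UNIV_subset[OF u bounded_opens_sets]
  obtain C where C: "\<And>n. compact (C n)" "\<And>n. C n \<subseteq> D" "\<And>n. C n \<subseteq> interior (C (Suc n))"
     "\<Union>(range C) = D" "\<And>K. \<lbrakk>compact K; K \<subseteq> D\<rbrakk> \<Longrightarrow> \<exists>N. \<forall>n\<ge>N. K \<subseteq> C n"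
    by (rule open_Union_compact_subsets[OF oD]) (rule that)
  define g where "g x = indicator D x *\<^sub>R (1 + norm (u x) powr p)" for x
  have oC: "open (D - C n)" for n using oD C(1) by (simp add: open_Diff compact_imp_closed)
  have bC: "D - C n \<in> bounded_opens" for n by (rule bounded_opens_subset[OF D oC]) auto
  have int: "integrable lebesgue (\<lambda>x. indicator E x *\<^sub>R (1 + norm (u x) powr p))"
     "(\<integral>x. indicator E x *\<^sub>R (1 + norm (u x) powr p) \<partial>lebesgue) = measure lebesgue E + power_integral E u"
    if "E \<in> bounded_opens" for E
    using integral_one_plus_powers[OF that u Lp_zero] by simp_all
  have "(\<lambda>n. \<integral>x. indicator (D - C n) x *\<^sub>R (1 + norm (u x) powr p) \<partial>lebesgue) \<longlonglongrightarrow> (\<integral>x. 0 \<partial>(lebesgue :: (real^'n) measure))"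
  proof (rule integral_dominated_convergence[where w=g])
    show "integrable lebesgue g" unfolding g_def by (rule int(1)[OF D])
    show "(\<lambda>x. indicator (D - C n) x *\<^sub>R (1 + norm (u x) powr p)) \<in> borel_measurable lebesgue" for n
      using int(1)[OF bC] by (rule borel_measurable_integrable)
    show "AE x in lebesgue. (\<lambda>n. indicator (D - C n) x *\<^sub>R (1 + norm (u x) powr p)) \<longlonglongrightarrow> 0"
    proof (rule AE_I2)
      fix x
      have "\<exists>N. \<forall>n\<ge>N. x \<notin> D - C n" using C(5)[of "{x}"] by (cases "x \<in> D") auto
      then have "\<forall>\<^sub>F n in sequentially. 0 = indicator (D - C n) x *\<^sub>R (1 + norm (u x) powr p)"
        unfolding eventually_sequentially by (auto simp: indicator_def)
      then show "(\<lambda>n. indicator (D - C n) x *\<^sub>R (1 + norm (u x) powr p)) \<longlonglongrightarrow> 0"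
        by (rule Lim_transform_eventually[OF tendsto_const])
    qed
    show "AE x in lebesgue. norm (indicator (D - C n) x *\<^sub>R (1 + norm (u x) powr p)) \<le> g x" for n
      by (rule AE_I2) (auto simp: g_def indicator_def)
  qed auto
  then have "(\<lambda>n. measure lebesgue (D - C n) + power_integral (D - C n) u) \<longlonglongrightarrow> 0" by (simp only: int(2)[OF bC] integral_zero)
  moreover have "0 < e / c0" using e c0 by simp
  ultimately have "\<forall>\<^sub>F n in sequentially. measure lebesgue (D - C n) + power_integral (D - C n) u < e / c0"
    by (rule order_tendstoD(2))
  then obtain n where n: "measure lebesgue (D - C n) + power_integral (D - C n) u < e / c0"
    by (meson eventually_happens trivial_limit_sequentially)
  have small: "gsup u (D - C n) \<le> e"
  proof -
    have "gsup u (D - C n) \<le> c0 * (measure lebesgue (D - C n) + power_integral (D - C n) u)"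
      by (rule gsup_upper[OF bC L[OF bC]])
    also have "\<dots> \<le> c0 * (e / c0)" using n c0 by (intro mult_left_mono) auto
    finally show ?thesis using c0 by simp
  qed
  show ?thesis
  proof (rule that[OF C(1,2)[of n]])
    fix V assume V: "open V" "C n \<subseteq> V" "V \<subseteq> D"
    obtain W L where WL: "open W" "compact L" "C n \<subseteq> W" "W \<subseteq> L" "L \<subseteq> V"
      using compact_between[OF C(1) V(1,2)] by blast
    have eq: "D = W \<union> (D - C n)" using WL V by blast
    have "gsup u D \<le> gsup u V + gsup u (D - C n)"
      using gsup_subadditive_compact[OF bounded_opens_subset[OF D V(1,3)] bC WL(1,4,2,5) u, of n] eq by simp
    then show "gsup u D \<le> gsup u V + e" using small by simp
  qed
qed

text \<open>The estimate available so far shrinks one of the sets, and inner regularity permits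
  this: if \<open>K\<close> carries almost all of the union, then \<open>K - E2\<close> is a compact
  part of \<open>E1\<close> and \<open>E1\<close> may be replaced by a neighbourhood of it that is
  relatively compact in \<open>E1\<close>.\<close>

lemma gsup_subadditive:
  assumes E1: "E1 \<in> bounded_opens" and E2: "E2 \<in> bounded_opens" and u: "u \<in> Lp p UNIV"
  shows "gsup u (E1 \<union> E2) \<le> gsup u E1 + gsup u E2"
proof (rule field_le_epsilon)
  fix e :: real assume e: "0 < e"
  have o: "open E1" "open E2" using E1 E2 by (auto simp: bounded_opens_def)
  obtain K where K: "compact K" "K \<subseteq> E1 \<union> E2" "\<And>V. open V \<Longrightarrow> K \<subseteq> V \<Longrightarrow> V \<subseteq> E1 \<union> E2 \<Longrightarrow> gsup u (E1 \<union> E2) \<le> gsup u V + e"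
    by (rule gsup_inner_regular[OF bounded_opens_Un[OF E1 E2] u e]) (rule that)
  have "compact (K - E2)" "K - E2 \<subseteq> E1" using K(1,2) o by (auto intro: compact_diff)
  then obtain W L where WL: "open W" "compact L" "K - E2 \<subseteq> W" "W \<subseteq> L" "L \<subseteq> E1"
    using compact_between[OF _ o(1)] by blast
  have "gsup u (E1 \<union> E2) \<le> gsup u (W \<union> E2) + e"
    by (rule K(3)) (use WL o in auto)
  also have "gsup u (W \<union> E2) \<le> gsup u E1 + gsup u E2"
    by (rule gsup_subadditive_compact[OF E1 E2 WL(1,4,2,5) u])
  finally show "gsup u (E1 \<union> E2) \<le> gsup u E1 + gsup u E2 + e" by simp
qed

text \<open>With \<open>K\<close> from inner regularity and \<open>W\<close> in the countable family
  between \<open>K\<close> and \<open>D\<close>, the upper limit on \<open>D\<close> is at most that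
  on \<open>W\<close> plus \<open>e\<close>; on \<open>W\<close> both limits agree, and the lower
  limit is monotone.\<close>

lemma Gamma_convergence_on_all_opens:
  assumes V: "\<And>K D. compact K \<Longrightarrow> D \<in> bounded_opens \<Longrightarrow> K \<subseteq> D \<Longrightarrow> \<exists>V\<in>\<V>. K \<subseteq> V \<and> V \<subseteq> D" "\<V> \<subseteq> bounded_opens"
    and conv: "\<And>V u. V \<in> \<V> \<Longrightarrow> u \<in> Lp p V \<Longrightarrow> ginf u V = gsup u V"
    and D: "D \<in> bounded_opens" and u: "u \<in> Lp p D"
  shows "ginf u D = gsup u D"
proof -
  define u' where "u' x = (if x \<in> D then u x else 0)" for x
  have u': "u' \<in> Lp p UNIV" unfolding u'_def by (rule Lp_extend[OF u bounded_opens_sets[OF D]])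
  note L = Lp_UNIV_subset[OF u' bounded_opens_sets]
  have "gsup u' D \<le> ginf u' D"
  proof (rule field_le_epsilon)
    fix e :: real assume e: "0 < e"
    obtain K where K: "compact K" "K \<subseteq> D" "\<And>V. open V \<Longrightarrow> K \<subseteq> V \<Longrightarrow> V \<subseteq> D \<Longrightarrow> gsup u' D \<le> gsup u' V + e"
      by (rule gsup_inner_regular[OF D u' e]) (rule that)
    obtain W where W: "W \<in> \<V>" "K \<subseteq> W" "W \<subseteq> D" using V(1)[OF K(1) D K(2)] by blast
    have Wb: "W \<in> bounded_opens" using W V(2) by blast
    have "gsup u' D \<le> gsup u' W + e" using K(3)[of W] W Wb by (simp add: bounded_opens_def)
    also have "gsup u' W = ginf u' W" using conv[OF W(1) L[OF Wb]] by simp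
    also have "ginf u' W \<le> ginf u' D" by (rule ginf_mono[OF Wb D W(3) L[OF D]])
    finally show "gsup u' D \<le> ginf u' D + e" by simp
  qed
  then have "gsup u' D = ginf u' D" using ginf_le_gsup[OF D L[OF D]] by simp
  moreover have "ginf u D = ginf u' D" "gsup u D = gsup u' D"
    by (rule ginf_cong[OF D u]; simp add: u'_def)+
  ultimately show ?thesis by simp
qed

end

section \<open>The measure property and the compactness theorem\<close>

text \<open>Caratheodory's construction with the outer measure \<open>\<beta>\<close> induced by
  open supersets. The compact sets in the hypothesis \<open>inner\<close> are used twice:
  compactness reduces countable covers to finite ones, which yields countable subadditivity, and it
  makes superadditivity for disjoint open sets strong enough to show that open sets are
  measurable.\<close>

theorem De_Giorgi_Letta:
  fixes \<alpha> :: "'a::euclidean_space set \<Rightarrow> real"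
  assumes D: "open D" and nonneg: "\<And>B. open B \<Longrightarrow> B \<subseteq> D \<Longrightarrow> 0 \<le> \<alpha> B" and empty: "\<alpha> {} = 0"
    and mono: "\<And>B B'. open B \<Longrightarrow> open B' \<Longrightarrow> B \<subseteq> B' \<Longrightarrow> B' \<subseteq> D \<Longrightarrow> \<alpha> B \<le> \<alpha> B'"
    and sub: "\<And>B B'. open B \<Longrightarrow> open B' \<Longrightarrow> B \<subseteq> D \<Longrightarrow> B' \<subseteq> D \<Longrightarrow> \<alpha> (B \<union> B') \<le> \<alpha> B + \<alpha> B'"
    and super: "\<And>B B'. open B \<Longrightarrow> open B' \<Longrightarrow> B \<subseteq> D \<Longrightarrow> B' \<subseteq> D \<Longrightarrow> B \<inter> B' = {} \<Longrightarrow> \<alpha> B + \<alpha> B' \<le> \<alpha> (B \<union> B')"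
    and inner: "\<And>B e. open B \<Longrightarrow> B \<subseteq> D \<Longrightarrow> 0 < e \<Longrightarrow>
       \<exists>K. compact K \<and> K \<subseteq> B \<and> (\<forall>V. open V \<longrightarrow> K \<subseteq> V \<longrightarrow> V \<subseteq> B \<longrightarrow> \<alpha> B \<le> \<alpha> V + e)"
  shows "\<exists>\<mu>. space \<mu> = D \<and> sets \<mu> = sets (restrict_space borel D) \<and>
    (\<forall>B. open B \<and> B \<subseteq> D \<longrightarrow> emeasure \<mu> B = ennreal (\<alpha> B))"
proof -
  define \<beta> where "\<beta> E = (INF B\<in>{B. open B \<and> E \<subseteq> B \<and> B \<subseteq> D}. ennreal (\<alpha> B))" for E
  have \<beta>_le: "\<beta> E \<le> ennreal (\<alpha> B)" if "open B" "E \<subseteq> B" "B \<subseteq> D" for E B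
    unfolding \<beta>_def using that by (intro INF_lower) auto
  have \<beta>_open: "\<beta> B = ennreal (\<alpha> B)" if "open B" "B \<subseteq> D" for B
  proof (rule antisym[OF \<beta>_le])
    show "ennreal (\<alpha> B) \<le> \<beta> B"
      unfolding \<beta>_def using mono[OF that(1)] by (intro INF_greatest ennreal_leI) auto
  qed (use that in auto)
  have \<beta>_mono: "\<beta> E \<le> \<beta> E'" if "E \<subseteq> E'" for E E'
    unfolding \<beta>_def using that by (intro INF_superset_mono) auto
  have fin_sub: "\<alpha> (\<Union>n<N. B n) \<le> (\<Sum>n<N. \<alpha> (B n))" if "\<And>n. open (B n)" "\<And>n. B n \<subseteq> D" for B :: "nat \<Rightarrow> 'a set" and N
  proof (induction N)
    case (Suc N)
    have "\<alpha> ((\<Union>n<N. B n) \<union> B N) \<le> \<alpha> (\<Union>n<N. B n) + \<alpha> (B N)"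
      by (rule sub) (use that in auto)
    moreover have "(\<Union>n<Suc N. B n) = (\<Union>n<N. B n) \<union> B N" by (auto simp: lessThan_Suc)
    ultimately show ?case using Suc by simp
  qed (simp add: empty)
  have countable_sub: "ennreal (\<alpha> (\<Union>n. B n)) \<le> (\<Sum>n. ennreal (\<alpha> (B n)))"
    if B: "\<And>n. open (B n)" "\<And>n. B n \<subseteq> D" for B :: "nat \<Rightarrow> 'a set"
  proof (rule ennreal_le_epsilon)
    fix e :: real assume "0 < e"
    have U: "open (\<Union>n. B n)" "(\<Union>n. B n) \<subseteq> D" using B by auto
    obtain K where K: "compact K" "K \<subseteq> (\<Union>n. B n)" "\<And>V. open V \<Longrightarrow> K \<subseteq> V \<Longrightarrow> V \<subseteq> (\<Union>n. B n) \<Longrightarrow> \<alpha> (\<Union>n. B n) \<le> \<alpha> V + e"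
      using inner[OF U \<open>0 < e\<close>] by blast
    obtain C where C: "finite C" "K \<subseteq> (\<Union>n\<in>C. B n)"
      using compactE_image[OF K(1), of UNIV B] B(1) K(2) by metis
    obtain N where N: "C \<subseteq> {..<N}" using finite_nat_bounded[OF C(1)] by blast
    have "\<alpha> (\<Union>n. B n) \<le> \<alpha> (\<Union>n<N. B n) + e"
    proof (rule K(3))
      have "(\<Union>n\<in>C. B n) \<subseteq> (\<Union>n<N. B n)" by (rule UN_mono[OF N]) simp
      then show "K \<subseteq> (\<Union>n<N. B n)" using C(2) by blast
    qed (use B in auto)
    also have "\<dots> \<le> (\<Sum>n<N. \<alpha> (B n)) + e" using fin_sub[OF B] by simp
    finally have "ennreal (\<alpha> (\<Union>n. B n)) \<le> ennreal ((\<Sum>n<N. \<alpha> (B n)) + e)" by (rule ennreal_leI)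
    also have "\<dots> = (\<Sum>n<N. ennreal (\<alpha> (B n))) + ennreal e"
      using \<open>0 < e\<close> nonneg[OF B] by (simp add: ennreal_plus sum_nonneg sum_ennreal)
    also have "\<dots> \<le> (\<Sum>n. ennreal (\<alpha> (B n))) + ennreal e" by (intro add_right_mono sum_le_suminf) auto
    finally show "ennreal (\<alpha> (\<Union>n. B n)) \<le> (\<Sum>n. ennreal (\<alpha> (B n))) + ennreal e" .
  qed
  have csa: "\<beta> (\<Union>n. E n) \<le> (\<Sum>n. \<beta> (E n))" if E: "\<And>n. E n \<subseteq> D" for E :: "nat \<Rightarrow> 'a set"
  proof (rule ennreal_le_epsilon)
    fix e :: real assume e: "0 < e"
    have "\<exists>B. open B \<and> E n \<subseteq> B \<and> B \<subseteq> D \<and> ennreal (\<alpha> B) < \<beta> (E n) + ennreal (e * (1/2) ^ Suc n)" for n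
    proof -
      have "\<beta> (E n) \<le> ennreal (\<alpha> D)" by (rule \<beta>_le[OF D E]) simp
      then have "\<beta> (E n) \<noteq> top" by (auto simp: top_unique)
      then have "\<beta> (E n) < \<beta> (E n) + ennreal (e * (1/2) ^ Suc n)"
        using e by (auto simp: less_top)
      then show ?thesis unfolding \<beta>_def INF_less_iff by blast
    qed
    then obtain B where B: "\<And>n. open (B n)" "\<And>n. E n \<subseteq> B n" "\<And>n. B n \<subseteq> D"
       "\<And>n. ennreal (\<alpha> (B n)) < \<beta> (E n) + ennreal (e * (1/2) ^ Suc n)" by metis
    have "\<beta> (\<Union>n. E n) \<le> ennreal (\<alpha> (\<Union>n. B n))" by (rule \<beta>_le) (use B(1-3) in blast)+
    also have "\<dots> \<le> (\<Sum>n. ennreal (\<alpha> (B n)))" by (rule countable_sub[OF B(1,3)])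
    also have "\<dots> \<le> (\<Sum>n. \<beta> (E n) + ennreal (e * (1/2) ^ Suc n))"
      using B(4) by (intro suminf_le less_imp_le) auto
    also have "\<dots> = (\<Sum>n. \<beta> (E n)) + (\<Sum>n. ennreal (e * (1/2) ^ Suc n))"
      by (rule suminf_add[symmetric]) auto
    also have "(\<Sum>n. ennreal (e * (1/2) ^ Suc n)) = ennreal e"
    proof -
      have "(\<lambda>n. e * (1/2) ^ Suc n) sums (e * 1)" by (rule sums_mult[OF power_half_series])
      then show ?thesis
        using e by (subst suminf_ennreal2) (auto simp: sums_iff simp del: power_Suc)
    qed
    finally show "\<beta> (\<Union>n. E n) \<le> (\<Sum>n. \<beta> (E n)) + ennreal e" .
  qed
  have \<beta>_empty: "\<beta> {} = 0" using \<beta>_open[of "{}"] empty by simp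
  have oms: "outer_measure_space (Pow D) \<beta>"
    unfolding outer_measure_space_def
  proof (intro conjI)
    show "positive (Pow D) \<beta>" using \<beta>_empty by (simp add: positive_def)
    show "increasing (Pow D) \<beta>" using \<beta>_mono by (simp add: increasing_def)
    show "countably_subadditive (Pow D) \<beta>"
      unfolding countably_subadditive_def by (intro allI impI csa) auto
  qed
  interpret P: sigma_algebra D "Pow D" by (rule sigma_algebra_Pow)
  define \<L> where "\<L> = lambda_system D (Pow D) \<beta>"
  have ms: "measure_space D \<L> \<beta>" using P.caratheodory_lemma[OF oms] by (simp add: \<L>_def)
  interpret L: sigma_algebra D \<L> using ms by (simp add: measure_space_def)
  have two_sub: "\<beta> (E \<union> E') \<le> \<beta> E + \<beta> E'" if "E \<subseteq> D" "E' \<subseteq> D" for E E'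
  proof -
    have "\<beta> (\<Union>n. (\<lambda>n::nat. if n = 0 then E else if n = 1 then E' else {}) n) \<le> (\<Sum>n. \<beta> ((\<lambda>n::nat. if n = 0 then E else if n = 1 then E' else {}) n))"
      by (rule csa) (use that in auto)
    also have "\<dots> = (\<Sum>n\<in>{0, 1}. \<beta> ((\<lambda>n::nat. if n = 0 then E else if n = 1 then E' else {}) n))"
      by (rule suminf_finite) (auto simp: \<beta>_empty)
    also have "(\<Union>n. (\<lambda>n::nat. if n = 0 then E else if n = 1 then E' else {}) n) = E \<union> E'"
      by (auto split: if_splits)
    finally show ?thesis by simp
  qed
  have open_in: "B \<in> \<L>" if B: "open B" "B \<subseteq> D" for B
    unfolding \<L>_def P.lambda_system_eq
  proof (intro CollectI conjI ballI)
    show "B \<in> Pow D" using B by simp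
    fix E assume E: "E \<in> Pow D"
    show "\<beta> (E \<inter> B) + \<beta> (E - B) = \<beta> E"
    proof (rule antisym)
      have "E = (E \<inter> B) \<union> (E - B)" by blast
      then show "\<beta> E \<le> \<beta> (E \<inter> B) + \<beta> (E - B)" using two_sub[of "E \<inter> B" "E - B"] E by auto
      show "\<beta> (E \<inter> B) + \<beta> (E - B) \<le> \<beta> E"
        unfolding \<beta>_def[of E]
      proof (rule INF_greatest)
        fix G assume "G \<in> {B. open B \<and> E \<subseteq> B \<and> B \<subseteq> D}"
        then have G: "open G" "E \<subseteq> G" "G \<subseteq> D" by auto
        show "\<beta> (E \<inter> B) + \<beta> (E - B) \<le> ennreal (\<alpha> G)"
        proof (rule ennreal_le_epsilon)
          fix e :: real assume e: "0 < e"
          have GB: "open (G \<inter> B)" "G \<inter> B \<subseteq> D" using G B by auto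
          \<comment> \<open>\<open>G - B\<close> need not be open, so superadditivity cannot be
            applied to it directly. At the cost of \<open>e\<close>, the set
            \<open>G \<inter> B\<close> is shrunk to \<open>W\<close>, which leaves the open set
            \<open>G - L\<close>: it is disjoint from \<open>W\<close> and still contains
            \<open>E - B\<close>.\<close>
          obtain K where K: "compact K" "K \<subseteq> G \<inter> B" "\<And>V. open V \<Longrightarrow> K \<subseteq> V \<Longrightarrow> V \<subseteq> G \<inter> B \<Longrightarrow> \<alpha> (G \<inter> B) \<le> \<alpha> V + e"
            using inner[OF GB e] by blast
          obtain W L where WL: "open W" "compact L" "K \<subseteq> W" "W \<subseteq> L" "L \<subseteq> G \<inter> B"
            using compact_between[OF K(1) GB(1) K(2)] by blast
          have oGL: "open (G - L)" using G(1) WL(2) by (simp add: open_Diff compact_imp_closed)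
          have W: "W \<subseteq> D" "G - L \<subseteq> D" "W \<inter> (G - L) = {}" "W \<union> (G - L) \<subseteq> G" using WL G by auto
          have "\<alpha> W + \<alpha> (G - L) \<le> \<alpha> (W \<union> (G - L))" by (rule super[OF WL(1) oGL W(1,2,3)])
          also have "\<dots> \<le> \<alpha> G" by (rule mono[OF _ G(1) W(4) G(3)]) (use WL(1) oGL in auto)
          finally have "\<alpha> W + \<alpha> (G - L) \<le> \<alpha> G" .
          moreover have "\<alpha> (G \<inter> B) \<le> \<alpha> W + e" by (rule K(3)[OF WL(1,3)]) (use WL in auto)
          ultimately have le: "\<alpha> (G \<inter> B) + \<alpha> (G - L) \<le> \<alpha> G + e" by simp
          have "\<beta> (E \<inter> B) + \<beta> (E - B) \<le> ennreal (\<alpha> (G \<inter> B)) + ennreal (\<alpha> (G - L))"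
            using G WL by (intro add_mono \<beta>_le GB oGL W(2)) auto
          also have "\<dots> = ennreal (\<alpha> (G \<inter> B) + \<alpha> (G - L))"
            using nonneg[OF GB] nonneg[OF oGL W(2)] by simp
          also have "\<dots> \<le> ennreal (\<alpha> G + e)" by (rule ennreal_leI[OF le])
          also have "\<dots> = ennreal (\<alpha> G) + ennreal e" using nonneg[OF G(1,3)] e by simp
          finally show "\<beta> (E \<inter> B) + \<beta> (E - B) \<le> ennreal (\<alpha> G) + ennreal e" .
        qed
      qed
    qed
  qed
  have borel_in: "B \<inter> D \<in> \<L>" if "B \<in> sets borel" for B
  proof -
    have "B \<in> sigma_sets UNIV {S. open S}" using that by (simp add: sets_borel)
    then show ?thesis
    proof (induction rule: sigma_sets.induct)
      case (Basic S)
      then show ?case using D by (intro open_in) auto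
    next
      case (Compl S)
      have "(UNIV - S) \<inter> D = D - (S \<inter> D)" by blast
      then show ?case using Compl by (simp add: L.compl_sets)
    next
      case (Union S)
      have "(\<Union>i. S i) \<inter> D = (\<Union>i. S i \<inter> D)" by blast
      then show ?case using Union L.countable_nat_UN[of "\<lambda>i. S i \<inter> D"] by auto
    qed simp
  qed
  let ?R = "sets (restrict_space borel D)"
  have R: "?R = (\<lambda>B. B \<inter> D) ` sets borel" by (auto simp: sets_restrict_space)
  have sR: "sigma_algebra D ?R" using sets.sigma_algebra_axioms[of "restrict_space borel D"] by (simp add: space_restrict_space)
  have "?R \<subseteq> \<L>" unfolding R using borel_in by auto
  then have mR: "measure_space D ?R \<beta>" by (rule measure_down[OF ms sR])
  define \<mu> where "\<mu> = measure_of D ?R \<beta>"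
  have RP: "?R \<subseteq> Pow D" using sR by (simp add: sigma_algebra_iff2)
  show ?thesis
  proof (intro exI[of _ \<mu>] conjI allI impI)
    show "space \<mu> = D" unfolding \<mu>_def by (rule space_measure_of[OF RP])
    show "sets \<mu> = ?R" unfolding \<mu>_def using sigma_algebra.sets_measure_of_eq[OF sR] by simp
    fix B assume B: "open B \<and> B \<subseteq> D"
    then have "B \<in> ?R" unfolding R by (intro image_eqI[of _ _ B]) auto
    then have "emeasure \<mu> B = \<beta> B"
      unfolding \<mu>_def using mR by (intro emeasure_measure_of_sigma[OF sR]) (auto simp: measure_space_def)
    then show "emeasure \<mu> B = ennreal (\<alpha> B)" using \<beta>_open B by simp
  qed
qed

section \<open>Membership of the limit in the three classes\<close>

context class_I_sequence
begin

text \<open>Once the limits coincide, subadditivity and inner regularity of the upper limit and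
  superadditivity of the lower one hold for the same set function, as the criterion for measures
  requires.\<close>

lemma ginf_in_class_I:
  assumes conv: "\<And>D u. D \<in> bounded_opens \<Longrightarrow> u \<in> Lp p D \<Longrightarrow> gsup u D = ginf u D"
  shows "ginf \<in> class_I p c0"
  unfolding class_I_def
proof (intro CollectI ballI conjI impI)
  fix D :: "(real^'n) set" and u :: "real^'n \<Rightarrow> real^'d" assume D: "D \<in> bounded_opens" and u: "u \<in> Lp p D"
  have oD: "open D" using D by (simp add: bounded_opens_def)
  show "ginf u D = ginf v D" if "v \<in> Lp p D" "AE x in lebesgue_on D. u x = v x" for v
    by (rule ginf_cong_AE(1)[OF D u that])
  show "0 \<le> ginf u D" by (rule ginf_nonneg[OF D u])
  show "(1 / c0) * Lp_norm p D u powr p - c0 * measure lebesgue D \<le> ginf u D"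
    using ginf_lower[OF D u] by (simp add: Lp_norm_powr[OF p0])
  show "ginf u D \<le> c0 * (measure lebesgue D + Lp_norm p D u powr p)"
    using gsup_upper[OF D u] by (simp add: Lp_norm_powr[OF p0] conv[OF D u])
  \<comment> \<open>Subadditivity and inner regularity are stated for functions on the whole space;
    since the limit on a set depends only on the values there, the result transfers back to
    \<open>u\<close>.\<close>
  define u' where "u' x = (if x \<in> D then u x else 0)" for x
  have u': "u' \<in> Lp p UNIV" unfolding u'_def by (rule Lp_extend[OF u bounded_opens_sets[OF D]])
  have b: "B \<in> bounded_opens" if "open B" "B \<subseteq> D" for B by (rule bounded_opens_subset[OF D that])
  note L = Lp_UNIV_subset[OF u' bounded_opens_sets]
  have "\<exists>\<mu>. space \<mu> = D \<and> sets \<mu> = sets (restrict_space borel D) \<and>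
    (\<forall>B. open B \<and> B \<subseteq> D \<longrightarrow> emeasure \<mu> B = ennreal (ginf u' B))"
  proof (rule De_Giorgi_Letta[OF oD])
    show "0 \<le> ginf u' B" if "open B" "B \<subseteq> D" for B by (rule ginf_nonneg[OF b[OF that] L[OF b[OF that]]])
    have e: "{} \<in> bounded_opens" by (simp add: bounded_opens_def)
    show "ginf u' {} = 0"
      using ginf_nonneg[OF e L[OF e]] gsup_upper[OF e L[OF e]] conv[OF e L[OF e]] by simp
    show "ginf u' B \<le> ginf u' B'" if "open B" "open B'" "B \<subseteq> B'" "B' \<subseteq> D" for B B'
      by (rule ginf_mono[OF b b that(3) L[OF b]]) (use that in auto)
    show "ginf u' (B \<union> B') \<le> ginf u' B + ginf u' B'" if "open B" "open B'" "B \<subseteq> D" "B' \<subseteq> D" for B B'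
    proof -
      note B = b[OF that(1,3)] and B' = b[OF that(2,4)]
      show ?thesis using gsup_subadditive[OF B B' u'] conv[OF B L[OF B]] conv[OF B' L[OF B']]
          conv[OF bounded_opens_Un[OF B B'] L[OF bounded_opens_Un[OF B B']]] by simp
    qed
    show "ginf u' B + ginf u' B' \<le> ginf u' (B \<union> B')" if "open B" "open B'" "B \<subseteq> D" "B' \<subseteq> D" "B \<inter> B' = {}" for B B'
    proof -
      note U = bounded_opens_Un[OF b[OF that(1,3)] b[OF that(2,4)]]
      show ?thesis by (rule ginf_superadditive[OF U that(1,2,5) subset_refl L[OF U]])
    qed
    show "\<exists>K. compact K \<and> K \<subseteq> B \<and> (\<forall>V. open V \<longrightarrow> K \<subseteq> V \<longrightarrow> V \<subseteq> B \<longrightarrow> ginf u' B \<le> ginf u' V + e)"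
      if B: "open B" "B \<subseteq> D" and e: "0 < e" for B e
    proof -
      obtain K where K: "compact K" "K \<subseteq> B" "\<And>V. open V \<Longrightarrow> K \<subseteq> V \<Longrightarrow> V \<subseteq> B \<Longrightarrow> gsup u' B \<le> gsup u' V + e"
        by (rule gsup_inner_regular[OF b[OF B] u' e]) (rule that)
      have "ginf u' B \<le> ginf u' V + e" if V: "open V" "K \<subseteq> V" "V \<subseteq> B" for V
      proof -
        have VD: "V \<in> bounded_opens" using V B b by blast
        show ?thesis using K(3)[OF V] conv[OF VD L[OF VD]] conv[OF b[OF B] L[OF b[OF B]]] by simp
      qed
      then show ?thesis using K(1,2) by blast
    qed
  qed
  moreover have "ginf u' B = ginf u B" if "open B" "B \<subseteq> D" for B
    by (rule ginf_cong(1)[OF b[OF that] L[OF b[OF that]]]) (use that in \<open>auto simp: u'_def\<close>)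
  ultimately show "\<exists>\<mu>. space \<mu> = D \<and> sets \<mu> = sets (restrict_space borel D) \<and>
    (\<forall>B. open B \<and> B \<subseteq> D \<longrightarrow> emeasure \<mu> B = ennreal (ginf u B))" by simp
qed

lemma ginf_in_class_I_sc:
  assumes conv: "\<And>D u. D \<in> bounded_opens \<Longrightarrow> u \<in> Lp p D \<Longrightarrow> gsup u D = ginf u D"
  shows "ginf \<in> class_I_sc A p q c0"
  unfolding class_I_sc_def lower_semicontinuous_on_top_def
proof (intro CollectI conjI ballI allI ginf_in_class_I conv)
  fix D :: "(real^'n) set" and c :: real assume D: "D \<in> bounded_opens"
  have "{u \<in> topspace (A_topology A p q D). c < ginf u D} = {u \<in> topspace (A_topology A p q D). ereal c < Ginf u D}"
    using Gsup_ginf_real(2)[OF D] by (auto simp: topspace_A_topology)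
  then show "openin (A_topology A p q D) {u \<in> topspace (A_topology A p q D). c < ginf u D}"
    using openin_less_Gamma_liminf[of "A_topology A p q D" "ereal c"] by (simp add: Ginf_def)
qed

text \<open>If \<open>w\<close> is almost optimal for \<open>u\<close>, then
  \<open>w + (v - u)\<close> is a competitor for \<open>v\<close>: it is as far from
  \<open>v\<close> as \<open>w\<close> is from \<open>u\<close>, and it differs from
  \<open>w\<close> by \<open>v - u\<close>. The Lipschitz estimate for \<open>f k\<close> thus holds
  with the same norm for every \<open>k\<close>.\<close>

lemma ginf_Lipschitz_aux:
  assumes conv: "\<And>D u. D \<in> bounded_opens \<Longrightarrow> u \<in> Lp p D \<Longrightarrow> gsup u D = ginf u D"
    and lip: "\<And>k. f k \<in> class_I_Lip p c0 c1" and c1: "0 \<le> c1"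
    and D: "D \<in> bounded_opens" and u: "u \<in> Lp p D" and v: "v \<in> Lp p D"
  shows "ginf v D \<le> ginf u D + c1 * (measure lebesgue D powr ((p - 1) / p) + ginf u D powr ((p - 1) / p)
     + Lp_norm p D (\<lambda>x. u x - v x) powr (p - 1)) * Lp_norm p D (\<lambda>x. u x - v x)"
proof -
  define d where "d = Lp_norm p D (\<lambda>x. u x - v x)"
  define m where "m = measure lebesgue D powr ((p - 1) / p)"
  have d0: "0 \<le> d" by (simp add: d_def Lp_norm_nonneg)
  have a0: "0 < (p - 1) / p" using p by simp
  define \<Psi> where "\<Psi> t = t + c1 * (m + t powr ((p - 1) / p) + d powr (p - 1)) * d" for t
  have le: "ginf v D \<le> \<Psi> (ginf u D + \<eta>)" if \<eta>: "0 < \<eta>" for \<eta>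
  proof -
    have "gsup v D \<le> \<Psi> (ginf u D + \<eta>)"
    proof (rule gsup_leI[OF D v])
      fix r :: real assume r: "0 < r"
      have "\<forall>\<^sub>F k in sequentially. \<exists>w\<in>A_ball A D u r. f k w D < ginf u D + \<eta>"
        by (rule gsup_lessD[OF D u _ r]) (use \<eta> conv[OF D u] in simp)
      then show "\<forall>\<^sub>F k in sequentially. \<exists>w\<in>A_ball A D v r. f k w D \<le> \<Psi> (ginf u D + \<eta>)"
      proof eventually_elim
        case (elim k)
        then obtain w where w: "w \<in> A_ball A D u r" "f k w D < ginf u D + \<eta>" by blast
        have wL: "w \<in> Lp p D" using w by (simp add: A_ball_def)
        define w' where "w' x = w x + (v x - u x)" for x
        have w'L: "w' \<in> Lp p D" unfolding w'_def by (rule Lp_add[OF p0 wL Lp_diff[OF p0 v u]])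
        have "(\<lambda>x. w' x - v x) = (\<lambda>x. w x - u x)" by (auto simp: w'_def)
        then have ball: "w' \<in> A_ball A D v r" using w(1) w'L by (simp add: A_ball_def)
        have dw: "(\<lambda>x. w x - w' x) = (\<lambda>x. u x - v x)" by (auto simp: w'_def)
        have nn: "0 \<le> f k w D" "0 \<le> f k w' D" using class_I_nonneg[OF f D] wL w'L by auto
        have "\<bar>f k w D - f k w' D\<bar> \<le> c1 * (m + min (f k w D) (f k w' D) powr ((p - 1) / p) + d powr (p - 1)) * d"
          using lip[of k] D wL w'L unfolding class_I_Lip_def m_def d_def dw[symmetric] by blast
        \<comment> \<open>The minimum is at most \<open>f k w D\<close>, which lies below
          \<open>ginf u D + \<eta>\<close>; in this way the bound comes to involve the limit at
          \<open>u\<close> only.\<close>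
        also have "\<dots> \<le> c1 * (m + (ginf u D + \<eta>) powr ((p - 1) / p) + d powr (p - 1)) * d"
          using w(2) nn a0 c1 d0
          by (intro mult_right_mono mult_left_mono add_right_mono add_left_mono powr_mono2) auto
        finally have "f k w' D \<le> \<Psi> (ginf u D + \<eta>)" using w(2) unfolding \<Psi>_def by linarith
        then show ?case using ball by blast
      qed
    qed
    then show ?thesis using conv[OF D v] by simp
  qed
  \<comment> \<open>The limit at \<open>u\<close> may be 0; the positive exponent
    \<open>(p - 1) / p\<close> makes the power continuous there as well.\<close>
  have "(\<lambda>n. \<Psi> (ginf u D + inverse (real (Suc n)))) \<longlonglongrightarrow> \<Psi> (ginf u D)"
  proof -
    have t: "(\<lambda>n. ginf u D + inverse (real (Suc n))) \<longlonglongrightarrow> ginf u D"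
      using tendsto_add[OF tendsto_const[of "ginf u D"] LIMSEQ_inverse_real_of_nat] by simp
    have "0 \<le> ginf u D + inverse (real (Suc n))" for n using ginf_nonneg[OF D u] by simp
    then have "(\<lambda>n. (ginf u D + inverse (real (Suc n))) powr ((p - 1) / p)) \<longlonglongrightarrow> ginf u D powr ((p - 1) / p)"
      using a0 by (intro tendsto_powr' t tendsto_const) (simp del: of_nat_Suc)
    then show ?thesis unfolding \<Psi>_def by (intro tendsto_add tendsto_mult tendsto_const t)
  qed
  then have "ginf v D \<le> \<Psi> (ginf u D)" by (rule LIMSEQ_le_const) (use le in auto)
  then show ?thesis by (simp add: \<Psi>_def m_def d_def)
qed

lemma ginf_in_class_I_Lip:
  assumes conv: "\<And>D u. D \<in> bounded_opens \<Longrightarrow> u \<in> Lp p D \<Longrightarrow> gsup u D = ginf u D"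
    and lip: "\<And>k. f k \<in> class_I_Lip p c0 c1" and c1: "0 \<le> c1"
  shows "ginf \<in> class_I_Lip p c0 c1"
  unfolding class_I_Lip_def
proof (intro CollectI conjI ballI ginf_in_class_I conv)
  fix D :: "(real^'n) set" and u v :: "real^'n \<Rightarrow> real^'d" assume D: "D \<in> bounded_opens" and u: "u \<in> Lp p D" and v: "v \<in> Lp p D"
  note 1 = ginf_Lipschitz_aux[OF conv lip c1 D u v]
  note 2 = ginf_Lipschitz_aux[OF conv lip c1 D v u, unfolded Lp_norm_minus_commute[of p D v u]]
  show "\<bar>ginf u D - ginf v D\<bar> \<le> c1 * (measure lebesgue D powr ((p - 1) / p) + min (ginf u D) (ginf v D) powr ((p - 1) / p)
             + Lp_norm p D (\<lambda>x. u x - v x) powr (p - 1)) * Lp_norm p D (\<lambda>x. u x - v x)"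
  \<comment> \<open>The one-sided estimate with the larger limit on the left has the smaller one on
    the right, and that is the required minimum.\<close>
  proof (cases "ginf u D \<le> ginf v D")
    case True
    then have "min (ginf u D) (ginf v D) = ginf u D" "\<bar>ginf u D - ginf v D\<bar> = ginf v D - ginf u D" by auto
    then show ?thesis using 1 by simp
  next
    case False
    then have "min (ginf u D) (ginf v D) = ginf v D" "\<bar>ginf u D - ginf v D\<bar> = ginf u D - ginf v D" by auto
    then show ?thesis using 2 by simp
  qed
qed

end

section \<open>Choice of the subsequence and conclusion\<close>

theorem theorem3p1:
  fixes p q c0 c1 c1hat :: real
    and A :: "'n::finite \<Rightarrow> real^'d::finite^'l::finite"
    and Fk :: "nat \<Rightarrow> ('n, 'd) functional"
  assumes "1 < p" and "1 < q" and "1 / p + 1 / q = 1"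
    and "constant_rank A"
    and "1 \<le> c0" and "1 \<le> c1hat" and "c1hat \<le> c1"
    and "span (wave_cone A) = UNIV \<Longrightarrow> quasiconvex_Lipschitz_const A p c0 c1hat"
    and "\<And>k. Fk k \<in> class_I p c0"
  shows "\<exists>s F. strict_mono s \<and> F \<in> class_I_sc A p q c0 \<and>
           (\<forall>D \<in> bounded_opens.
              Gamma_converges (A_topology A p q D) (\<lambda>k u. ereal (Fk (s k) u D))
                (\<lambda>u. ereal (F u D))) \<and>
           ((\<forall>k. Fk (s k) \<in> class_I_Lip p c0 c1) \<longrightarrow> F \<in> class_I_Lip p c0 c1)"
proof -
  interpret dual_exponents p q by unfold_locales (use assms in auto)
  obtain \<V> :: "(real^'n) set set" where V: "countable \<V>" "\<V> \<subseteq> bounded_opens"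
    "\<And>K D. compact K \<Longrightarrow> D \<in> bounded_opens \<Longrightarrow> K \<subseteq> D \<Longrightarrow> \<exists>V\<in>\<V>. K \<subseteq> V \<and> V \<subseteq> D"
    by (rule countable_open_family) (rule that)
  have "\<exists>\<B>. countable \<B> \<and> (\<forall>B\<in>\<B>. openin (A_topology A p q V) B) \<and>
    (\<forall>U u. openin (A_topology A p q V) U \<longrightarrow> u \<in> U \<longrightarrow> (\<exists>B\<in>\<B>. u \<in> B \<and> B \<subseteq> U))" if V': "V \<in> bounded_opens" for V
  proof -
    obtain \<B> where "countable \<B>" "\<And>B. B \<in> \<B> \<Longrightarrow> openin (A_topology A p q V) B"
      "\<And>U u. openin (A_topology A p q V) U \<Longrightarrow> u \<in> U \<Longrightarrow> \<exists>B\<in>\<B>. u \<in> B \<and> B \<subseteq> U"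
      by (rule A_topology_countable_base[OF V', where A=A]) (rule that)
    then show ?thesis by (intro exI[of _ \<B>]) simp
  qed
  then obtain \<B> where B: "\<And>V. V \<in> bounded_opens \<Longrightarrow> countable (\<B> V) \<and> (\<forall>B\<in>\<B> V. openin (A_topology A p q V) B) \<and>
    (\<forall>U u. openin (A_topology A p q V) U \<longrightarrow> u \<in> U \<longrightarrow> (\<exists>B\<in>\<B> V. u \<in> B \<and> B \<subseteq> U))" by metis
  \<comment> \<open>The index set consists of the pairs of a domain \<open>V\<close> in the
    countable family and a base set of its topology. Convergence of the infima over these base sets
    decides Gamma-convergence on \<open>V\<close> at every function.\<close>
  have "countable (SIGMA V:\<V>. \<B> V)" using V(1,2) B by (intro countable_SIGMA) auto
  then obtain s where s: "strict_mono s" "\<And>i. i \<in> (SIGMA V:\<V>. \<B> V) \<Longrightarrow>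
      convergent (\<lambda>k. (\<lambda>i k. INF v\<in>snd i. ereal (Fk k v (fst i))) i (s k))"
    by (rule countable_diagonal_convergent) (rule that)
  interpret class_I_sequence p q A c0 "\<lambda>k. Fk (s k)"
    by unfold_locales (use assms in auto)
  have "ginf u V = gsup u V" if VV: "V \<in> \<V>" and u: "u \<in> Lp p V" for V u
  proof -
    have Vb: "V \<in> bounded_opens" using VV V(2) by blast
    have "Ginf u V = Gsup u V"
      unfolding Ginf_def Gsup_def
    proof (rule Gamma_liminf_eq_limsup[of "\<B> V"])
      show "convergent (\<lambda>k. INF v\<in>B. ereal (Fk (s k) v V))" if "B \<in> \<B> V" for B
        using s(2)[of "(V, B)"] VV that by simp
    qed (use B[OF Vb] in blast)+
    then show ?thesis by (simp add: ginf_def gsup_def)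
  qed
  then have conv: "gsup u D = ginf u D" if "D \<in> bounded_opens" "u \<in> Lp p D" for D u
    using Gamma_convergence_on_all_opens[OF V(3,2) _ that] by simp
  have "Gamma_converges (A_topology A p q D) (\<lambda>k u. ereal (Fk (s k) u D)) (\<lambda>u. ereal (ginf u D))"
    if D: "D \<in> bounded_opens" for D
    unfolding Gamma_converges_def topspace_A_topology
    using Gsup_ginf_real[OF D] conv[OF D] by (simp add: Ginf_def Gsup_def)
  moreover have "ginf \<in> class_I_Lip p c0 c1" if "\<forall>k. Fk (s k) \<in> class_I_Lip p c0 c1"
    by (rule ginf_in_class_I_Lip[OF conv]) (use that assms in auto)
  ultimately show ?thesis
    using s(1) ginf_in_class_I_sc[OF conv] by (intro exI[of _ s] exI[of _ ginf] conjI ballI impI)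
qed

end
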